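(* Let $\Lambda$ be a weakly finite ring with $1$ and involution, let $\epsilon=(-1)^q$, and let $z=(F\xleftarrow{\gamma}G\xrightarrow{\mu}F^*,\bar\theta)$ be a regular $\epsilon$-quadratic split preformation over $\Lambda$. If $[z]\in l_{2q+2}(\Lambda)$ is elementary, then $\ker\gamma\cong\ker\mu$, $\operatorname{coker}\gamma\cong\operatorname{coker}\mu$, $\ker(\gamma^*\mu)\cong\ker\gamma\oplus\ker\gamma^*$, $\operatorname{coker}(\gamma^*\mu)\cong\operatorname{coker}\gamma\oplus\operatorname{coker}\gamma^*$, and $\operatorname{rk}F$ is even.
   Context: Conventions. A ring $\Lambda$ is weakly finite if for all $n\ge 0$ and all modules $K$, $\Lambda^n\cong\Lambda^n\oplus K$ implies $K=0$ (so ranks of finitely generated (f.g.) free modules are well defined). An involution is an anti-automorphism $x\mapsto\bar x$ of order two. Modules are left modules; $M^*=\mathrm{Hom}_\Lambda(M,\Lambda)$ with $(af)(x)=f(x)\bar a$; f.g. free modules are identified with their double duals. For $\phi\in\mathrm{Hom}_\Lambda(M,M^* )$, $\phi^*(x)(y)=\overline{\phi(y)(x)}$. For $e\in\{1,-1\}$ put $Q_e(\Lambda)=\Lambda/\{b-e\bar b\}$ and $Q_e(M)=\mathrm{Hom}_\Lambda(M,M^* )/\{\phi-e\phi^*\}$. An $e$-symmetric form is $(M,\lambda)$ with $\lambda=e\lambda^*\in\mathrm{Hom}_\Lambda(M,M^* )$. An $e$-quadratic form $(M,\lambda,\nu)$ is an $e$-symmetric form with a map $\nu:M\to Q_e(\Lambda)$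 such that $\nu(x+y)-\nu(x)-\nu(y)=\lambda(x,y)$ in $Q_e(\Lambda)$, $\nu(x)+e\overline{\nu(x)}=\lambda(x,x)$ and $\nu(ax)=a\nu(x)\bar a$. For $M$ f.g. free this is the same as a class $\psi\in Q_e(M)$, with $\lambda=\psi+e\psi^*$, $\nu(x)=\psi(x)(x)$. Preformations. An $\epsilon$-quadratic split preformation $(F\xleftarrow{\gamma}G\xrightarrow{\mu}F^*,\bar\theta)$ consists of a f.g. free module $F$, a f.g. module $G$, homomorphisms $\gamma:G\to F$, $\mu:G\to F^*$ and a map $\bar\theta:G\to Q_{-\epsilon}(\Lambda)$ such that $(G,\gamma^*\mu,\bar\theta)$ is a $(-\epsilon)$-quadratic form. It is regular if $G$ is free (then $\bar\theta$ is regarded as an element of $Q_{-\epsilon}(G)$ with $\theta-\epsilon\theta^*=\gamma^*\mu$). A strong isomorphism from $(F\xleftarrow{\gamma}G\xrightarrow{\mu}F^*,\bar\theta)$ to $(F'\xleftarrow{\gamma'}G'\xrightarrow{\mu'}F'^*,\bar\theta')$ is a pair of isomorphisms $a:F\to F'$, $b:G\to G'$ with $a\gamma=\gamma' b$, $(a^{-1})^*\mu=\mu' b$, $\bar\theta=\bar\theta' b$. Sums are direct sums. The hyperbolic preformation on a f.g. free module $P$ is $\partial H_{-\epsilon}(P)=\bigl(P\oplus P^*\xleftarrow{1}P\oplus P^*\xrightarrow{\begin{pmatrix}0&1\\-\epsilon&0\end{pmatrix}}P^*\oplus P,\begin{pmatrix}0&1\\0&0\end{pmatrix}\bigr)$.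 Two preformations are stably strongly isomorphic if they become strongly isomorphic after adding hyperbolic preformations. $l_{2q+2}(\Lambda)$ is the abelian monoid of stable strong isomorphism classes of regular $\epsilon$-quadratic split preformations. Elementary. A preformation is elementary if there is a f.g. free submodule $j:U\hookrightarrow G$ with $j^*\gamma^*\mu j=0$, $\bar\theta j=0$, such that $\gamma j$ and $\mu j$ are injective with images $U_0\subset F$, $U_1\subset F^*$ direct summands, and $F^*/U_1\to U_0^*$, $f\mapsto f|_{U_0}$, is an isomorphism. An element of $l_{2q+2}(\Lambda)$ is elementary if it has an elementary representative. *)

theory Defs
  imports "HOL-Algebra.Module" "HOL-Algebra.AbelCoset"
begin

section \<open>Rings with involution\<close>

record 'a involution_ring = "'a ring" +
  bar :: "'a \<Rightarrow> 'a" (\<open>bar\<index>\<close>)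

text \<open>The identity is allowed as an involution, if the ring is commutative.\<close>

locale involution_ring = ring \<Lambda> for \<Lambda> :: "'a involution_ring" (structure) +
  assumes bar_closed: "a \<in> carrier \<Lambda> \<Longrightarrow> bar a \<in> carrier \<Lambda>"
    and bar_add: "\<lbrakk>a \<in> carrier \<Lambda>; b \<in> carrier \<Lambda>\<rbrakk> \<Longrightarrow> bar (a \<oplus> b) = bar a \<oplus> bar b"
    and bar_mult: "\<lbrakk>a \<in> carrier \<Lambda>; b \<in> carrier \<Lambda>\<rbrakk> \<Longrightarrow> bar (a \<otimes> b) = bar b \<otimes> bar a"
    and bar_one: "bar \<one> = \<one>"
    and bar_bar: "a \<in> carrier \<Lambda> \<Longrightarrow> bar (bar a) = a"

section \<open>Left modules\<close>

text \<open>
  The library's locale \<open>module\<close> requires a commutative ring of scalars, so left modules over an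
  arbitrary ring are introduced here, on the library's record type. The fields \<open>mult\<close> and \<open>one\<close>
  of that record type play no role for modules.
\<close>

locale left_module = R?: ring R + M?: abelian_group M
  for R :: "('a, 'r) ring_scheme" (structure) and M :: "('a, 'b) module" (structure) +
  assumes smult_closed: "\<lbrakk>a \<in> carrier R; x \<in> carrier M\<rbrakk> \<Longrightarrow> a \<odot>\<^bsub>M\<^esub> x \<in> carrier M"
    and smult_l_distr: "\<lbrakk>a \<in> carrier R; b \<in> carrier R; x \<in> carrier M\<rbrakk> \<Longrightarrow>
      (a \<oplus> b) \<odot>\<^bsub>M\<^esub> x = a \<odot>\<^bsub>M\<^esub> x \<oplus>\<^bsub>M\<^esub> b \<odot>\<^bsub>M\<^esub> x"
    and smult_r_distr: "\<lbrakk>a \<in> carrier R; x \<in> carrier M; y \<in> carrier M\<rbrakk> \<Longrightarrow>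
      a \<odot>\<^bsub>M\<^esub> (x \<oplus>\<^bsub>M\<^esub> y) = a \<odot>\<^bsub>M\<^esub> x \<oplus>\<^bsub>M\<^esub> a \<odot>\<^bsub>M\<^esub> y"
    and smult_assoc: "\<lbrakk>a \<in> carrier R; b \<in> carrier R; x \<in> carrier M\<rbrakk> \<Longrightarrow>
      (a \<otimes> b) \<odot>\<^bsub>M\<^esub> x = a \<odot>\<^bsub>M\<^esub> (b \<odot>\<^bsub>M\<^esub> x)"
    and smult_one: "x \<in> carrier M \<Longrightarrow> \<one> \<odot>\<^bsub>M\<^esub> x = x"

definition mod_hom :: "('a, 'r) ring_scheme \<Rightarrow> ('a, 'b) module \<Rightarrow> ('a, 'c) module \<Rightarrow> ('b \<Rightarrow> 'c) set"
  where "mod_hom R M N = {f \<in> carrier M \<rightarrow> carrier N.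
    (\<forall>x\<in>carrier M. \<forall>y\<in>carrier M. f (x \<oplus>\<^bsub>M\<^esub> y) = f x \<oplus>\<^bsub>N\<^esub> f y) \<and>
    (\<forall>a\<in>carrier R. \<forall>x\<in>carrier M. f (a \<odot>\<^bsub>M\<^esub> x) = a \<odot>\<^bsub>N\<^esub> f x)}"

definition mod_iso :: "('a, 'r) ring_scheme \<Rightarrow> ('a, 'b) module \<Rightarrow> ('a, 'c) module \<Rightarrow> ('b \<Rightarrow> 'c) set"
  where "mod_iso R M N = {f \<in> mod_hom R M N. bij_betw f (carrier M) (carrier N)}"

definition isomorphic :: "('a, 'r) ring_scheme \<Rightarrow> ('a, 'b) module \<Rightarrow> ('a, 'c) module \<Rightarrow> bool"
  where "isomorphic R M N \<longleftrightarrow> mod_iso R M N \<noteq> {}"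

definition dsum :: "('a, 'b) module \<Rightarrow> ('a, 'c) module \<Rightarrow> ('a, 'b \<times> 'c) module"
  where "dsum M N =
    \<lparr>carrier = carrier M \<times> carrier N, mult = undefined, one = undefined,
     zero = (\<zero>\<^bsub>M\<^esub>, \<zero>\<^bsub>N\<^esub>), add = (\<lambda>(x, y) (x', y'). (x \<oplus>\<^bsub>M\<^esub> x', y \<oplus>\<^bsub>N\<^esub> y')),
     smult = (\<lambda>a (x, y). (a \<odot>\<^bsub>M\<^esub> x, a \<odot>\<^bsub>N\<^esub> y))\<rparr>"

definition restr_mod :: "('a, 'b) module \<Rightarrow> 'b set \<Rightarrow> ('a, 'b) module"
  where "restr_mod M U = M\<lparr>carrier := U\<rparr>"

definition quot_mod :: "('a, 'b) module \<Rightarrow> 'b set \<Rightarrow> ('a, 'b set) module"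
  where "quot_mod M U =
    \<lparr>carrier = a_rcosets\<^bsub>M\<^esub> U, mult = undefined, one = undefined,
     zero = U, add = (\<lambda>A B. A <+>\<^bsub>M\<^esub> B),
     smult = (\<lambda>a A. \<Union>x\<in>A. U +>\<^bsub>M\<^esub> (a \<odot>\<^bsub>M\<^esub> x))\<rparr>"

definition ker_mod :: "('a, 'b) module \<Rightarrow> ('a, 'c) module \<Rightarrow> ('b \<Rightarrow> 'c) \<Rightarrow> ('a, 'b) module"
  where "ker_mod M N f = restr_mod M {x \<in> carrier M. f x = \<zero>\<^bsub>N\<^esub>}"

definition coker_mod :: "('a, 'b) module \<Rightarrow> ('a, 'c) module \<Rightarrow> ('b \<Rightarrow> 'c) \<Rightarrow> ('a, 'c set) module"
  where "coker_mod M N f = quot_mod N (f ` carrier M)"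

definition direct_summand :: "('a, 'r) ring_scheme \<Rightarrow> ('a, 'b) module \<Rightarrow> 'b set \<Rightarrow> bool"
  where "direct_summand R M U \<longleftrightarrow> submodule U R M \<and>
    (\<exists>V. submodule V R M \<and> U \<inter> V = {\<zero>\<^bsub>M\<^esub>} \<and> U <+>\<^bsub>M\<^esub> V = carrier M)"

definition free_mod :: "('a, 'r) ring_scheme \<Rightarrow> nat \<Rightarrow> ('a, nat \<Rightarrow> 'a) module"
  where "free_mod R n =
    \<lparr>carrier = {..<n} \<rightarrow>\<^sub>E carrier R, mult = undefined, one = undefined,
     zero = (\<lambda>i\<in>{..<n}. \<zero>\<^bsub>R\<^esub>), add = (\<lambda>x y. \<lambda>i\<in>{..<n}. x i \<oplus>\<^bsub>R\<^esub> y i),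
     smult = (\<lambda>a x. \<lambda>i\<in>{..<n}. a \<otimes>\<^bsub>R\<^esub> x i)\<rparr>"

definition fg_mod :: "('a, 'r) ring_scheme \<Rightarrow> ('a, 'b) module \<Rightarrow> bool"
  where "fg_mod R M \<longleftrightarrow> left_module R M \<and>
    (\<exists>n. \<exists>f\<in>mod_hom R (free_mod R n) M. f ` carrier (free_mod R n) = carrier M)"

definition fg_free_mod :: "('a, 'r) ring_scheme \<Rightarrow> ('a, 'b) module \<Rightarrow> bool"
  where "fg_free_mod R M \<longleftrightarrow> left_module R M \<and> (\<exists>n. isomorphic R M (free_mod R n))"

text \<open>
  Over a nonzero weakly finite ring there is exactly one \<open>n\<close> as in the following definition. The
  zero ring is weakly finite as well; there the rank is \<open>0\<close> by this convention.
\<close>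

definition rank :: "('a, 'r) ring_scheme \<Rightarrow> ('a, 'b) module \<Rightarrow> nat"
  where "rank R M = (LEAST n. isomorphic R M (free_mod R n))"

text \<open>
  The modules \<open>K\<close> may be taken to live on the type \<open>nat \<Rightarrow> 'a\<close> without loss of generality: an
  isomorphism between \<open>free_mod R n\<close> and its direct sum with \<open>K\<close> embeds \<open>K\<close> into \<open>free_mod R n\<close>.
\<close>

definition weakly_finite :: "('a, 'r) ring_scheme \<Rightarrow> bool"
  where "weakly_finite R \<longleftrightarrow>
    (\<forall>n. \<forall>K :: ('a, nat \<Rightarrow> 'a) module. left_module R K \<longrightarrow>
      isomorphic R (free_mod R n) (dsum (free_mod R n) K) \<longrightarrow> carrier K = {\<zero>\<^bsub>K\<^esub>})"

section \<open>Duality and quadratic forms\<close>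

text \<open>The elements of the dual are taken extensional, so that they are equal iff they agree on
  the carrier of \<open>M\<close>.\<close>

definition dual :: "'a involution_ring \<Rightarrow> ('a, 'b) module \<Rightarrow> ('a, 'b \<Rightarrow> 'a) module"
  where "dual \<Lambda> M =
    \<lparr>carrier = {f \<in> carrier M \<rightarrow>\<^sub>E carrier \<Lambda>.
       (\<forall>x\<in>carrier M. \<forall>y\<in>carrier M. f (x \<oplus>\<^bsub>M\<^esub> y) = f x \<oplus>\<^bsub>\<Lambda>\<^esub> f y) \<and>
       (\<forall>a\<in>carrier \<Lambda>. \<forall>x\<in>carrier M. f (a \<odot>\<^bsub>M\<^esub> x) = a \<otimes>\<^bsub>\<Lambda>\<^esub> f x)},
     mult = undefined, one = undefined,
     zero = (\<lambda>x\<in>carrier M. \<zero>\<^bsub>\<Lambda>\<^esub>),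
     add = (\<lambda>f g. \<lambda>x\<in>carrier M. f x \<oplus>\<^bsub>\<Lambda>\<^esub> g x),
     smult = (\<lambda>a f. \<lambda>x\<in>carrier M. f x \<otimes>\<^bsub>\<Lambda>\<^esub> bar\<^bsub>\<Lambda>\<^esub> a)\<rparr>"

text \<open>For a homomorphism \<open>h\<close> from \<open>M\<close> to \<open>N\<close>, the dual homomorphism from the dual of \<open>N\<close> to the dual
  of \<open>M\<close> is \<open>dual_map M h\<close>.\<close>

definition dual_map :: "('a, 'b) module \<Rightarrow> ('b \<Rightarrow> 'c) \<Rightarrow> ('c \<Rightarrow> 'a) \<Rightarrow> 'b \<Rightarrow> 'a"
  where "dual_map M h f = (\<lambda>x\<in>carrier M. f (h x))"

text \<open>
  The sign \<open>e\<close> is an element of the ring, which is \<open>1\<close> or \<open>- 1\<close> in all uses. Elements of the group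
  \<open>Q\<^sub>e(\<Lambda>)\<close> are the cosets \<open>Q_class \<Lambda> e a\<close>.
\<close>

definition Q_zero :: "'a involution_ring \<Rightarrow> 'a \<Rightarrow> 'a set"
  where "Q_zero \<Lambda> e = {b \<ominus>\<^bsub>\<Lambda>\<^esub> e \<otimes>\<^bsub>\<Lambda>\<^esub> bar\<^bsub>\<Lambda>\<^esub> b | b. b \<in> carrier \<Lambda>}"

definition Q_class :: "'a involution_ring \<Rightarrow> 'a \<Rightarrow> 'a \<Rightarrow> 'a set"
  where "Q_class \<Lambda> e a = Q_zero \<Lambda> e +>\<^bsub>\<Lambda>\<^esub> a"

definition Q_group :: "'a involution_ring \<Rightarrow> 'a \<Rightarrow> 'a set set"
  where "Q_group \<Lambda> e = a_rcosets\<^bsub>\<Lambda>\<^esub> (Q_zero \<Lambda> e)"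

definition symmetric_form ::
  "'a involution_ring \<Rightarrow> 'a \<Rightarrow> ('a, 'b) module \<Rightarrow> ('b \<Rightarrow> 'b \<Rightarrow> 'a) \<Rightarrow> bool"
  where "symmetric_form \<Lambda> e M l \<longleftrightarrow> left_module \<Lambda> M \<and> l \<in> mod_hom \<Lambda> M (dual \<Lambda> M) \<and>
    (\<forall>x\<in>carrier M. \<forall>y\<in>carrier M. l x y = e \<otimes>\<^bsub>\<Lambda>\<^esub> bar\<^bsub>\<Lambda>\<^esub> (l y x))"

definition quadratic_form ::
  "'a involution_ring \<Rightarrow> 'a \<Rightarrow> ('a, 'b) module \<Rightarrow> ('b \<Rightarrow> 'b \<Rightarrow> 'a) \<Rightarrow> ('b \<Rightarrow> 'a set) \<Rightarrow> bool"
  where "quadratic_form \<Lambda> e M l \<nu> \<longleftrightarrow> symmetric_form \<Lambda> e M l \<and>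
    \<nu> \<in> carrier M \<rightarrow> Q_group \<Lambda> e \<and>
    (\<forall>x\<in>carrier M. \<forall>y\<in>carrier M.
      \<nu> (x \<oplus>\<^bsub>M\<^esub> y) = \<nu> x <+>\<^bsub>\<Lambda>\<^esub> \<nu> y <+>\<^bsub>\<Lambda>\<^esub> Q_class \<Lambda> e (l x y)) \<and>
    (\<forall>x\<in>carrier M. \<forall>t\<in>\<nu> x. t \<oplus>\<^bsub>\<Lambda>\<^esub> e \<otimes>\<^bsub>\<Lambda>\<^esub> bar\<^bsub>\<Lambda>\<^esub> t = l x x) \<and>
    (\<forall>a\<in>carrier \<Lambda>. \<forall>x\<in>carrier M. \<forall>t\<in>\<nu> x.
      \<nu> (a \<odot>\<^bsub>M\<^esub> x) = Q_class \<Lambda> e (a \<otimes>\<^bsub>\<Lambda>\<^esub> t \<otimes>\<^bsub>\<Lambda>\<^esub> bar\<^bsub>\<Lambda>\<^esub> a))"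

section \<open>Quadratic split preformations\<close>

record ('a, 'f, 'g) preform =
  Fmod :: "('a, 'f) module"
  Gmod :: "('a, 'g) module"
  gam :: "'g \<Rightarrow> 'f"
  mu :: "'g \<Rightarrow> 'f \<Rightarrow> 'a"
  theta :: "'g \<Rightarrow> 'a set"

text \<open>The homomorphism \<open>\<gamma>\<^sup>*\<mu>\<close> from \<open>G\<close> to its dual.\<close>

definition gam_mu :: "('a, 'f, 'g) preform \<Rightarrow> 'g \<Rightarrow> 'g \<Rightarrow> 'a"
  where "gam_mu z x = dual_map (Gmod z) (gam z) (mu z x)"

definition split_preformation :: "'a involution_ring \<Rightarrow> 'a \<Rightarrow> ('a, 'f, 'g) preform \<Rightarrow> bool"
  where "split_preformation \<Lambda> \<epsilon> z \<longleftrightarrow>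
    fg_free_mod \<Lambda> (Fmod z) \<and> fg_mod \<Lambda> (Gmod z) \<and>
    gam z \<in> mod_hom \<Lambda> (Gmod z) (Fmod z) \<and>
    mu z \<in> mod_hom \<Lambda> (Gmod z) (dual \<Lambda> (Fmod z)) \<and>
    quadratic_form \<Lambda> (\<ominus>\<^bsub>\<Lambda>\<^esub> \<epsilon>) (Gmod z) (gam_mu z) (theta z)"

definition regular_preformation :: "'a involution_ring \<Rightarrow> 'a \<Rightarrow> ('a, 'f, 'g) preform \<Rightarrow> bool"
  where "regular_preformation \<Lambda> \<epsilon> z \<longleftrightarrow> split_preformation \<Lambda> \<epsilon> z \<and> fg_free_mod \<Lambda> (Gmod z)"

definition strongly_isomorphic ::
  "'a involution_ring \<Rightarrow> ('a, 'f, 'g) preform \<Rightarrow> ('a, 'f2, 'g2) preform \<Rightarrow> bool"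
  where "strongly_isomorphic \<Lambda> z z' \<longleftrightarrow>
    (\<exists>a\<in>mod_iso \<Lambda> (Fmod z) (Fmod z'). \<exists>b\<in>mod_iso \<Lambda> (Gmod z) (Gmod z').
      \<forall>x\<in>carrier (Gmod z).
        a (gam z x) = gam z' (b x) \<and>
        dual_map (Fmod z') (inv_into (carrier (Fmod z)) a) (mu z x) = mu z' (b x) \<and>
        theta z x = theta z' (b x))"

text \<open>The direct sum identifies the dual of \<open>F \<oplus> F'\<close> with the direct sum of the duals.\<close>

definition preform_sum ::
  "'a involution_ring \<Rightarrow> ('a, 'f, 'g) preform \<Rightarrow> ('a, 'f2, 'g2) preform \<Rightarrow>
    ('a, 'f \<times> 'f2, 'g \<times> 'g2) preform"
  where "preform_sum \<Lambda> z z' =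
    \<lparr>Fmod = dsum (Fmod z) (Fmod z'), Gmod = dsum (Gmod z) (Gmod z'),
     gam = (\<lambda>(x, y). (gam z x, gam z' y)),
     mu = (\<lambda>(x, y). \<lambda>(u, v)\<in>carrier (dsum (Fmod z) (Fmod z')). mu z x u \<oplus>\<^bsub>\<Lambda>\<^esub> mu z' y v),
     theta = (\<lambda>(x, y). theta z x <+>\<^bsub>\<Lambda>\<^esub> theta z' y)\<rparr>"

text \<open>
  The hyperbolic preformation \<open>\<partial>H\<^sub>-\<^sub>\<epsilon>(P)\<close>. The element \<open>(f, - \<epsilon> p)\<close> of \<open>P\<^sup>* \<oplus> P\<close> is the
  functional \<open>(p', f') \<mapsto> f(p') - \<epsilon> bar (f'(p))\<close> on \<open>P \<oplus> P\<^sup>*\<close>, by the identification of \<open>P\<close> with its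
  double dual. The matrix \<open>(0 1; 0 0)\<close> is the class of the form \<open>(p, f), (p', f') \<mapsto> f(p')\<close>.
\<close>

definition hyperbolic ::
  "'a involution_ring \<Rightarrow> 'a \<Rightarrow> ('a, 'p) module \<Rightarrow> ('a, 'p \<times> ('p \<Rightarrow> 'a), 'p \<times> ('p \<Rightarrow> 'a)) preform"
  where "hyperbolic \<Lambda> \<epsilon> P =
    \<lparr>Fmod = dsum P (dual \<Lambda> P), Gmod = dsum P (dual \<Lambda> P),
     gam = (\<lambda>x. x),
     mu = (\<lambda>(p, f). \<lambda>(p', f')\<in>carrier (dsum P (dual \<Lambda> P)).
       f p' \<oplus>\<^bsub>\<Lambda>\<^esub> (\<ominus>\<^bsub>\<Lambda>\<^esub> \<epsilon>) \<otimes>\<^bsub>\<Lambda>\<^esub> bar\<^bsub>\<Lambda>\<^esub> (f' p)),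
     theta = (\<lambda>(p, f). Q_class \<Lambda> (\<ominus>\<^bsub>\<Lambda>\<^esub> \<epsilon>) (f p))\<rparr>"

text \<open>
  Every f.g. free module is isomorphic to one on the type \<open>nat \<Rightarrow> 'a\<close>, and a sum of hyperbolic
  preformations is strongly isomorphic to the hyperbolic preformation on the sum. So it is no
  restriction to add one hyperbolic preformation, on a module \<open>P\<close> of that type.
\<close>

definition stably_strongly_isomorphic ::
  "'a involution_ring \<Rightarrow> 'a \<Rightarrow> ('a, 'f, 'g) preform \<Rightarrow> ('a, 'f2, 'g2) preform \<Rightarrow> bool"
  where "stably_strongly_isomorphic \<Lambda> \<epsilon> z z' \<longleftrightarrow>
    (\<exists>(P :: ('a, nat \<Rightarrow> 'a) module) (P' :: ('a, nat \<Rightarrow> 'a) module).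
      fg_free_mod \<Lambda> P \<and> fg_free_mod \<Lambda> P' \<and>
      strongly_isomorphic \<Lambda>
        (preform_sum \<Lambda> z (hyperbolic \<Lambda> \<epsilon> P)) (preform_sum \<Lambda> z' (hyperbolic \<Lambda> \<epsilon> P')))"

text \<open>
  The element \<open>[z]\<close> of the \<open>l\<close>-monoid, as the set of its representatives. The types \<open>'f2\<close>, \<open>'g2\<close>
  on which the representatives live are independent of the types of \<open>z\<close>.
\<close>

definition l_class ::
  "'a involution_ring \<Rightarrow> 'a \<Rightarrow> ('a, 'f, 'g) preform \<Rightarrow> ('a, 'f2, 'g2) preform set"
  where "l_class \<Lambda> \<epsilon> z =
    {z'. regular_preformation \<Lambda> \<epsilon> z' \<and> stably_strongly_isomorphic \<Lambda> \<epsilon> z z'}"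

text \<open>\<open>Q_zero\<close> is the zero element of \<open>Q_group\<close>.\<close>

definition elementary_preformation :: "'a involution_ring \<Rightarrow> 'a \<Rightarrow> ('a, 'f, 'g) preform \<Rightarrow> bool"
  where "elementary_preformation \<Lambda> \<epsilon> z \<longleftrightarrow>
    (\<exists>U. submodule U \<Lambda> (Gmod z) \<and> fg_free_mod \<Lambda> (restr_mod (Gmod z) U) \<and>
      (\<forall>x\<in>U. \<forall>y\<in>U. gam_mu z x y = \<zero>\<^bsub>\<Lambda>\<^esub>) \<and>
      (\<forall>x\<in>U. theta z x = Q_zero \<Lambda> (\<ominus>\<^bsub>\<Lambda>\<^esub> \<epsilon>)) \<and>
      inj_on (gam z) U \<and> inj_on (mu z) U \<and>
      (let F = Fmod z; U0 = gam z ` U; U1 = mu z ` U in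
        direct_summand \<Lambda> F U0 \<and> direct_summand \<Lambda> (dual \<Lambda> F) U1 \<and>
        (\<exists>h\<in>mod_iso \<Lambda> (quot_mod (dual \<Lambda> F) U1) (dual \<Lambda> (restr_mod F U0)).
          \<forall>f\<in>carrier (dual \<Lambda> F). h (U1 +>\<^bsub>dual \<Lambda> F\<^esub> f) = restrict f U0)))"

definition elementary_class :: "'a involution_ring \<Rightarrow> 'a \<Rightarrow> ('a, 'f, 'g) preform set \<Rightarrow> bool"
  where "elementary_class \<Lambda> \<epsilon> c \<longleftrightarrow> (\<exists>z'\<in>c. elementary_preformation \<Lambda> \<epsilon> z')"

end

theory Submission
  imports Defs
begin

text \<open>
  Let \<open>z\<close> be elementary via \<open>U\<close>. The maps \<open>A\<close> and \<open>B\<close> from \<open>F\<close> and \<open>F\<^sup>*\<close> to \<open>U\<^sup>*\<close>, given by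
  \<open>A f u = bar (\<mu> u f)\<close> and \<open>B \<phi> u = \<phi> (\<gamma> u)\<close>, are surjective with kernels \<open>U\<^sub>0 = \<gamma> U\<close> and \<open>U\<^sub>1 = \<mu> U\<close>,
  and \<open>A \<gamma> = - \<epsilon> B \<mu>\<close> by the symmetry of \<open>\<gamma>\<^sup>*\<mu>\<close>. Hence both cokernels are that of \<open>B \<mu>\<close>, and
  \<open>x \<mapsto> x - \<sigma> (\<mu> x)\<close> maps \<open>ker \<gamma>\<close> onto \<open>ker \<mu>\<close>, where \<open>\<sigma>\<close> inverts \<open>\<mu>\<close> on \<open>U\<^sub>1\<close>. Since
  \<open>ker \<gamma>\<^sup>* \<subseteq> U\<^sub>1\<close>, the sequence \<open>ker \<mu> \<rightarrow> ker \<gamma>\<^sup>*\<mu> \<rightarrow> ker \<gamma>\<^sup>*\<close> splits by \<open>\<sigma>\<close>; with \<open>\<tau>\<close> from \<open>F\<close> to \<open>U\<close> inverting \<open>\<gamma>\<close>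
  on \<open>U\<^sub>0\<close>, the map \<open>h \<mapsto> ([h \<tau>], [h])\<close> identifies the cokernel of \<open>\<gamma>\<^sup>*\<mu>\<close> with
  \<open>coker \<mu> \<oplus> coker \<gamma>\<^sup>*\<close>. Moreover \<open>F \<cong> U \<oplus> U\<^sup>*\<close> by \<open>f \<mapsto> (\<tau> f, A f)\<close>, so the rank is even.

  In a hyperbolic preformation \<open>\<gamma>\<close> and \<open>\<mu>\<close> are isomorphisms. So adding one changes none of the kernels
  and cokernels of \<open>\<gamma>\<close>, \<open>\<mu>\<close>, \<open>\<gamma>\<^sup>*\<close>, \<open>\<gamma>\<^sup>*\<mu>\<close>, and adds an even number to the rank of \<open>F\<close>.
\<close>

text \<open>Elementarity compares only the quotient of \<open>F\<^sup>*\<close> by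
  \<open>U\<^sub>1\<close> with the dual of \<open>U\<^sub>0\<close>. The mirror statement, that an
  element of F killed by \<open>U\<^sub>1\<close> lies in \<open>U\<^sub>0\<close>, is recovered
  from reflexivity of the f.g. free module F. Complements enter only through the retractions \<tau>
  and \<sigma> onto U. All four isomorphisms concern kernels and cokernels. These change under
  stabilisation only by explicit isomorphisms, so no module has to be cancelled and each claim
  travels back from the elementary representative to z. The parity of the rank does need
  cancellation: it rests on an equation m + 2p = 2n + 2p', which weak finiteness supplies over a
  nonzero ring. The delicate point of stabilisation is the composite
  \<open>\<gamma>\<^sup>*\<mu>\<close>: the summand of \<open>F\<^sup>*\<close> that \<mu> splits
  off must be the dual of the one that \<gamma> splits off. So inclusions and projections are kept
  as explicit data.\<close>

section \<open>Left modules and homomorphisms\<close>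

context left_module
begin

lemma minus_eq_zero_iff:
  "\<lbrakk>x \<in> carrier M; y \<in> carrier M\<rbrakk> \<Longrightarrow> x \<ominus>\<^bsub>M\<^esub> y = \<zero>\<^bsub>M\<^esub> \<longleftrightarrow> x = y"
  by (metis M.add.inv_closed M.add.inv_equality M.add.inv_inv M.minus_eq M.r_neg)

lemma diff_add_cancel:
  "\<lbrakk>x \<in> carrier M; y \<in> carrier M\<rbrakk> \<Longrightarrow> (x \<ominus>\<^bsub>M\<^esub> y) \<oplus>\<^bsub>M\<^esub> y = x"
  by (simp add: M.minus_eq M.a_assoc M.l_neg)

lemma add_diff_cancel:
  "\<lbrakk>x \<in> carrier M; y \<in> carrier M\<rbrakk> \<Longrightarrow> y \<oplus>\<^bsub>M\<^esub> (x \<ominus>\<^bsub>M\<^esub> y) = x"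
  using diff_add_cancel M.a_comm by simp

lemma add_minus_cancel:
  assumes x: "x \<in> carrier M" and y: "y \<in> carrier M"
  shows "(x \<oplus>\<^bsub>M\<^esub> y) \<ominus>\<^bsub>M\<^esub> y = x"
proof -
  have "(x \<oplus>\<^bsub>M\<^esub> y) \<ominus>\<^bsub>M\<^esub> y = x \<oplus>\<^bsub>M\<^esub> (y \<oplus>\<^bsub>M\<^esub> \<ominus>\<^bsub>M\<^esub> y)"
    using assms by (simp add: M.minus_eq M.a_assoc)
  then show ?thesis using assms by (simp add: M.r_neg)
qed

lemma minus_zero: "x \<in> carrier M \<Longrightarrow> x \<ominus>\<^bsub>M\<^esub> \<zero>\<^bsub>M\<^esub> = x"
  by (metis M.r_zero M.zero_closed diff_add_cancel M.minus_closed)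

lemma smult_l_null: "x \<in> carrier M \<Longrightarrow> \<zero>\<^bsub>R\<^esub> \<odot>\<^bsub>M\<^esub> x = \<zero>\<^bsub>M\<^esub>"
  by (metis M.add.r_cancel_one R.l_zero R.zero_closed smult_closed smult_l_distr)

lemma smult_r_null: "a \<in> carrier R \<Longrightarrow> a \<odot>\<^bsub>M\<^esub> \<zero>\<^bsub>M\<^esub> = \<zero>\<^bsub>M\<^esub>"
  by (metis M.add.r_cancel_one M.l_zero M.zero_closed smult_closed smult_r_distr)

lemma minus_one_smult: "x \<in> carrier M \<Longrightarrow> (\<ominus>\<^bsub>R\<^esub> \<one>\<^bsub>R\<^esub>) \<odot>\<^bsub>M\<^esub> x = \<ominus>\<^bsub>M\<^esub> x"
  by (metis M.minus_equality R.add.inv_closed R.l_neg R.one_closed smult_closed smult_l_distr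
      smult_l_null smult_one)

lemma smult_minus:
  "\<lbrakk>a \<in> carrier R; x \<in> carrier M; y \<in> carrier M\<rbrakk>
    \<Longrightarrow> a \<odot>\<^bsub>M\<^esub> (x \<ominus>\<^bsub>M\<^esub> y) = a \<odot>\<^bsub>M\<^esub> x \<ominus>\<^bsub>M\<^esub> a \<odot>\<^bsub>M\<^esub> y"
  using smult_r_distr[of a "x \<ominus>\<^bsub>M\<^esub> y" y]
    add_minus_cancel[of "a \<odot>\<^bsub>M\<^esub> (x \<ominus>\<^bsub>M\<^esub> y)" "a \<odot>\<^bsub>M\<^esub> y"]
  by (simp add: diff_add_cancel smult_closed)

lemma add_minus_add:
  "\<lbrakk>x \<in> carrier M; y \<in> carrier M; u \<in> carrier M; v \<in> carrier M\<rbrakk>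
    \<Longrightarrow> (x \<oplus>\<^bsub>M\<^esub> y) \<ominus>\<^bsub>M\<^esub> (u \<oplus>\<^bsub>M\<^esub> v) = (x \<ominus>\<^bsub>M\<^esub> u) \<oplus>\<^bsub>M\<^esub> (y \<ominus>\<^bsub>M\<^esub> v)"
  by (simp add: M.minus_eq M.minus_add M.a_ac)

end

text \<open>Negatives come from the scalars: by distributivity (-1) x + x = 0 x, so the equation 0 x
  = 0 takes the place of the inverse axiom.\<close>

lemma left_moduleI:
  assumes "ring R"
    and "\<And>x y. \<lbrakk>x \<in> carrier M; y \<in> carrier M\<rbrakk> \<Longrightarrow> x \<oplus>\<^bsub>M\<^esub> y \<in> carrier M"
    and "\<zero>\<^bsub>M\<^esub> \<in> carrier M"
    and "\<And>x y z. \<lbrakk>x \<in> carrier M; y \<in> carrier M; z \<in> carrier M\<rbrakk>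
      \<Longrightarrow> (x \<oplus>\<^bsub>M\<^esub> y) \<oplus>\<^bsub>M\<^esub> z = x \<oplus>\<^bsub>M\<^esub> (y \<oplus>\<^bsub>M\<^esub> z)"
    and "\<And>x y. \<lbrakk>x \<in> carrier M; y \<in> carrier M\<rbrakk> \<Longrightarrow> x \<oplus>\<^bsub>M\<^esub> y = y \<oplus>\<^bsub>M\<^esub> x"
    and "\<And>x. x \<in> carrier M \<Longrightarrow> \<zero>\<^bsub>M\<^esub> \<oplus>\<^bsub>M\<^esub> x = x"
    and "\<And>x. x \<in> carrier M \<Longrightarrow> \<zero>\<^bsub>R\<^esub> \<odot>\<^bsub>M\<^esub> x = \<zero>\<^bsub>M\<^esub>"
    and sc: "\<And>a x. \<lbrakk>a \<in> carrier R; x \<in> carrier M\<rbrakk> \<Longrightarrow> a \<odot>\<^bsub>M\<^esub> x \<in> carrier M"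
    and ld: "\<And>a b x. \<lbrakk>a \<in> carrier R; b \<in> carrier R; x \<in> carrier M\<rbrakk>
      \<Longrightarrow> (a \<oplus>\<^bsub>R\<^esub> b) \<odot>\<^bsub>M\<^esub> x = a \<odot>\<^bsub>M\<^esub> x \<oplus>\<^bsub>M\<^esub> b \<odot>\<^bsub>M\<^esub> x"
    and "\<And>a x y. \<lbrakk>a \<in> carrier R; x \<in> carrier M; y \<in> carrier M\<rbrakk>
      \<Longrightarrow> a \<odot>\<^bsub>M\<^esub> (x \<oplus>\<^bsub>M\<^esub> y) = a \<odot>\<^bsub>M\<^esub> x \<oplus>\<^bsub>M\<^esub> a \<odot>\<^bsub>M\<^esub> y"
    and "\<And>a b x. \<lbrakk>a \<in> carrier R; b \<in> carrier R; x \<in> carrier M\<rbrakk>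
      \<Longrightarrow> (a \<otimes>\<^bsub>R\<^esub> b) \<odot>\<^bsub>M\<^esub> x = a \<odot>\<^bsub>M\<^esub> (b \<odot>\<^bsub>M\<^esub> x)"
    and so: "\<And>x. x \<in> carrier M \<Longrightarrow> \<one>\<^bsub>R\<^esub> \<odot>\<^bsub>M\<^esub> x = x"
  shows "left_module R M"
proof -
  interpret ring R by fact
  have "\<exists>y\<in>carrier M. y \<oplus>\<^bsub>M\<^esub> x = \<zero>\<^bsub>M\<^esub>" if x: "x \<in> carrier M" for x
    using ld[of "\<ominus>\<^bsub>R\<^esub> \<one>\<^bsub>R\<^esub>" "\<one>\<^bsub>R\<^esub>" x] so[OF x] assms(7)[OF x] sc[of "\<ominus>\<^bsub>R\<^esub> \<one>\<^bsub>R\<^esub>" x] x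
    by (auto simp: l_neg)
  then have "abelian_group M" by (intro abelian_groupI assms)
  then show ?thesis
    by (intro left_module.intro left_module_axioms.intro assms)
qed

text \<open>In the form of \<open>left_moduleI\<close> the module axioms are closure conditions and
  equations, and these pass along a surjection that commutes with the operations. Meant for
  quotients.\<close>

lemma left_module_surj_image:
  assumes "left_module R M" and surj: "p ` carrier M = carrier N"
    and add: "\<And>x y. \<lbrakk>x \<in> carrier M; y \<in> carrier M\<rbrakk> \<Longrightarrow> p x \<oplus>\<^bsub>N\<^esub> p y = p (x \<oplus>\<^bsub>M\<^esub> y)"
    and smult: "\<And>a x. \<lbrakk>a \<in> carrier R; x \<in> carrier M\<rbrakk> \<Longrightarrow> a \<odot>\<^bsub>N\<^esub> p x = p (a \<odot>\<^bsub>M\<^esub> x)"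
    and zero: "\<zero>\<^bsub>N\<^esub> = p \<zero>\<^bsub>M\<^esub>"
  shows "left_module R N"
proof -
  interpret left_module R M by fact
  have ex: "\<And>y. y \<in> carrier N \<Longrightarrow> \<exists>x\<in>carrier M. y = p x"
    and cl: "\<And>x. x \<in> carrier M \<Longrightarrow> p x \<in> carrier N"
    using surj by auto
  show ?thesis
    by (rule left_moduleI)
      (use R.ring_axioms in \<open>auto dest!: ex simp: cl add smult zero M.a_ac smult_l_null
        smult_closed smult_l_distr smult_r_distr smult_assoc smult_one\<close>)
qed

lemma mod_homI:
  assumes "\<And>x. x \<in> carrier M \<Longrightarrow> f x \<in> carrier N"
    and "\<And>x y. \<lbrakk>x \<in> carrier M; y \<in> carrier M\<rbrakk> \<Longrightarrow> f (x \<oplus>\<^bsub>M\<^esub> y) = f x \<oplus>\<^bsub>N\<^esub> f y"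
    and "\<And>a x. \<lbrakk>a \<in> carrier R; x \<in> carrier M\<rbrakk> \<Longrightarrow> f (a \<odot>\<^bsub>M\<^esub> x) = a \<odot>\<^bsub>N\<^esub> f x"
  shows "f \<in> mod_hom R M N"
  using assms by (auto simp: mod_hom_def)

lemma mod_hom_closed: "\<lbrakk>f \<in> mod_hom R M N; x \<in> carrier M\<rbrakk> \<Longrightarrow> f x \<in> carrier N"
  by (auto simp: mod_hom_def)

lemma mod_hom_add:
  "\<lbrakk>f \<in> mod_hom R M N; x \<in> carrier M; y \<in> carrier M\<rbrakk> \<Longrightarrow> f (x \<oplus>\<^bsub>M\<^esub> y) = f x \<oplus>\<^bsub>N\<^esub> f y"
  by (auto simp: mod_hom_def)

lemma mod_hom_smult:
  "\<lbrakk>f \<in> mod_hom R M N; a \<in> carrier R; x \<in> carrier M\<rbrakk> \<Longrightarrow> f (a \<odot>\<^bsub>M\<^esub> x) = a \<odot>\<^bsub>N\<^esub> f x"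
  by (auto simp: mod_hom_def)

lemma mod_hom_zero:
  assumes "left_module R M" "left_module R N" "f \<in> mod_hom R M N"
  shows "f \<zero>\<^bsub>M\<^esub> = \<zero>\<^bsub>N\<^esub>"
proof -
  interpret M: left_module R M by fact
  interpret N: left_module R N by fact
  have "f (\<zero>\<^bsub>R\<^esub> \<odot>\<^bsub>M\<^esub> \<zero>\<^bsub>M\<^esub>) = \<zero>\<^bsub>R\<^esub> \<odot>\<^bsub>N\<^esub> f \<zero>\<^bsub>M\<^esub>"
    by (rule mod_hom_smult[OF assms(3) M.R.zero_closed M.M.zero_closed])
  then show ?thesis
    by (simp only: M.smult_l_null[OF M.M.zero_closed]
        N.smult_l_null[OF mod_hom_closed[OF assms(3) M.M.zero_closed]])
qed

lemma mod_hom_uminus: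
  assumes "left_module R M" "left_module R N" "f \<in> mod_hom R M N" "x \<in> carrier M"
  shows "f (\<ominus>\<^bsub>M\<^esub> x) = \<ominus>\<^bsub>N\<^esub> f x"
proof -
  interpret M: left_module R M by fact
  interpret N: left_module R N by fact
  have "f ((\<ominus>\<^bsub>R\<^esub> \<one>\<^bsub>R\<^esub>) \<odot>\<^bsub>M\<^esub> x) = (\<ominus>\<^bsub>R\<^esub> \<one>\<^bsub>R\<^esub>) \<odot>\<^bsub>N\<^esub> f x"
    by (rule mod_hom_smult[OF assms(3) _ assms(4)]) simp
  then show ?thesis
    by (simp only: M.minus_one_smult[OF assms(4)]
        N.minus_one_smult[OF mod_hom_closed[OF assms(3,4)]])
qed

lemma mod_hom_minus:
  assumes "left_module R M" "left_module R N" "f \<in> mod_hom R M N" "x \<in> carrier M" "y \<in> carrier M"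
  shows "f (x \<ominus>\<^bsub>M\<^esub> y) = f x \<ominus>\<^bsub>N\<^esub> f y"
proof -
  interpret M: left_module R M by fact
  interpret N: left_module R N by fact
  show ?thesis
    using assms by (simp add: a_minus_def mod_hom_add mod_hom_uminus)
qed

lemma mod_hom_comp:
  "\<lbrakk>f \<in> mod_hom R M N; g \<in> mod_hom R N L\<rbrakk> \<Longrightarrow> g \<circ> f \<in> mod_hom R M L"
  by (auto simp: mod_hom_def Pi_iff)

lemma mod_isoI: "\<lbrakk>f \<in> mod_hom R M N; bij_betw f (carrier M) (carrier N)\<rbrakk> \<Longrightarrow> f \<in> mod_iso R M N"
  by (simp add: mod_iso_def)

lemma mod_iso_hom: "f \<in> mod_iso R M N \<Longrightarrow> f \<in> mod_hom R M N"
  by (simp add: mod_iso_def)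

lemma mod_iso_bij: "f \<in> mod_iso R M N \<Longrightarrow> bij_betw f (carrier M) (carrier N)"
  by (simp add: mod_iso_def)

lemma isomorphicI: "f \<in> mod_iso R M N \<Longrightarrow> isomorphic R M N"
  by (auto simp: isomorphic_def)

lemma isomorphicE:
  assumes "isomorphic R M N" obtains f where "f \<in> mod_iso R M N"
  using assms by (auto simp: isomorphic_def)

lemma inj_on_mod_homI:
  assumes "left_module R M" "left_module R N" "f \<in> mod_hom R M N"
    and "\<And>x. \<lbrakk>x \<in> carrier M; f x = \<zero>\<^bsub>N\<^esub>\<rbrakk> \<Longrightarrow> x = \<zero>\<^bsub>M\<^esub>"
  shows "inj_on f (carrier M)"
proof -
  interpret M: left_module R M by fact
  interpret N: left_module R N by fact
  show ?thesis
  proof (rule inj_onI)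
    fix x y assume x: "x \<in> carrier M" and y: "y \<in> carrier M" and eq: "f x = f y"
    have "f (x \<ominus>\<^bsub>M\<^esub> y) = \<zero>\<^bsub>N\<^esub>"
      using x y eq assms(3) by (simp add: mod_hom_minus[OF assms(1-3)] N.minus_eq_zero_iff mod_hom_closed)
    then have "x \<ominus>\<^bsub>M\<^esub> y = \<zero>\<^bsub>M\<^esub>" using assms(4) x y by simp
    then show "x = y" using x y by (simp add: M.minus_eq_zero_iff)
  qed
qed

lemma mod_isoI':
  assumes "left_module R M" "left_module R N" "f \<in> mod_hom R M N"
    and "\<And>x. \<lbrakk>x \<in> carrier M; f x = \<zero>\<^bsub>N\<^esub>\<rbrakk> \<Longrightarrow> x = \<zero>\<^bsub>M\<^esub>"
    and "\<And>y. y \<in> carrier N \<Longrightarrow> \<exists>x\<in>carrier M. f x = y"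
  shows "f \<in> mod_iso R M N"
  using inj_on_mod_homI[OF assms(1-4)] assms(3,5)
  by (auto simp: mod_iso_def bij_betw_def mod_hom_closed intro: rev_image_eqI)

lemma mod_iso_inv:
  assumes "left_module R M" "f \<in> mod_iso R M N"
  shows "inv_into (carrier M) f \<in> mod_iso R N M"
proof -
  interpret M: left_module R M by fact
  let ?g = "inv_into (carrier M) f"
  have bij: "bij_betw f (carrier M) (carrier N)" and hom: "f \<in> mod_hom R M N"
    using assms(2) by (auto simp: mod_iso_def)
  have gf: "?g (f x) = x" if "x \<in> carrier M" for x
    using bij that by (simp add: bij_betw_def)
  have fg: "f (?g y) = y" and gc: "?g y \<in> carrier M" if "y \<in> carrier N" for y
    using bij that by (simp_all add: bij_betw_inv_into_right bij_betw_def inv_into_into)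
  show ?thesis
  proof (intro mod_isoI mod_homI)
    fix x y assume xy: "x \<in> carrier N" "y \<in> carrier N"
    then have "f (?g x \<oplus>\<^bsub>M\<^esub> ?g y) = x \<oplus>\<^bsub>N\<^esub> y"
      by (simp only: mod_hom_add[OF hom gc gc] fg)
    then show "?g (x \<oplus>\<^bsub>N\<^esub> y) = ?g x \<oplus>\<^bsub>M\<^esub> ?g y"
      using gf[OF M.M.a_closed[OF gc[OF xy(1)] gc[OF xy(2)]]] by simp
  next
    fix a x assume ax: "a \<in> carrier R" "x \<in> carrier N"
    then have "f (a \<odot>\<^bsub>M\<^esub> ?g x) = a \<odot>\<^bsub>N\<^esub> x"
      by (simp only: mod_hom_smult[OF hom _ gc] fg)
    then show "?g (a \<odot>\<^bsub>N\<^esub> x) = a \<odot>\<^bsub>M\<^esub> ?g x"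
      using gf[OF M.smult_closed[OF ax(1) gc[OF ax(2)]]] by simp
  qed (use bij gc in \<open>auto intro: bij_betw_inv_into\<close>)
qed

lemma isomorphic_refl: "isomorphic R M M"
  by (rule isomorphicI[of id]) (auto simp: mod_iso_def mod_hom_def)

lemma isomorphic_sym: "\<lbrakk>left_module R M; isomorphic R M N\<rbrakk> \<Longrightarrow> isomorphic R N M"
  by (meson isomorphicE isomorphicI mod_iso_inv)

lemma isomorphic_trans: "\<lbrakk>isomorphic R M N; isomorphic R N L\<rbrakk> \<Longrightarrow> isomorphic R M L"
  by (elim isomorphicE, rule isomorphicI)
    (auto simp: mod_iso_def intro: mod_hom_comp bij_betw_trans)

section \<open>Direct sums, submodules and quotients\<close>

lemma dsum_simps [simp]:
  "carrier (dsum M N) = carrier M \<times> carrier N"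
  "\<zero>\<^bsub>dsum M N\<^esub> = (\<zero>\<^bsub>M\<^esub>, \<zero>\<^bsub>N\<^esub>)"
  "(x, y) \<oplus>\<^bsub>dsum M N\<^esub> (x', y') = (x \<oplus>\<^bsub>M\<^esub> x', y \<oplus>\<^bsub>N\<^esub> y')"
  "a \<odot>\<^bsub>dsum M N\<^esub> (x, y) = (a \<odot>\<^bsub>M\<^esub> x, a \<odot>\<^bsub>N\<^esub> y)"
  by (simp_all add: dsum_def)

lemma left_module_dsum:
  assumes "left_module R M" "left_module R N"
  shows "left_module R (dsum M N)"
proof -
  interpret M: left_module R M by fact
  interpret N: left_module R N by fact
  show ?thesis
    by (rule left_moduleI)
      (use M.R.ring_axioms in \<open>auto simp: M.M.a_ac M.smult_l_null
        M.smult_closed M.smult_l_distr M.smult_r_distr M.smult_assoc M.smult_one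
        N.M.a_ac N.smult_l_null
        N.smult_closed N.smult_l_distr N.smult_r_distr N.smult_assoc N.smult_one\<close>)
qed

lemma isomorphic_dsum:
  assumes "isomorphic R M M'" "isomorphic R N N'"
  shows "isomorphic R (dsum M N) (dsum M' N')"
proof -
  obtain f g where f: "f \<in> mod_iso R M M'" and g: "g \<in> mod_iso R N N'"
    using assms by (auto elim!: isomorphicE)
  note h = mod_iso_hom[OF f] mod_iso_hom[OF g]
  have "map_prod f g \<in> mod_hom R (dsum M N) (dsum M' N')"
    by (rule mod_homI) (auto simp: h[THEN mod_hom_closed] h[THEN mod_hom_add] h[THEN mod_hom_smult])
  then show ?thesis
    using f g by (auto simp: mod_iso_def intro!: isomorphicI mod_isoI bij_betw_map_prod)
qed

lemma restr_mod_simps [simp]: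
  "carrier (restr_mod M U) = U" "zero (restr_mod M U) = zero M"
  "add (restr_mod M U) = add M" "smult (restr_mod M U) = smult M"
  by (simp_all add: restr_mod_def)

lemma submoduleD:
  assumes "submodule U R M"
  shows submodule_subset: "U \<subseteq> carrier M" and submodule_zero: "\<zero>\<^bsub>M\<^esub> \<in> U"
    and submodule_add: "\<lbrakk>x \<in> U; y \<in> U\<rbrakk> \<Longrightarrow> x \<oplus>\<^bsub>M\<^esub> y \<in> U"
    and submodule_smult: "\<lbrakk>a \<in> carrier R; x \<in> U\<rbrakk> \<Longrightarrow> a \<odot>\<^bsub>M\<^esub> x \<in> U"
    and submodule_additive: "additive_subgroup U M"
proof -
  interpret submodule U R M by fact
  show "U \<subseteq> carrier M" "\<zero>\<^bsub>M\<^esub> \<in> U" "\<lbrakk>x \<in> U; y \<in> U\<rbrakk> \<Longrightarrow> x \<oplus>\<^bsub>M\<^esub> y \<in> U"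
    "\<lbrakk>a \<in> carrier R; x \<in> U\<rbrakk> \<Longrightarrow> a \<odot>\<^bsub>M\<^esub> x \<in> U" "additive_subgroup U M"
    using subset one_closed m_closed smult_closed subgroup_axioms by (auto intro: additive_subgroup.intro)
qed

text \<open>Closure under negation is automatic, since negation is multiplication by -1.\<close>

lemma submoduleI:
  assumes "left_module R M" "U \<subseteq> carrier M" "\<zero>\<^bsub>M\<^esub> \<in> U"
    and "\<And>x y. \<lbrakk>x \<in> U; y \<in> U\<rbrakk> \<Longrightarrow> x \<oplus>\<^bsub>M\<^esub> y \<in> U"
    and sm: "\<And>a x. \<lbrakk>a \<in> carrier R; x \<in> U\<rbrakk> \<Longrightarrow> a \<odot>\<^bsub>M\<^esub> x \<in> U"
  shows "submodule U R M"
proof -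
  interpret left_module R M by fact
  have "\<ominus>\<^bsub>M\<^esub> x \<in> U" if "x \<in> U" for x
    using sm[of "\<ominus>\<^bsub>R\<^esub> \<one>\<^bsub>R\<^esub>" x] that assms(2) by (auto simp: minus_one_smult subset_iff)
  then show ?thesis
    by (intro submodule.intro subgroup.intro submodule_axioms.intro)
      (use assms in \<open>auto simp: a_inv_def\<close>)
qed

lemma left_module_restr:
  assumes "left_module R M" "submodule U R M"
  shows "left_module R (restr_mod M U)"
proof -
  interpret left_module R M by fact
  have sub: "\<And>x. x \<in> U \<Longrightarrow> x \<in> carrier M" using submodule_subset[OF assms(2)] by auto
  show ?thesis
    by (rule left_moduleI)
      (use R.ring_axioms in \<open>auto simp: sub M.a_ac smult_l_null submoduleD[OF assms(2)]
        smult_closed smult_l_distr smult_r_distr smult_assoc smult_one\<close>)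
qed

lemma submodule_minus:
  assumes "left_module R M" "submodule U R M" "x \<in> U" "y \<in> U"
  shows "x \<ominus>\<^bsub>M\<^esub> y \<in> U"
proof -
  interpret additive_subgroup U M using assms(2) by (rule submodule_additive)
  show ?thesis using assms by (simp add: a_minus_def)
qed

lemma submodule_image:
  assumes "left_module R M" "left_module R N" "f \<in> mod_hom R M N" "submodule U R M"
  shows "submodule (f ` U) R N"
proof (rule submoduleI)
  interpret M: left_module R M by fact
  note s = submoduleD[OF assms(4)]
  have c: "\<And>x. x \<in> U \<Longrightarrow> x \<in> carrier M" using s(1) by auto
  show "f ` U \<subseteq> carrier N" using assms(3) c by (auto intro: mod_hom_closed)
  show "\<zero>\<^bsub>N\<^esub> \<in> f ` U" using mod_hom_zero[OF assms(1-3)] s(2) by (metis imageI)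
  show "x \<oplus>\<^bsub>N\<^esub> y \<in> f ` U" if "x \<in> f ` U" "y \<in> f ` U" for x y
    using that assms(3) s(3) c by (auto simp: mod_hom_add[symmetric])
  show "a \<odot>\<^bsub>N\<^esub> x \<in> f ` U" if "a \<in> carrier R" "x \<in> f ` U" for a x
    using that assms(3) s(4) c by (auto simp: mod_hom_smult[symmetric])
qed fact

lemma submodule_carrier: "left_module R M \<Longrightarrow> submodule (carrier M) R M"
  by (rule submoduleI)
    (auto simp: left_module.smult_closed left_module_def abelian_group_def abelian_monoid.a_closed
      abelian_monoid.zero_closed)

lemma submodule_range:
  "\<lbrakk>left_module R M; left_module R N; f \<in> mod_hom R M N\<rbrakk> \<Longrightarrow> submodule (f ` carrier M) R N"
  by (simp add: submodule_carrier submodule_image)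

lemma submodule_kernel:
  assumes "left_module R M" "left_module R N" "f \<in> mod_hom R M N"
  shows "submodule {x \<in> carrier M. f x = \<zero>\<^bsub>N\<^esub>} R M"
proof -
  interpret M: left_module R M by fact
  interpret N: left_module R N by fact
  show ?thesis
    by (rule submoduleI)
      (use assms in \<open>auto simp: mod_hom_add mod_hom_smult mod_hom_zero M.smult_closed N.smult_r_null\<close>)
qed

lemma left_module_ker:
  "\<lbrakk>left_module R M; left_module R N; f \<in> mod_hom R M N\<rbrakk> \<Longrightarrow> left_module R (ker_mod M N f)"
  by (simp add: ker_mod_def left_module_restr submodule_kernel)

lemma ker_mod_simps [simp]:
  "carrier (ker_mod M N f) = {x \<in> carrier M. f x = \<zero>\<^bsub>N\<^esub>}" "zero (ker_mod M N f) = zero M"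
  "add (ker_mod M N f) = add M" "smult (ker_mod M N f) = smult M"
  by (simp_all add: ker_mod_def)

section \<open>Cosets, quotient modules and the first isomorphism theorem\<close>

context
  fixes R :: "('a, 'r) ring_scheme" and M :: "('a, 'b) module" and U
  assumes M: "left_module R M" and U: "submodule U R M"
begin

interpretation M: left_module R M by (rule M)
interpretation U: abelian_subgroup U M
  by (rule abelian_subgroupI3[OF submodule_additive[OF U] M.M.abelian_group_axioms])

lemma coset_eq_iff:
  assumes "x \<in> carrier M" "y \<in> carrier M"
  shows "U +>\<^bsub>M\<^esub> x = U +>\<^bsub>M\<^esub> y \<longleftrightarrow> x \<ominus>\<^bsub>M\<^esub> y \<in> U"
  using assms U.a_rcos_module M.M.a_repr_independence U.a_rcos_self U.a_subgroup
  by (metis M.M.minus_eq)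

lemma coset_eq_subgroup_iff:
  assumes "x \<in> carrier M"
  shows "U +>\<^bsub>M\<^esub> x = U \<longleftrightarrow> x \<in> U"
  using assms M.M.a_coset_join1 M.M.a_coset_join2 U.a_subgroup by blast

lemma quot_mod_carrier: "carrier (quot_mod M U) = (\<lambda>x. U +>\<^bsub>M\<^esub> x) ` carrier M"
  by (auto simp: quot_mod_def A_RCOSETS_def')

lemma quot_mod_zero: "\<zero>\<^bsub>quot_mod M U\<^esub> = U"
  by (simp add: quot_mod_def)

lemma quot_mod_add:
  "\<lbrakk>x \<in> carrier M; y \<in> carrier M\<rbrakk>
    \<Longrightarrow> (U +>\<^bsub>M\<^esub> x) \<oplus>\<^bsub>quot_mod M U\<^esub> (U +>\<^bsub>M\<^esub> y) = U +>\<^bsub>M\<^esub> (x \<oplus>\<^bsub>M\<^esub> y)"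
  by (simp add: quot_mod_def U.a_rcos_sum)

text \<open>The union in \<open>quot_mod\<close> runs over all representatives of the coset. As U is
  closed under scalars they all yield the same coset, so the union collapses.\<close>

lemma quot_mod_smult:
  assumes a: "a \<in> carrier R" and x: "x \<in> carrier M"
  shows "a \<odot>\<^bsub>quot_mod M U\<^esub> (U +>\<^bsub>M\<^esub> x) = U +>\<^bsub>M\<^esub> (a \<odot>\<^bsub>M\<^esub> x)"
proof -
  have "U +>\<^bsub>M\<^esub> (a \<odot>\<^bsub>M\<^esub> y) = U +>\<^bsub>M\<^esub> (a \<odot>\<^bsub>M\<^esub> x)" if y: "y \<in> U +>\<^bsub>M\<^esub> x" for y
  proof -
    have yc: "y \<in> carrier M"
      using y x M.M.a_r_coset_subset_G[OF U.a_subset] by blast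
    have "U +>\<^bsub>M\<^esub> y = U +>\<^bsub>M\<^esub> x"
      using M.M.a_repr_independence[OF y x U.a_subgroup] by simp
    then have "y \<ominus>\<^bsub>M\<^esub> x \<in> U"
      using coset_eq_iff[OF yc x] by simp
    then have "a \<odot>\<^bsub>M\<^esub> (y \<ominus>\<^bsub>M\<^esub> x) \<in> U"
      using a by (rule submodule_smult[OF U, rotated])
    then have "a \<odot>\<^bsub>M\<^esub> y \<ominus>\<^bsub>M\<^esub> a \<odot>\<^bsub>M\<^esub> x \<in> U"
      by (simp only: M.smult_minus[OF a yc x])
    then show ?thesis
      using coset_eq_iff[OF M.smult_closed[OF a yc] M.smult_closed[OF a x]] by simp
  qed
  moreover have "U +>\<^bsub>M\<^esub> x \<noteq> {}" using U.a_rcos_self[OF x] by blast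
  ultimately have "(\<Union>y\<in>U +>\<^bsub>M\<^esub> x. U +>\<^bsub>M\<^esub> (a \<odot>\<^bsub>M\<^esub> y)) = U +>\<^bsub>M\<^esub> (a \<odot>\<^bsub>M\<^esub> x)"
    by (intro SUP_eq_const)
  then show ?thesis by (simp add: quot_mod_def)
qed

lemma left_module_quot: "left_module R (quot_mod M U)"
proof (rule left_module_surj_image[OF M])
  show "(\<lambda>x. U +>\<^bsub>M\<^esub> x) ` carrier M = carrier (quot_mod M U)" by (simp only: quot_mod_carrier)
  show "\<zero>\<^bsub>quot_mod M U\<^esub> = U +>\<^bsub>M\<^esub> \<zero>\<^bsub>M\<^esub>"
    unfolding quot_mod_zero by (rule M.M.a_coset_add_zero[OF U.a_subset, symmetric])
qed (rule quot_mod_add quot_mod_smult; assumption)+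

lemma coset_hom: "(\<lambda>x. U +>\<^bsub>M\<^esub> x) \<in> mod_hom R M (quot_mod M U)"
  by (rule mod_homI) (auto simp only: quot_mod_carrier quot_mod_add quot_mod_smult)

theorem first_isomorphism:
  assumes N: "left_module R N" and g: "g \<in> mod_hom R M N" and surj: "g ` carrier M = carrier N"
    and ker: "\<And>x. x \<in> carrier M \<Longrightarrow> g x = \<zero>\<^bsub>N\<^esub> \<longleftrightarrow> x \<in> U"
  shows "isomorphic R (quot_mod M U) N"
proof -
  interpret N: left_module R N by fact
  \<comment> \<open>The induced map uses a chosen representative. By \<open>eq\<close>, g separates
    exactly the cosets: the choice is immaterial, and the induced map is injective.\<close>
  define h where "h A = g (SOME x. x \<in> carrier M \<and> A = U +>\<^bsub>M\<^esub> x)" for A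
  have eq: "g x = g y \<longleftrightarrow> U +>\<^bsub>M\<^esub> x = U +>\<^bsub>M\<^esub> y" if "x \<in> carrier M" "y \<in> carrier M" for x y
    using that ker[of "x \<ominus>\<^bsub>M\<^esub> y"] g
    by (simp add: coset_eq_iff mod_hom_minus[OF M N g] N.minus_eq_zero_iff mod_hom_closed[OF g])
  have h: "h (U +>\<^bsub>M\<^esub> x) = g x" if "x \<in> carrier M" for x
  proof -
    have "(SOME y. y \<in> carrier M \<and> U +>\<^bsub>M\<^esub> x = U +>\<^bsub>M\<^esub> y) \<in> carrier M
      \<and> U +>\<^bsub>M\<^esub> x = U +>\<^bsub>M\<^esub> (SOME y. y \<in> carrier M \<and> U +>\<^bsub>M\<^esub> x = U +>\<^bsub>M\<^esub> y)"
      by (rule someI[of _ x]) (use that in simp)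
    then show ?thesis using that eq unfolding h_def by metis
  qed
  have "h \<in> mod_hom R (quot_mod M U) N"
    by (rule mod_homI)
      (auto simp: quot_mod_carrier quot_mod_add quot_mod_smult h M.smult_closed
        mod_hom_closed[OF g] mod_hom_add[OF g] mod_hom_smult[OF g])
  moreover have "bij_betw h (carrier (quot_mod M U)) (carrier N)"
    unfolding bij_betw_def inj_on_def
    using surj by (auto simp: quot_mod_carrier h eq image_image)
  ultimately show ?thesis by (intro isomorphicI mod_isoI)
qed

end

lemma left_module_coker:
  "\<lbrakk>left_module R M; left_module R N; f \<in> mod_hom R M N\<rbrakk> \<Longrightarrow> left_module R (coker_mod M N f)"
  by (simp add: coker_mod_def left_module_quot submodule_range)

text \<open>Only the behaviour of a on the kernel matters, so a need not belong to a commutative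
  square; \<open>ker_\<gamma>_\<mu>\<close> applies this with no companion map on the
  targets.\<close>

lemma ker_isomorphic:
  assumes "left_module R M" "left_module R N" "left_module R M'" "left_module R N'"
    and f: "f \<in> mod_hom R M N" and f': "f' \<in> mod_hom R M' N'" and a: "a \<in> mod_hom R M M'"
    and comm: "\<And>x. \<lbrakk>x \<in> carrier M; f x = \<zero>\<^bsub>N\<^esub>\<rbrakk> \<Longrightarrow> f' (a x) = \<zero>\<^bsub>N'\<^esub>"
    and inj: "\<And>x. \<lbrakk>x \<in> carrier M; f x = \<zero>\<^bsub>N\<^esub>; a x = \<zero>\<^bsub>M'\<^esub>\<rbrakk> \<Longrightarrow> x = \<zero>\<^bsub>M\<^esub>"
    and surj: "\<And>x'. \<lbrakk>x' \<in> carrier M'; f' x' = \<zero>\<^bsub>N'\<^esub>\<rbrakk> \<Longrightarrow> \<exists>x\<in>carrier M. f x = \<zero>\<^bsub>N\<^esub> \<and> a x = x'"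
  shows "isomorphic R (ker_mod M N f) (ker_mod M' N' f')"
proof (rule isomorphicI, rule mod_isoI')
  show "left_module R (ker_mod M N f)" "left_module R (ker_mod M' N' f')"
    using assms by (auto intro: left_module_ker)
  show "a \<in> mod_hom R (ker_mod M N f) (ker_mod M' N' f')"
    using a comm by (auto simp: mod_hom_def)
qed (use inj surj in auto)

text \<open>Followed by the quotient map of N', b becomes a map onto coker f' with kernel exactly im
  f. Surjectivity is asked only modulo im f', because b may be the inclusion of a summand or a map
  into a direct sum.\<close>

lemma coker_isomorphic:
  assumes "left_module R M" "left_module R N" "left_module R M'" "left_module R N'"
    and f: "f \<in> mod_hom R M N" and f': "f' \<in> mod_hom R M' N'" and b: "b \<in> mod_hom R N N'"
    and comm: "\<And>x. x \<in> carrier M \<Longrightarrow> b (f x) \<in> f' ` carrier M'"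
    and inj: "\<And>y x'. \<lbrakk>y \<in> carrier N; x' \<in> carrier M'; b y = f' x'\<rbrakk> \<Longrightarrow> y \<in> f ` carrier M"
    and surj: "\<And>y'. y' \<in> carrier N' \<Longrightarrow>
      \<exists>y\<in>carrier N. \<exists>x'\<in>carrier M'. y' = b y \<oplus>\<^bsub>N'\<^esub> f' x'"
  shows "isomorphic R (coker_mod M N f) (coker_mod M' N' f')"
proof -
  interpret N': left_module R N' by fact
  let ?I = "f ` carrier M" and ?I' = "f' ` carrier M'"
  have I: "submodule ?I R N" and I': "submodule ?I' R N'"
    using assms by (auto intro: submodule_range)
  define g where "g = (\<lambda>x. ?I' +>\<^bsub>N'\<^esub> x) \<circ> b"
  note quot = quot_mod_carrier[OF assms(4) I'] quot_mod_zero[OF assms(4) I']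
  have gh: "g \<in> mod_hom R N (quot_mod N' ?I')"
    unfolding g_def by (rule mod_hom_comp[OF b coset_hom[OF assms(4) I']])
  have "carrier (quot_mod N' ?I') \<subseteq> g ` carrier N"
  proof
    fix A assume "A \<in> carrier (quot_mod N' ?I')"
    then obtain y' where y': "y' \<in> carrier N'" "A = ?I' +>\<^bsub>N'\<^esub> y'" by (auto simp: quot)
    obtain y x' where y: "y \<in> carrier N" "x' \<in> carrier M'" "y' = b y \<oplus>\<^bsub>N'\<^esub> f' x'"
      using surj[OF y'(1)] by auto
    have "y' \<ominus>\<^bsub>N'\<^esub> b y = f' x'"
      using y mod_hom_closed[OF b y(1)] mod_hom_closed[OF f' y(2)]
      by (simp only: N'.M.a_comm[of "b y"] N'.add_minus_cancel)
    then have "A = g y"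
      using y y' mod_hom_closed[OF b y(1)] by (simp add: g_def coset_eq_iff[OF assms(4) I'])
    then show "A \<in> g ` carrier N" using y(1) by blast
  qed
  then have "g ` carrier N = carrier (quot_mod N' ?I')"
    using mod_hom_closed[OF gh] by blast
  moreover have "g x = \<zero>\<^bsub>quot_mod N' ?I'\<^esub> \<longleftrightarrow> x \<in> ?I" if "x \<in> carrier N" for x
    using that comm inj mod_hom_closed[OF b that]
    by (auto simp: g_def quot coset_eq_subgroup_iff[OF assms(4) I'])
  ultimately show ?thesis unfolding coker_mod_def
    by (intro first_isomorphism[OF assms(2) I left_module_quot[OF assms(4) I'] gh])
qed

lemma mod_hom_id: "(\<lambda>x. x) \<in> mod_hom R M M"
  by (auto simp: mod_hom_def)

lemma mod_hom_const_zero: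
  assumes "left_module R M" "left_module R N"
  shows "(\<lambda>x. \<zero>\<^bsub>N\<^esub>) \<in> mod_hom R M N"
proof -
  interpret N: left_module R N by fact
  show ?thesis by (rule mod_homI) (simp_all add: N.smult_r_null)
qed

lemma map_prod_hom:
  assumes "f \<in> mod_hom R M M'" "g \<in> mod_hom R N N'"
  shows "map_prod f g \<in> mod_hom R (dsum M N) (dsum M' N')"
  by (rule mod_homI)
    (auto simp: assms[THEN mod_hom_closed] assms[THEN mod_hom_add] assms[THEN mod_hom_smult])

text \<open>The carriers and operations coincide, so the identity serves.\<close>

lemma ker_map_prod_isomorphic:
  "isomorphic R (ker_mod (dsum M N) (dsum M' N') (map_prod f g)) (dsum (ker_mod M M' f) (ker_mod N N' g))"
  by (rule isomorphicI[of "\<lambda>x. x"]) (auto simp: mod_iso_def mod_hom_def bij_betw_def)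

lemma coker_map_prod_isomorphic:
  assumes M: "left_module R M" and M': "left_module R M'" and N: "left_module R N" and N': "left_module R N'"
    and f: "f \<in> mod_hom R M M'" and g: "g \<in> mod_hom R N N'"
  shows "isomorphic R (coker_mod (dsum M N) (dsum M' N') (map_prod f g))
    (dsum (coker_mod M M' f) (coker_mod N N' g))"
proof -
  let ?F = "f ` carrier M" and ?G = "g ` carrier N"
  have F: "submodule ?F R M'" and G: "submodule ?G R N'"
    using assms by (auto intro: submodule_range)
  note D = left_module_dsum[OF M N] and D' = left_module_dsum[OF M' N']
  note fg = map_prod_hom[OF f g]
  note quot = quot_mod_carrier[OF M' F] quot_mod_carrier[OF N' G]
  show ?thesis
    unfolding coker_mod_def
  proof (rule first_isomorphism[OF D' submodule_range[OF D D' fg]])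
    show "left_module R (dsum (quot_mod M' ?F) (quot_mod N' ?G))"
      by (intro left_module_dsum left_module_quot M' N' F G)
    show "map_prod (\<lambda>x. ?F +>\<^bsub>M'\<^esub> x) (\<lambda>x. ?G +>\<^bsub>N'\<^esub> x)
      \<in> mod_hom R (dsum M' N') (dsum (quot_mod M' ?F) (quot_mod N' ?G))"
      by (intro map_prod_hom coset_hom M' N' F G)
    show "map_prod (\<lambda>x. ?F +>\<^bsub>M'\<^esub> x) (\<lambda>x. ?G +>\<^bsub>N'\<^esub> x) ` carrier (dsum M' N')
      = carrier (dsum (quot_mod M' ?F) (quot_mod N' ?G))"
      unfolding dsum_simps quot by (rule map_prod_surj_on) (rule refl)+
  next
    fix x assume "x \<in> carrier (dsum M' N')"
    then obtain m n where x: "x = (m, n)" "m \<in> carrier M'" "n \<in> carrier N'" by auto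
    show "map_prod (\<lambda>x. ?F +>\<^bsub>M'\<^esub> x) (\<lambda>x. ?G +>\<^bsub>N'\<^esub> x) x
      = \<zero>\<^bsub>dsum (quot_mod M' ?F) (quot_mod N' ?G)\<^esub> \<longleftrightarrow> x \<in> map_prod f g ` carrier (dsum M N)"
      unfolding x dsum_simps quot_mod_zero[OF M' F] quot_mod_zero[OF N' G] map_prod_simp prod.inject
        coset_eq_subgroup_iff[OF M' F x(2)] coset_eq_subgroup_iff[OF N' G x(3)]
      by auto
  qed
qed

section \<open>Stabilisation of homomorphisms\<close>

text \<open>
  Up to isomorphism, \<open>f'\<close> is the direct sum of \<open>f\<close> and an isomorphism: \<open>i\<close>, \<open>j\<close> are the inclusions
  of the summands, \<open>p\<close>, \<open>r\<close> the projections, and \<open>g\<close> is the inverse of the isomorphism, extended by zero.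
\<close>

locale stabilization =
  fixes R :: "('a, 'r) ring_scheme" and M :: "('a, 'm) module" and N :: "('a, 'n) module" and f
    and M' :: "('a, 'm2) module" and N' :: "('a, 'n2) module" and f' i p j r g
  assumes M: "left_module R M" and N: "left_module R N"
    and M': "left_module R M'" and N': "left_module R N'"
    and f: "f \<in> mod_hom R M N" and f': "f' \<in> mod_hom R M' N'"
    and i: "i \<in> mod_hom R M M'" and p: "p \<in> mod_hom R M' M"
    and j: "j \<in> mod_hom R N N'" and r: "r \<in> mod_hom R N' N"
    and g: "g \<in> mod_hom R N' M'"
    and pi: "x \<in> carrier M \<Longrightarrow> p (i x) = x" and rj: "y \<in> carrier N \<Longrightarrow> r (j y) = y"
    and fi: "x \<in> carrier M \<Longrightarrow> f' (i x) = j (f x)"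
    and rf: "x' \<in> carrier M' \<Longrightarrow> r (f' x') = f (p x')"
    and gj: "y \<in> carrier N \<Longrightarrow> g (j y) = \<zero>\<^bsub>M'\<^esub>" and pg: "y' \<in> carrier N' \<Longrightarrow> p (g y') = \<zero>\<^bsub>M\<^esub>"
    and gf: "x' \<in> carrier M' \<Longrightarrow> g (f' x') \<oplus>\<^bsub>M'\<^esub> i (p x') = x'"
    and fg: "y' \<in> carrier N' \<Longrightarrow> f' (g y') \<oplus>\<^bsub>N'\<^esub> j (r y') = y'"
begin

lemma ker_iso: "isomorphic R (ker_mod M N f) (ker_mod M' N' f')"
proof (rule ker_isomorphic[OF M N M' N' f f' i])
  interpret M': left_module R M' by (rule M')
  \<comment> \<open>On ker f' the identity \<open>gf\<close> reads i (p x') = x', so this kernel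
    lies in the summand i M.\<close>
  fix x' assume x': "x' \<in> carrier M'" "f' x' = \<zero>\<^bsub>N'\<^esub>"
  have c: "i (p x') \<in> carrier M'" using x' by (simp add: i[THEN mod_hom_closed] p[THEN mod_hom_closed])
  have "i (p x') = x'" using gf[OF x'(1)] c by (simp add: x'(2) mod_hom_zero[OF N' M' g])
  moreover have "f (p x') = \<zero>\<^bsub>N\<^esub>" using rf[OF x'(1)] by (simp add: x'(2) mod_hom_zero[OF N' N r])
  ultimately show "\<exists>x\<in>carrier M. f x = \<zero>\<^bsub>N\<^esub> \<and> i x = x'" using mod_hom_closed[OF p x'(1)] by auto
next
  fix x assume x: "x \<in> carrier M" "i x = \<zero>\<^bsub>M'\<^esub>"
  then show "x = \<zero>\<^bsub>M\<^esub>" using pi[OF x(1)] by (simp add: mod_hom_zero[OF M' M p])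
qed (simp add: fi mod_hom_zero[OF N N' j])

text \<open>By \<open>fg\<close>, every element of N' is congruent to its j-component modulo the
  image of f'.\<close>

lemma coker_iso: "isomorphic R (coker_mod M N f) (coker_mod M' N' f')"
proof (rule coker_isomorphic[OF M N M' N' f f' j])
  interpret N': left_module R N' by (rule N')
  show "j (f x) \<in> f' ` carrier M'" if "x \<in> carrier M" for x
    using that by (simp flip: fi add: mod_hom_closed[OF i])
  show "y \<in> f ` carrier M" if "y \<in> carrier N" "x' \<in> carrier M'" "j y = f' x'" for y x'
    using rf[OF that(2)] rj[OF that(1)] mod_hom_closed[OF p that(2)] unfolding that(3) by simp
  fix y' assume y': "y' \<in> carrier N'"
  note c = mod_hom_closed[OF r y'] mod_hom_closed[OF g y']
  have "y' = j (r y') \<oplus>\<^bsub>N'\<^esub> f' (g y')"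
    using fg[OF y'] N'.M.a_comm[OF mod_hom_closed[OF f' c(2)] mod_hom_closed[OF j c(1)]] by simp
  then show "\<exists>y\<in>carrier N. \<exists>x'\<in>carrier M'. y' = j y \<oplus>\<^bsub>N'\<^esub> f' x'"
    using c by blast
qed

end

text \<open>Both stabilisations use the same j and r on the middle module. As g kills the image of j
  and g' takes values in the kernel of r, the two inverses extended by zero still compose to the
  inverse of the composite, extended by zero (\<open>gg\<close>, \<open>ff\<close>).\<close>

lemma stabilization_comp:
  assumes "stabilization R M N f M' N' f' i p j r g" "stabilization R N L h N' L' h' j r k s g'"
  shows "stabilization R M L (h \<circ> f) M' L' (h' \<circ> f') i p k s (g \<circ> g')"
proof -
  interpret f: stabilization R M N f M' N' f' i p j r g by fact
  interpret h: stabilization R N L h N' L' h' j r k s g' by fact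
  interpret M': left_module R M' by (rule f.M')
  interpret N': left_module R N' by (rule f.N')
  note c = f.f[THEN mod_hom_closed] f.f'[THEN mod_hom_closed] f.i[THEN mod_hom_closed]
    f.p[THEN mod_hom_closed] f.j[THEN mod_hom_closed] f.r[THEN mod_hom_closed] f.g[THEN mod_hom_closed]
    h.f[THEN mod_hom_closed] h.f'[THEN mod_hom_closed] h.j[THEN mod_hom_closed]
    h.r[THEN mod_hom_closed] h.g[THEN mod_hom_closed]
  have gg: "g (g' (h' (f' x))) = g (f' x)" if x: "x \<in> carrier M'" for x
  proof -
    have "g (g' (h' (f' x)) \<oplus>\<^bsub>N'\<^esub> j (r (f' x))) = g (f' x)"
      using h.gf[of "f' x"] x by (simp add: c)
    then show ?thesis using x by (simp add: mod_hom_add[OF f.g] c f.gj)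
  qed
  have ff: "f' (g (g' y)) = g' y" if y: "y \<in> carrier L'" for y
    using f.fg[of "g' y"] y by (simp add: c h.pg mod_hom_zero[OF f.N f.N' f.j])
  show ?thesis
  proof (rule stabilization.intro)
    show "left_module R M" "left_module R L" "left_module R M'" "left_module R L'"
      "h \<circ> f \<in> mod_hom R M L" "h' \<circ> f' \<in> mod_hom R M' L'" "i \<in> mod_hom R M M'"
      "p \<in> mod_hom R M' M" "k \<in> mod_hom R L L'" "s \<in> mod_hom R L' L" "g \<circ> g' \<in> mod_hom R L' M'"
      by (rule f.M h.N f.M' h.N' mod_hom_comp[OF f.f h.f] mod_hom_comp[OF f.f' h.f'] f.i f.p h.j h.r
        mod_hom_comp[OF h.g f.g])+
  qed (unfold comp_def,
    simp_all only: c f.pi h.rj f.fi h.fi f.rf h.rf h.gj f.pg mod_hom_zero[OF f.N' f.M' f.g] gg f.gf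
      ff h.fg)
qed

section \<open>Dual modules\<close>

context involution_ring
begin

lemma bar_zero: "bar \<zero> = \<zero>"
  using bar_add[of \<zero> \<zero>] bar_closed[of \<zero>] by simp

lemma bar_uminus: "a \<in> carrier \<Lambda> \<Longrightarrow> bar (\<ominus> a) = \<ominus> bar a"
  using bar_add[of "\<ominus> a" a] bar_closed[of a] bar_closed[of "\<ominus> a"]
  by (simp add: l_neg bar_zero minus_equality)

lemma bar_eq_zero_iff: "a \<in> carrier \<Lambda> \<Longrightarrow> bar a = \<zero> \<longleftrightarrow> a = \<zero>"
  using bar_bar[of a] bar_zero by auto

end

lemma dual_carrier_iff:
  "f \<in> carrier (dual \<Lambda> M) \<longleftrightarrow> f \<in> carrier M \<rightarrow>\<^sub>E carrier \<Lambda> \<and>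
     (\<forall>x\<in>carrier M. \<forall>y\<in>carrier M. f (x \<oplus>\<^bsub>M\<^esub> y) = f x \<oplus>\<^bsub>\<Lambda>\<^esub> f y) \<and>
     (\<forall>a\<in>carrier \<Lambda>. \<forall>x\<in>carrier M. f (a \<odot>\<^bsub>M\<^esub> x) = a \<otimes>\<^bsub>\<Lambda>\<^esub> f x)"
  by (simp add: dual_def)

lemma dual_closed: "\<lbrakk>f \<in> carrier (dual \<Lambda> M); x \<in> carrier M\<rbrakk> \<Longrightarrow> f x \<in> carrier \<Lambda>"
  and dual_add: "\<lbrakk>f \<in> carrier (dual \<Lambda> M); x \<in> carrier M; y \<in> carrier M\<rbrakk>
    \<Longrightarrow> f (x \<oplus>\<^bsub>M\<^esub> y) = f x \<oplus>\<^bsub>\<Lambda>\<^esub> f y"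
  and dual_smult: "\<lbrakk>f \<in> carrier (dual \<Lambda> M); a \<in> carrier \<Lambda>; x \<in> carrier M\<rbrakk>
    \<Longrightarrow> f (a \<odot>\<^bsub>M\<^esub> x) = a \<otimes>\<^bsub>\<Lambda>\<^esub> f x"
  by (auto simp: dual_carrier_iff)

lemma dual_ops:
  "x \<in> carrier M \<Longrightarrow> \<zero>\<^bsub>dual \<Lambda> M\<^esub> x = \<zero>\<^bsub>\<Lambda>\<^esub>"
  "x \<in> carrier M \<Longrightarrow> (f \<oplus>\<^bsub>dual \<Lambda> M\<^esub> g) x = f x \<oplus>\<^bsub>\<Lambda>\<^esub> g x"
  "x \<in> carrier M \<Longrightarrow> (a \<odot>\<^bsub>dual \<Lambda> M\<^esub> f) x = f x \<otimes>\<^bsub>\<Lambda>\<^esub> bar\<^bsub>\<Lambda>\<^esub> a"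
  by (simp_all add: dual_def)

lemma dual_zero_eq: "\<zero>\<^bsub>dual \<Lambda> M\<^esub> = (\<lambda>x\<in>carrier M. \<zero>\<^bsub>\<Lambda>\<^esub>)"
  by (simp add: dual_def)

lemma dual_extensional: "f \<in> carrier (dual \<Lambda> M) \<Longrightarrow> f \<in> extensional (carrier M)"
  by (auto simp: dual_carrier_iff PiE_def)

lemma dual_ops_extensional:
  "\<zero>\<^bsub>dual \<Lambda> M\<^esub> \<in> extensional (carrier M)"
  "f \<oplus>\<^bsub>dual \<Lambda> M\<^esub> g \<in> extensional (carrier M)"
  "a \<odot>\<^bsub>dual \<Lambda> M\<^esub> f \<in> extensional (carrier M)"
  by (simp_all add: dual_def)

lemma dual_eqI:
  "\<lbrakk>f \<in> carrier (dual \<Lambda> M); g \<in> carrier (dual \<Lambda> M); \<And>x. x \<in> carrier M \<Longrightarrow> f x = g x\<rbrakk> \<Longrightarrow> f = g"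
  by (rule extensionalityI[of _ "carrier M"]) (auto intro: dual_extensional)

lemma dual_carrierI:
  assumes "left_module \<Lambda> M"
    and cl: "\<And>x. x \<in> carrier M \<Longrightarrow> h x \<in> carrier \<Lambda>"
    and add: "\<And>x y. \<lbrakk>x \<in> carrier M; y \<in> carrier M\<rbrakk> \<Longrightarrow> h (x \<oplus>\<^bsub>M\<^esub> y) = h x \<oplus>\<^bsub>\<Lambda>\<^esub> h y"
    and smult: "\<And>a x. \<lbrakk>a \<in> carrier \<Lambda>; x \<in> carrier M\<rbrakk> \<Longrightarrow> h (a \<odot>\<^bsub>M\<^esub> x) = a \<otimes>\<^bsub>\<Lambda>\<^esub> h x"
  shows "(\<lambda>x\<in>carrier M. h x) \<in> carrier (dual \<Lambda> M)"
proof -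
  interpret left_module \<Lambda> M by fact
  show ?thesis using cl by (auto simp: dual_carrier_iff add smult smult_closed)
qed

text \<open>Scalars act by right multiplication with bar a. Since bar reverses products, both (ab) f
  and a (b f) multiply the values of f by bar b and then by bar a.\<close>

lemma left_module_dual:
  assumes "involution_ring \<Lambda>" "left_module \<Lambda> M"
  shows "left_module \<Lambda> (dual \<Lambda> M)"
proof -
  interpret L: involution_ring \<Lambda> by fact
  interpret M: left_module \<Lambda> M by fact
  note [simp] = L.bar_closed dual_closed M.smult_closed
  have add: "f \<oplus>\<^bsub>dual \<Lambda> M\<^esub> g \<in> carrier (dual \<Lambda> M)"
    if "f \<in> carrier (dual \<Lambda> M)" "g \<in> carrier (dual \<Lambda> M)" for f g
  proof -
    have "(\<lambda>x\<in>carrier M. f x \<oplus>\<^bsub>\<Lambda>\<^esub> g x) \<in> carrier (dual \<Lambda> M)"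
      by (rule dual_carrierI[OF assms(2)])
        (simp_all add: that that[THEN dual_add] that[THEN dual_smult] L.r_distr L.a_ac that[THEN dual_closed])
    then show ?thesis by (simp add: dual_def)
  qed
  have smult: "a \<odot>\<^bsub>dual \<Lambda> M\<^esub> f \<in> carrier (dual \<Lambda> M)"
    if "a \<in> carrier \<Lambda>" "f \<in> carrier (dual \<Lambda> M)" for a f
  proof -
    have "(\<lambda>x\<in>carrier M. f x \<otimes>\<^bsub>\<Lambda>\<^esub> bar\<^bsub>\<Lambda>\<^esub> a) \<in> carrier (dual \<Lambda> M)"
      by (rule dual_carrierI[OF assms(2)])
        (simp_all add: that dual_add[OF that(2)] dual_smult[OF that(2)] L.l_distr L.m_assoc
          dual_closed[OF that(2)])
    then show ?thesis by (simp add: dual_def)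
  qed
  have zero: "\<zero>\<^bsub>dual \<Lambda> M\<^esub> \<in> carrier (dual \<Lambda> M)"
    unfolding dual_zero_eq by (rule dual_carrierI[OF assms(2)]) simp_all
  show ?thesis
  proof (rule left_moduleI)
    show "ring \<Lambda>" ..
  next
    fix a f assume af: "a \<in> carrier \<Lambda>" "f \<in> carrier (dual \<Lambda> M)"
    show "a \<odot>\<^bsub>dual \<Lambda> M\<^esub> f \<in> carrier (dual \<Lambda> M)" using af by (rule smult)
  qed (auto intro!: dual_eqI[where M = M and \<Lambda> = \<Lambda>] add zero smult
      simp: dual_ops L.a_ac L.m_assoc L.l_distr L.r_distr L.bar_add L.bar_mult L.bar_one L.bar_zero)
qed

lemma dual_at_zero:
  assumes "left_module \<Lambda> M" "f \<in> carrier (dual \<Lambda> M)"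
  shows "f \<zero>\<^bsub>M\<^esub> = \<zero>\<^bsub>\<Lambda>\<^esub>"
proof -
  interpret M: left_module \<Lambda> M by fact
  show ?thesis using dual_add[OF assms(2), of "\<zero>\<^bsub>M\<^esub>" "\<zero>\<^bsub>M\<^esub>"] dual_closed[OF assms(2), of "\<zero>\<^bsub>M\<^esub>"] by simp
qed

lemma dual_map_apply: "x \<in> carrier M \<Longrightarrow> dual_map M h f x = f (h x)"
  by (simp add: dual_map_def)

lemma dual_map_closed:
  assumes "left_module \<Lambda> M" "h \<in> mod_hom \<Lambda> M N" "f \<in> carrier (dual \<Lambda> N)"
  shows "dual_map M h f \<in> carrier (dual \<Lambda> M)"
  unfolding dual_map_def
  by (rule dual_carrierI[OF assms(1)])
    (simp_all add: assms(2)[THEN mod_hom_closed] assms(2)[THEN mod_hom_add] assms(2)[THEN mod_hom_smult]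
      dual_closed[OF assms(3)] dual_add[OF assms(3)] dual_smult[OF assms(3)])

lemma dual_map_hom:
  assumes "involution_ring \<Lambda>" "left_module \<Lambda> M" "left_module \<Lambda> N" "h \<in> mod_hom \<Lambda> M N"
  shows "dual_map M h \<in> mod_hom \<Lambda> (dual \<Lambda> N) (dual \<Lambda> M)"
proof (rule mod_homI)
  interpret M: left_module \<Lambda> "dual \<Lambda> M" by (rule left_module_dual[OF assms(1,2)])
  interpret N: left_module \<Lambda> "dual \<Lambda> N" by (rule left_module_dual[OF assms(1,3)])
  note c = dual_map_closed[OF assms(2,4)]
  fix f assume f: "f \<in> carrier (dual \<Lambda> N)"
  then show "dual_map M h f \<in> carrier (dual \<Lambda> M)" by (rule c)
  show "dual_map M h (f \<oplus>\<^bsub>dual \<Lambda> N\<^esub> g) = dual_map M h f \<oplus>\<^bsub>dual \<Lambda> M\<^esub> dual_map M h g"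
    if g: "g \<in> carrier (dual \<Lambda> N)" for g
    by (rule dual_eqI[where M = M and \<Lambda> = \<Lambda>])
      (auto intro!: c f g N.M.a_closed M.M.a_closed simp: dual_map_apply dual_ops mod_hom_closed[OF assms(4)])
  show "dual_map M h (a \<odot>\<^bsub>dual \<Lambda> N\<^esub> f) = a \<odot>\<^bsub>dual \<Lambda> M\<^esub> dual_map M h f"
    if a: "a \<in> carrier \<Lambda>" for a
    by (rule dual_eqI[where M = M and \<Lambda> = \<Lambda>])
      (auto intro!: c f a N.smult_closed M.smult_closed
        simp: dual_map_apply dual_ops mod_hom_closed[OF assms(4)])
qed

text \<open>Arrows are reversed: r and p become inclusions, j and i projections. Accordingly
  \<open>rf\<close> turns into \<open>fi\<close>, \<open>pg\<close> into \<open>gj\<close>,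
  \<open>fg\<close> into \<open>gf\<close>, and conversely.\<close>

lemma stabilization_dual:
  assumes I: "involution_ring \<Lambda>" and "stabilization \<Lambda> M N f M' N' f' i p j r g"
  shows "stabilization \<Lambda> (dual \<Lambda> N) (dual \<Lambda> M) (dual_map M f) (dual \<Lambda> N') (dual \<Lambda> M')
    (dual_map M' f') (dual_map N' r) (dual_map N j) (dual_map M' p) (dual_map M i) (dual_map N' g)"
proof -
  interpret s: stabilization \<Lambda> M N f M' N' f' i p j r g by fact
  interpret L: involution_ring \<Lambda> by fact
  note c = s.f[THEN mod_hom_closed] s.f'[THEN mod_hom_closed] s.i[THEN mod_hom_closed]
    s.p[THEN mod_hom_closed] s.j[THEN mod_hom_closed] s.r[THEN mod_hom_closed] s.g[THEN mod_hom_closed]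
  note d = left_module_dual[OF I]
  note dM = d[OF s.M] and dN = d[OF s.N] and dM' = d[OF s.M'] and dN' = d[OF s.N']
  note h = dual_map_hom[OF I]
  note hc = h[OF s.M s.N s.f] h[OF s.M' s.N' s.f'] h[OF s.M s.M' s.i] h[OF s.M' s.M s.p]
    h[OF s.N s.N' s.j] h[OF s.N' s.N s.r] h[OF s.N' s.M' s.g]
  note hcl = hc[THEN mod_hom_closed]
  interpret dM': left_module \<Lambda> "dual \<Lambda> M'" by (rule dM')
  interpret dN': left_module \<Lambda> "dual \<Lambda> N'" by (rule dN')
  interpret dM: left_module \<Lambda> "dual \<Lambda> M" by (rule dM)
  show ?thesis
  proof (rule stabilization.intro)
    fix \<phi> assume \<phi>: "\<phi> \<in> carrier (dual \<Lambda> N)"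
    show "dual_map N j (dual_map N' r \<phi>) = \<phi>"
      by (rule dual_eqI[where M = N and \<Lambda> = \<Lambda>]) (simp_all add: hcl \<phi> dual_map_apply c s.rj)
    show "dual_map M' f' (dual_map N' r \<phi>) = dual_map M' p (dual_map M f \<phi>)"
      by (rule dual_eqI[where M = M' and \<Lambda> = \<Lambda>]) (simp_all add: hcl \<phi> dual_map_apply c s.rf)
  next
    fix \<phi> assume \<phi>: "\<phi> \<in> carrier (dual \<Lambda> M)"
    show "dual_map M i (dual_map M' p \<phi>) = \<phi>"
      by (rule dual_eqI[where M = M and \<Lambda> = \<Lambda>]) (simp_all add: hcl \<phi> dual_map_apply c s.pi)
    show "dual_map N' g (dual_map M' p \<phi>) = \<zero>\<^bsub>dual \<Lambda> N'\<^esub>"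
      by (rule dual_eqI[where M = N' and \<Lambda> = \<Lambda>])
        (simp_all add: hcl \<phi> dual_map_apply c s.pg dual_at_zero[OF s.M \<phi>] dual_ops)
  next
    fix \<phi> assume \<phi>: "\<phi> \<in> carrier (dual \<Lambda> N')"
    show "dual_map M i (dual_map M' f' \<phi>) = dual_map M f (dual_map N j \<phi>)"
      by (rule dual_eqI[where M = M and \<Lambda> = \<Lambda>]) (simp_all add: hcl \<phi> dual_map_apply c s.fi)
    show "dual_map N' g (dual_map M' f' \<phi>) \<oplus>\<^bsub>dual \<Lambda> N'\<^esub> dual_map N' r (dual_map N j \<phi>) = \<phi>"
    proof (rule dual_eqI[where M = N' and \<Lambda> = \<Lambda>])
      fix y assume y: "y \<in> carrier N'"
      have "\<phi> (f' (g y) \<oplus>\<^bsub>N'\<^esub> j (r y)) = \<phi> y" using s.fg[OF y] by simp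
      then show "(dual_map N' g (dual_map M' f' \<phi>) \<oplus>\<^bsub>dual \<Lambda> N'\<^esub> dual_map N' r (dual_map N j \<phi>)) y = \<phi> y"
        using y by (simp add: dual_add[OF \<phi>] dual_map_apply dual_ops c)
    qed (simp_all add: hcl \<phi>)
  next
    fix \<phi> assume \<phi>: "\<phi> \<in> carrier (dual \<Lambda> M')"
    show "dual_map N j (dual_map N' g \<phi>) = \<zero>\<^bsub>dual \<Lambda> N\<^esub>"
      by (rule dual_eqI[where M = N and \<Lambda> = \<Lambda>])
        (simp_all add: hcl \<phi> dual_map_apply c s.gj dual_at_zero[OF s.M' \<phi>] dual_ops
          abelian_monoid.zero_closed[OF abelian_group.axioms(1)[OF left_module.axioms(2)[OF dN]]])
    show "dual_map M' f' (dual_map N' g \<phi>) \<oplus>\<^bsub>dual \<Lambda> M'\<^esub> dual_map M' p (dual_map M i \<phi>) = \<phi>"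
    proof (rule dual_eqI[where M = M' and \<Lambda> = \<Lambda>])
      fix y assume y: "y \<in> carrier M'"
      have "\<phi> (g (f' y) \<oplus>\<^bsub>M'\<^esub> i (p y)) = \<phi> y" using s.gf[OF y] by simp
      then show "(dual_map M' f' (dual_map N' g \<phi>) \<oplus>\<^bsub>dual \<Lambda> M'\<^esub> dual_map M' p (dual_map M i \<phi>)) y = \<phi> y"
        using y by (simp add: dual_add[OF \<phi>] dual_map_apply dual_ops c)
    qed (simp_all add: hcl \<phi>)
  qed (rule dM dN dM' dN' hc)+
qed

lemma dual_map_iso:
  assumes I: "involution_ring \<Lambda>" and M: "left_module \<Lambda> M" and N: "left_module \<Lambda> N"
    and h: "h \<in> mod_iso \<Lambda> M N"
  shows "dual_map M h \<in> mod_iso \<Lambda> (dual \<Lambda> N) (dual \<Lambda> M)"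
proof -
  note k = mod_iso_hom[OF mod_iso_inv[OF M h]] and hom = mod_iso_hom[OF h] and bij = mod_iso_bij[OF h]
  note hc = mod_hom_closed[OF hom] and kc = mod_hom_closed[OF k]
  note e = dual_map_apply bij_betw_inv_into_left[OF bij] bij_betw_inv_into_right[OF bij] hc kc
  note ch = mod_hom_closed[OF dual_map_hom[OF I M N hom]] and ck = mod_hom_closed[OF dual_map_hom[OF I N M k]]
  have "bij_betw (dual_map M h) (carrier (dual \<Lambda> N)) (carrier (dual \<Lambda> M))"
    by (rule bij_betw_byWitness[where f' = "dual_map N (inv_into (carrier M) h)"])
      (auto intro!: ch ck dual_eqI[where M = M and \<Lambda> = \<Lambda>] dual_eqI[where M = N and \<Lambda> = \<Lambda>] simp: e)
  then show ?thesis by (intro mod_isoI dual_map_hom I M N hom)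
qed

lemma isomorphic_dual:
  "\<lbrakk>involution_ring \<Lambda>; left_module \<Lambda> M; left_module \<Lambda> N; isomorphic \<Lambda> N M\<rbrakk>
    \<Longrightarrow> isomorphic \<Lambda> (dual \<Lambda> M) (dual \<Lambda> N)"
  by (elim isomorphicE) (rule isomorphicI, rule dual_map_iso)

lemma fst_hom: "fst \<in> mod_hom R (dsum M N) M" and snd_hom: "snd \<in> mod_hom R (dsum M N) N"
  by (auto simp: mod_hom_def)

lemma inl_hom:
  assumes "left_module R N" shows "(\<lambda>x. (x, \<zero>\<^bsub>N\<^esub>)) \<in> mod_hom R M (dsum M N)"
proof -
  interpret N: left_module R N by fact
  show ?thesis by (rule mod_homI) (simp_all add: N.smult_r_null)
qed

lemma inr_hom:
  assumes "left_module R M" shows "(\<lambda>x. (\<zero>\<^bsub>M\<^esub>, x)) \<in> mod_hom R N (dsum M N)"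
proof -
  interpret M: left_module R M by fact
  show ?thesis by (rule mod_homI) (simp_all add: M.smult_r_null)
qed

lemma dual_dsum_decomp:
  assumes M: "left_module \<Lambda> M" and N: "left_module \<Lambda> N"
    and f: "f \<in> carrier (dual \<Lambda> (dsum M N))" and x: "x \<in> carrier M" and y: "y \<in> carrier N"
  shows "f (x, y) = f (x, \<zero>\<^bsub>N\<^esub>) \<oplus>\<^bsub>\<Lambda>\<^esub> f (\<zero>\<^bsub>M\<^esub>, y)"
proof -
  interpret M: left_module \<Lambda> M by fact
  interpret N: left_module \<Lambda> N by fact
  show ?thesis using dual_add[OF f, of "(x, \<zero>\<^bsub>N\<^esub>)" "(\<zero>\<^bsub>M\<^esub>, y)"] x y by simp
qed

lemma dual_dsum_isomorphic:
  assumes I: "involution_ring \<Lambda>" and M: "left_module \<Lambda> M" and N: "left_module \<Lambda> N"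
  shows "isomorphic \<Lambda> (dual \<Lambda> (dsum M N)) (dsum (dual \<Lambda> M) (dual \<Lambda> N))"
proof -
  let ?D = "dsum M N"
  note D = left_module_dsum[OF M N] and d = left_module_dual[OF I]
  interpret L: involution_ring \<Lambda> by fact
  interpret M: left_module \<Lambda> M by fact
  interpret N: left_module \<Lambda> N by fact
  interpret dD: left_module \<Lambda> "dual \<Lambda> ?D" by (rule d[OF D])
  let ?l = "dual_map M (\<lambda>x. (x, \<zero>\<^bsub>N\<^esub>))" and ?r = "dual_map N (\<lambda>y. (\<zero>\<^bsub>M\<^esub>, y))"
  note l = dual_map_hom[OF I M D inl_hom[OF N]] and r = dual_map_hom[OF I N D inr_hom[OF M]]
  have "(\<lambda>f. (?l f, ?r f)) \<in> mod_iso \<Lambda> (dual \<Lambda> ?D) (dsum (dual \<Lambda> M) (dual \<Lambda> N))"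
  proof (rule mod_isoI'[OF d[OF D] left_module_dsum[OF d[OF M] d[OF N]]])
    show "(\<lambda>f. (?l f, ?r f)) \<in> mod_hom \<Lambda> (dual \<Lambda> ?D) (dsum (dual \<Lambda> M) (dual \<Lambda> N))"
      by (rule mod_homI)
        (simp_all add: mod_hom_closed[OF l] mod_hom_closed[OF r] mod_hom_add[OF l] mod_hom_add[OF r]
          mod_hom_smult[OF l] mod_hom_smult[OF r])
  next
    fix f assume f: "f \<in> carrier (dual \<Lambda> ?D)"
      and "(?l f, ?r f) = \<zero>\<^bsub>dsum (dual \<Lambda> M) (dual \<Lambda> N)\<^esub>"
    then have e: "?l f = \<zero>\<^bsub>dual \<Lambda> M\<^esub>" "?r f = \<zero>\<^bsub>dual \<Lambda> N\<^esub>" by simp_all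
    have "f (x, \<zero>\<^bsub>N\<^esub>) = \<zero>\<^bsub>\<Lambda>\<^esub>" if "x \<in> carrier M" for x
      using fun_cong[OF e(1), of x] that by (simp add: dual_map_apply dual_ops)
    moreover have "f (\<zero>\<^bsub>M\<^esub>, y) = \<zero>\<^bsub>\<Lambda>\<^esub>" if "y \<in> carrier N" for y
      using fun_cong[OF e(2), of y] that by (simp add: dual_map_apply dual_ops)
    ultimately have "f (x, y) = \<zero>\<^bsub>\<Lambda>\<^esub>" if "x \<in> carrier M" "y \<in> carrier N" for x y
      using dual_dsum_decomp[OF M N f that] that by simp
    then show "f = \<zero>\<^bsub>dual \<Lambda> ?D\<^esub>"
      by (intro dual_eqI[where M = ?D and \<Lambda> = \<Lambda>] f dD.M.zero_closed) (auto simp: dual_ops)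
  next
    fix \<phi> assume "\<phi> \<in> carrier (dsum (dual \<Lambda> M) (dual \<Lambda> N))"
    then obtain g h where \<phi>: "\<phi> = (g, h)" and g: "g \<in> carrier (dual \<Lambda> M)" and h: "h \<in> carrier (dual \<Lambda> N)"
      by auto
    let ?f = "dual_map ?D fst g \<oplus>\<^bsub>dual \<Lambda> ?D\<^esub> dual_map ?D snd h"
    note fs = mod_hom_closed[OF dual_map_hom[OF I D M fst_hom] g] mod_hom_closed[OF dual_map_hom[OF I D N snd_hom] h]
    have f: "?f \<in> carrier (dual \<Lambda> ?D)" by (intro dD.M.a_closed fs)
    note z = dual_at_zero[OF M g] dual_at_zero[OF N h]
    have "?l ?f = g"
      by (rule dual_eqI[where M = M and \<Lambda> = \<Lambda>])
        (simp_all add: mod_hom_closed[OF l] f g dual_map_apply dual_ops z dual_closed[OF g])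
    moreover have "?r ?f = h"
      by (rule dual_eqI[where M = N and \<Lambda> = \<Lambda>])
        (simp_all add: mod_hom_closed[OF r] f h dual_map_apply dual_ops z dual_closed[OF h])
    ultimately show "\<exists>f\<in>carrier (dual \<Lambda> ?D). (?l f, ?r f) = \<phi>" using f \<phi> by blast
  qed
  then show ?thesis by (rule isomorphicI)
qed

section \<open>Free modules\<close>

lemma free_mod_simps:
  "carrier (free_mod R n) = {..<n} \<rightarrow>\<^sub>E carrier R"
  "\<zero>\<^bsub>free_mod R n\<^esub> = (\<lambda>i\<in>{..<n}. \<zero>\<^bsub>R\<^esub>)"
  "x \<oplus>\<^bsub>free_mod R n\<^esub> y = (\<lambda>i\<in>{..<n}. x i \<oplus>\<^bsub>R\<^esub> y i)"
  "a \<odot>\<^bsub>free_mod R n\<^esub> x = (\<lambda>i\<in>{..<n}. a \<otimes>\<^bsub>R\<^esub> x i)"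
  by (simp_all add: free_mod_def)

lemma free_mod_eqI:
  "\<lbrakk>x \<in> carrier (free_mod R n); y \<in> carrier (free_mod R n); \<And>i. i < n \<Longrightarrow> x i = y i\<rbrakk> \<Longrightarrow> x = y"
  unfolding free_mod_simps by (rule PiE_ext) auto

lemma left_module_free:
  assumes "ring R" shows "left_module R (free_mod R n)"
proof -
  interpret ring R by fact
  have c: "x i \<in> carrier R" if "x \<in> {..<n} \<rightarrow>\<^sub>E carrier R" "i < n" for x i using that by auto
  have ex: "restrict x {..<n} = x" if "x \<in> {..<n} \<rightarrow>\<^sub>E carrier R" for x
    using that by (rule PiE_restrict)
  show ?thesis
    by (rule left_moduleI[OF assms]; unfold free_mod_simps)
      (auto simp: c a_ac m_assoc l_distr r_distr ex cong: restrict_cong)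
qed

text \<open>Concatenation of tuples; the second one starts at index m.\<close>

lemma free_mod_add_isomorphic:
  assumes R: "ring R"
  shows "isomorphic R (dsum (free_mod R m) (free_mod R n)) (free_mod R (m + n))"
proof -
  interpret ring R by fact
  have c: "x i \<in> carrier R" if "x \<in> {..<k} \<rightarrow>\<^sub>E carrier R" "i < k" for x k i using that by auto
  let ?h = "\<lambda>(x, y). \<lambda>i\<in>{..<m + n}. if i < m then x i else y (i - m)"
  note F = left_module_free[OF R]
  have "?h \<in> mod_iso R (dsum (free_mod R m) (free_mod R n)) (free_mod R (m + n))"
  proof (rule mod_isoI'[OF left_module_dsum[OF F F] F])
    show "?h \<in> mod_hom R (dsum (free_mod R m) (free_mod R n)) (free_mod R (m + n))"
      using c[of _ m] c[of _ n] by (intro mod_homI) (auto simp: free_mod_simps fun_eq_iff)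
  next
    fix v assume "v \<in> carrier (dsum (free_mod R m) (free_mod R n))" and z: "?h v = \<zero>\<^bsub>free_mod R (m + n)\<^esub>"
    then obtain x y where v: "v = (x, y)" and x: "x \<in> {..<m} \<rightarrow>\<^sub>E carrier R" and y: "y \<in> {..<n} \<rightarrow>\<^sub>E carrier R"
      by (auto simp: free_mod_simps)
    have "x i = \<zero>\<^bsub>R\<^esub>" if "i < m" for i
      using fun_cong[OF z, of i] that by (simp add: v free_mod_simps)
    then have "x = \<zero>\<^bsub>free_mod R m\<^esub>"
      by (intro free_mod_eqI[where R = R and n = m]) (simp_all add: free_mod_simps x)
    moreover have "y i = \<zero>\<^bsub>R\<^esub>" if "i < n" for i
      using fun_cong[OF z, of "m + i"] that by (simp add: v free_mod_simps)
    then have "y = \<zero>\<^bsub>free_mod R n\<^esub>"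
      by (intro free_mod_eqI[where R = R and n = n]) (simp_all add: free_mod_simps y)
    ultimately show "v = \<zero>\<^bsub>dsum (free_mod R m) (free_mod R n)\<^esub>" by (simp add: v)
  next
    fix z assume z: "z \<in> carrier (free_mod R (m + n))"
    note z' = z[unfolded free_mod_simps(1)]
    have "?h (\<lambda>i\<in>{..<m}. z i, \<lambda>i\<in>{..<n}. z (m + i)) = z"
      by (rule free_mod_eqI[OF _ z]) (auto simp: free_mod_simps c[OF z'])
    moreover have "(\<lambda>i\<in>{..<m}. z i, \<lambda>i\<in>{..<n}. z (m + i)) \<in> carrier (dsum (free_mod R m) (free_mod R n))"
      by (simp add: free_mod_simps c[OF z'])
    ultimately show "\<exists>v\<in>carrier (dsum (free_mod R m) (free_mod R n)). ?h v = z" by blast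
  qed
  then show ?thesis by (rule isomorphicI)
qed

text \<open>For k < l an isomorphism between the free modules of ranks k and l would make the free
  module of rank l - k an admissible K in \<open>weakly_finite\<close>, hence zero, although the
  tuple of ones is nonzero.\<close>

lemma free_mod_rank_unique:
  assumes R: "ring R" and wf: "weakly_finite R" and ne: "\<one>\<^bsub>R\<^esub> \<noteq> \<zero>\<^bsub>R\<^esub>"
    and iso: "isomorphic R (free_mod R m) (free_mod R n)"
  shows "m = n"
proof -
  interpret ring R by fact
  note F = left_module_free[OF R]
  have ge: "k \<ge> l" if iso: "isomorphic R (free_mod R k) (free_mod R l)" for k l
  proof (rule ccontr)
    assume "\<not> k \<ge> l"
    then have l: "l = k + (l - k)" "0 < l - k" by auto
    have "isomorphic R (dsum (free_mod R k) (free_mod R (l - k))) (free_mod R l)"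
      using free_mod_add_isomorphic[OF R, of k "l - k"] l by simp
    then have "isomorphic R (free_mod R l) (dsum (free_mod R k) (free_mod R (l - k)))"
      by (rule isomorphic_sym[OF left_module_dsum[OF F F]])
    with iso have "isomorphic R (free_mod R k) (dsum (free_mod R k) (free_mod R (l - k)))"
      by (rule isomorphic_trans)
    then have "carrier (free_mod R (l - k)) = {\<zero>\<^bsub>free_mod R (l - k)\<^esub>}"
      using wf F unfolding weakly_finite_def by blast
    moreover have "(\<lambda>i\<in>{..<l - k}. \<one>\<^bsub>R\<^esub>) \<in> carrier (free_mod R (l - k))" by (simp add: free_mod_simps)
    ultimately have "(\<lambda>i\<in>{..<l - k}. \<one>\<^bsub>R\<^esub>) = (\<lambda>i\<in>{..<l - k}. \<zero>\<^bsub>R\<^esub>)" by (auto simp: free_mod_simps)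
    from fun_cong[OF this, of 0] show False using ne l(2) by simp
  qed
  show ?thesis using ge[OF iso] ge[OF isomorphic_sym[OF F iso]] by simp
qed

lemma rank_eqI:
  assumes R: "ring R" and wf: "weakly_finite R" and ne: "\<one>\<^bsub>R\<^esub> \<noteq> \<zero>\<^bsub>R\<^esub>"
    and M: "left_module R M" and iso: "isomorphic R M (free_mod R n)"
  shows "rank R M = n"
  unfolding rank_def
proof (rule Least_equality[where P = "\<lambda>k. isomorphic R M (free_mod R k)", OF iso])
  fix k assume "isomorphic R M (free_mod R k)"
  with isomorphic_sym[OF M iso] have "isomorphic R (free_mod R n) (free_mod R k)"
    by (rule isomorphic_trans)
  then have "n = k" by (rule free_mod_rank_unique[OF R wf ne])
  then show "n \<le> k" by simp
qed

text \<open>Over the zero ring every module is zero, hence free on no generators. Ranks are not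
  unique there, and the least one, which is 0, is the even number wanted.\<close>

lemma rank_trivial_ring:
  assumes R: "ring R" and triv: "\<one>\<^bsub>R\<^esub> = \<zero>\<^bsub>R\<^esub>" and M: "left_module R M"
  shows "rank R M = 0"
proof -
  interpret left_module R M by fact
  note F = left_module_free[OF R]
  have "x = \<zero>\<^bsub>M\<^esub>" if "x \<in> carrier M" for x
    using smult_one[OF that] smult_l_null[OF that] triv by simp
  then have "(\<lambda>x. \<zero>\<^bsub>free_mod R 0\<^esub>) \<in> mod_iso R M (free_mod R 0)"
    by (intro mod_isoI' M F mod_hom_const_zero) (auto simp: free_mod_simps)
  then show ?thesis unfolding rank_def by (intro Least_eq_0 isomorphicI)
qed

section \<open>Reflexivity\<close>

text \<open>Bijectivity of the evaluation map into the double dual, as trivial kernel and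
  surjectivity. Evaluation at x is f |-> bar (f x); the bar makes it linear for the scalar action f
  |-> f bar a on the dual.\<close>

definition reflexive :: "'a involution_ring \<Rightarrow> ('a, 'b) module \<Rightarrow> bool"
  where "reflexive \<Lambda> M \<longleftrightarrow>
    (\<forall>x\<in>carrier M. (\<forall>f\<in>carrier (dual \<Lambda> M). f x = \<zero>\<^bsub>\<Lambda>\<^esub>) \<longrightarrow> x = \<zero>\<^bsub>M\<^esub>) \<and>
    (\<forall>\<psi>\<in>carrier (dual \<Lambda> (dual \<Lambda> M)).
      \<exists>x\<in>carrier M. \<forall>f\<in>carrier (dual \<Lambda> M). \<psi> f = bar\<^bsub>\<Lambda>\<^esub> (f x))"

lemma reflexive_isomorphic:
  assumes I: "involution_ring \<Lambda>" and M: "left_module \<Lambda> M" and N: "left_module \<Lambda> N"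
    and iso: "isomorphic \<Lambda> M N" and refl: "reflexive \<Lambda> M"
  shows "reflexive \<Lambda> N"
proof -
  obtain h where h: "h \<in> mod_iso \<Lambda> M N" using iso by (rule isomorphicE)
  define k where "k = inv_into (carrier M) h"
  have k: "k \<in> mod_iso \<Lambda> N M" unfolding k_def by (rule mod_iso_inv[OF M h])
  note hom = mod_iso_hom[OF h] mod_iso_hom[OF k]
  note c = hom[THEN mod_hom_closed]
  have hk: "h (k y) = y" if "y \<in> carrier N" for y
    unfolding k_def by (rule bij_betw_inv_into_right[OF mod_iso_bij[OF h] that])
  note dh = dual_map_hom[OF I M N hom(1)] and dk = dual_map_hom[OF I N M hom(2)]
  note ddk = dual_map_hom[OF I left_module_dual[OF I M] left_module_dual[OF I N] dk]
  show ?thesis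
    unfolding reflexive_def
  proof (intro conjI ballI impI)
    fix y assume y: "y \<in> carrier N" and z: "\<forall>f\<in>carrier (dual \<Lambda> N). f y = \<zero>\<^bsub>\<Lambda>\<^esub>"
    have "f (k y) = \<zero>\<^bsub>\<Lambda>\<^esub>" if "f \<in> carrier (dual \<Lambda> M)" for f
      using z mod_hom_closed[OF dk that] y by (auto simp: dual_map_apply dest: bspec)
    then have "k y = \<zero>\<^bsub>M\<^esub>" using refl c(2)[OF y] by (simp add: reflexive_def)
    then show "y = \<zero>\<^bsub>N\<^esub>" using hk[OF y] by (simp add: mod_hom_zero[OF M N hom(1)])
  next
    fix \<psi> assume \<psi>: "\<psi> \<in> carrier (dual \<Lambda> (dual \<Lambda> N))"
    \<comment> \<open>The double dual of k carries \<psi> to the double dual of M, where it is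
      evaluation at some x; back in N it is evaluation at h x.\<close>
    obtain x where x: "x \<in> carrier M"
      and e: "\<And>f. f \<in> carrier (dual \<Lambda> M) \<Longrightarrow> dual_map (dual \<Lambda> M) (dual_map N k) \<psi> f = bar\<^bsub>\<Lambda>\<^esub> (f x)"
      using refl mod_hom_closed[OF ddk \<psi>] unfolding reflexive_def by blast
    have "\<psi> f = bar\<^bsub>\<Lambda>\<^esub> (f (h x))" if f: "f \<in> carrier (dual \<Lambda> N)" for f
    proof -
      note f' = mod_hom_closed[OF dh f]
      have "dual_map N k (dual_map M h f) = f"
        by (rule dual_eqI[where M = N and \<Lambda> = \<Lambda>])
          (simp_all add: mod_hom_closed[OF dk f'] f dual_map_apply c hk)
      then show ?thesis using e[OF f'] f' x by (simp add: dual_map_apply)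
    qed
    then show "\<exists>y\<in>carrier N. \<forall>f\<in>carrier (dual \<Lambda> N). \<psi> f = bar\<^bsub>\<Lambda>\<^esub> (f y)"
      using c(1)[OF x] by blast
  qed
qed

lemma reflexive_dsum:
  assumes I: "involution_ring \<Lambda>" and M: "left_module \<Lambda> M" and N: "left_module \<Lambda> N"
    and refl: "reflexive \<Lambda> M" "reflexive \<Lambda> N"
  shows "reflexive \<Lambda> (dsum M N)"
proof -
  let ?D = "dsum M N"
  note D = left_module_dsum[OF M N] and d = left_module_dual[OF I]
  interpret L: involution_ring \<Lambda> by fact
  interpret M: left_module \<Lambda> M by fact
  interpret N: left_module \<Lambda> N by fact
  interpret dD: left_module \<Lambda> "dual \<Lambda> ?D" by (rule d[OF D])
  note f1 = dual_map_hom[OF I D M fst_hom] and f2 = dual_map_hom[OF I D N snd_hom]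
  note i1 = dual_map_hom[OF I M D inl_hom[OF N]] and i2 = dual_map_hom[OF I N D inr_hom[OF M]]
  note g1 = dual_map_hom[OF I d[OF M] d[OF D] f1] and g2 = dual_map_hom[OF I d[OF N] d[OF D] f2]
  show ?thesis
    unfolding reflexive_def
  proof (intro conjI ballI impI)
    fix v assume "v \<in> carrier ?D" and z: "\<forall>f\<in>carrier (dual \<Lambda> ?D). f v = \<zero>\<^bsub>\<Lambda>\<^esub>"
    then obtain x y where v: "v = (x, y)" and xy: "x \<in> carrier M" "y \<in> carrier N" by auto
    have "f x = \<zero>\<^bsub>\<Lambda>\<^esub>" if "f \<in> carrier (dual \<Lambda> M)" for f
      using bspec[OF z mod_hom_closed[OF f1 that]] xy by (simp add: v dual_map_apply)
    moreover have "f y = \<zero>\<^bsub>\<Lambda>\<^esub>" if "f \<in> carrier (dual \<Lambda> N)" for f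
      using bspec[OF z mod_hom_closed[OF f2 that]] xy by (simp add: v dual_map_apply)
    ultimately show "v = \<zero>\<^bsub>?D\<^esub>" using refl xy by (simp add: v reflexive_def)
  next
    fix \<psi> assume \<psi>: "\<psi> \<in> carrier (dual \<Lambda> (dual \<Lambda> ?D))"
    \<comment> \<open>Restricting \<psi> to the functionals that factor through one projection gives
      the two coordinates of the representing element.\<close>
    obtain x where x: "x \<in> carrier M" and ex:
      "\<And>f. f \<in> carrier (dual \<Lambda> M) \<Longrightarrow> dual_map (dual \<Lambda> M) (dual_map ?D fst) \<psi> f = bar\<^bsub>\<Lambda>\<^esub> (f x)"
      using refl(1) mod_hom_closed[OF g1 \<psi>] unfolding reflexive_def by blast
    obtain y where y: "y \<in> carrier N" and ey:
      "\<And>f. f \<in> carrier (dual \<Lambda> N) \<Longrightarrow> dual_map (dual \<Lambda> N) (dual_map ?D snd) \<psi> f = bar\<^bsub>\<Lambda>\<^esub> (f y)"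
      using refl(2) mod_hom_closed[OF g2 \<psi>] unfolding reflexive_def by blast
    have "\<psi> f = bar\<^bsub>\<Lambda>\<^esub> (f (x, y))" if f: "f \<in> carrier (dual \<Lambda> ?D)" for f
    proof -
      define a where "a = dual_map M (\<lambda>x. (x, \<zero>\<^bsub>N\<^esub>)) f"
      define b where "b = dual_map N (\<lambda>y. (\<zero>\<^bsub>M\<^esub>, y)) f"
      have a: "a \<in> carrier (dual \<Lambda> M)" and b: "b \<in> carrier (dual \<Lambda> N)"
        unfolding a_def b_def by (rule mod_hom_closed[OF i1 f] mod_hom_closed[OF i2 f])+
      note ca = mod_hom_closed[OF f1 a] and cb = mod_hom_closed[OF f2 b]
      have "f = dual_map ?D fst a \<oplus>\<^bsub>dual \<Lambda> ?D\<^esub> dual_map ?D snd b"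
        by (rule dual_eqI[where M = ?D and \<Lambda> = \<Lambda>])
          (auto intro!: f dD.M.a_closed ca[unfolded a_def] cb[unfolded b_def] dual_dsum_decomp[OF M N f]
            simp: dual_ops dual_map_apply a_def b_def)
      then have "\<psi> f = \<psi> (dual_map ?D fst a) \<oplus>\<^bsub>\<Lambda>\<^esub> \<psi> (dual_map ?D snd b)"
        using dual_add[OF \<psi> ca cb] by simp
      also have "\<dots> = bar\<^bsub>\<Lambda>\<^esub> (a x) \<oplus>\<^bsub>\<Lambda>\<^esub> bar\<^bsub>\<Lambda>\<^esub> (b y)"
        using ex[OF a] ey[OF b] a b by (simp add: dual_map_apply)
      also have "\<dots> = bar\<^bsub>\<Lambda>\<^esub> (a x \<oplus>\<^bsub>\<Lambda>\<^esub> b y)"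
        using L.bar_add[OF dual_closed[OF a x] dual_closed[OF b y]] by simp
      also have "a x \<oplus>\<^bsub>\<Lambda>\<^esub> b y = f (x, y)"
        using dual_dsum_decomp[OF M N f x y] x y by (simp add: a_def b_def dual_map_apply)
      finally show ?thesis .
    qed
    then show "\<exists>v\<in>carrier ?D. \<forall>f\<in>carrier (dual \<Lambda> ?D). \<psi> f = bar\<^bsub>\<Lambda>\<^esub> (f v)"
      using x y by (intro bexI[of _ "(x, y)"]) auto
  qed
qed

lemma dual_free_one:
  assumes I: "involution_ring \<Lambda>" and f: "f \<in> carrier (dual \<Lambda> (free_mod \<Lambda> (Suc 0)))"
    and x: "x \<in> carrier (free_mod \<Lambda> (Suc 0))"
  shows "f x = x 0 \<otimes>\<^bsub>\<Lambda>\<^esub> f (\<lambda>i\<in>{..<Suc 0}. \<one>\<^bsub>\<Lambda>\<^esub>)"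
proof -
  interpret L: involution_ring \<Lambda> by fact
  let ?e = "\<lambda>i\<in>{..<Suc 0}. \<one>\<^bsub>\<Lambda>\<^esub>"
  have e: "?e \<in> carrier (free_mod \<Lambda> (Suc 0))" by (simp add: free_mod_simps)
  have x0: "x 0 \<in> carrier \<Lambda>" using x by (auto simp: free_mod_simps)
  have "x = x 0 \<odot>\<^bsub>free_mod \<Lambda> (Suc 0)\<^esub> ?e"
    by (rule free_mod_eqI[OF x]) (use x0 in \<open>auto simp: free_mod_simps\<close>)
  then show ?thesis using dual_smult[OF f x0 e] by simp
qed

lemma dual_coordinate:
  assumes I: "involution_ring \<Lambda>" and b: "b \<in> carrier \<Lambda>"
  shows "(\<lambda>x\<in>carrier (free_mod \<Lambda> (Suc 0)). x 0 \<otimes>\<^bsub>\<Lambda>\<^esub> b) \<in> carrier (dual \<Lambda> (free_mod \<Lambda> (Suc 0)))"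
proof -
  interpret L: involution_ring \<Lambda> by fact
  have c: "x 0 \<in> carrier \<Lambda>" if "x \<in> {..<Suc 0} \<rightarrow>\<^sub>E carrier \<Lambda>" for x using that by auto
  show ?thesis
    by (rule dual_carrierI[OF left_module_free[OF L.ring_axioms]])
      (simp_all add: free_mod_simps c b L.l_distr L.m_assoc)
qed

lemma reflexive_free_one:
  assumes I: "involution_ring \<Lambda>"
  shows "reflexive \<Lambda> (free_mod \<Lambda> (Suc 0))"
proof -
  interpret L: involution_ring \<Lambda> by fact
  let ?F = "free_mod \<Lambda> (Suc 0)"
  let ?e = "\<lambda>i\<in>{..<Suc 0}. \<one>\<^bsub>\<Lambda>\<^esub>"
  \<comment> \<open>The coordinate functional; the factor one is kept so that it is an instance of
    \<open>dual_coordinate\<close>.\<close>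
  let ?\<pi> = "\<lambda>x\<in>carrier ?F. x 0 \<otimes>\<^bsub>\<Lambda>\<^esub> \<one>\<^bsub>\<Lambda>\<^esub>"
  interpret F: left_module \<Lambda> ?F by (rule left_module_free[OF L.ring_axioms])
  interpret dF: left_module \<Lambda> "dual \<Lambda> ?F" by (rule left_module_dual[OF I F.left_module_axioms])
  have e: "?e \<in> carrier ?F" by (simp add: free_mod_simps)
  have \<pi>: "?\<pi> \<in> carrier (dual \<Lambda> ?F)" by (rule dual_coordinate[OF I L.one_closed])
  have c: "x 0 \<in> carrier \<Lambda>" if "x \<in> carrier ?F" for x using that by (auto simp: free_mod_simps)
  show ?thesis
    unfolding reflexive_def
  proof (intro conjI ballI impI)
    fix x assume x: "x \<in> carrier ?F" and z: "\<forall>f\<in>carrier (dual \<Lambda> ?F). f x = \<zero>\<^bsub>\<Lambda>\<^esub>"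
    have "x 0 = \<zero>\<^bsub>\<Lambda>\<^esub>" using bspec[OF z \<pi>] x c[OF x] by simp
    then show "x = \<zero>\<^bsub>?F\<^esub>"
      by (intro free_mod_eqI[OF x F.M.zero_closed]) (simp add: free_mod_simps)
  next
    fix \<psi> assume \<psi>: "\<psi> \<in> carrier (dual \<Lambda> (dual \<Lambda> ?F))"
    \<comment> \<open>Every functional is f = bar (f e) \<pi>, where e is the generator, so \<psi>
      is determined by its value at \<pi>. Evaluation at a e sends \<pi> to bar a, which dictates
      this a.\<close>
    define a where "a = bar\<^bsub>\<Lambda>\<^esub> (\<psi> ?\<pi>)"
    have \<psi>\<pi>: "\<psi> ?\<pi> \<in> carrier \<Lambda>" by (rule dual_closed[OF \<psi> \<pi>])
    then have a: "a \<in> carrier \<Lambda>" by (simp add: a_def L.bar_closed)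
    have "\<psi> f = bar\<^bsub>\<Lambda>\<^esub> (f (a \<odot>\<^bsub>?F\<^esub> ?e))" if f: "f \<in> carrier (dual \<Lambda> ?F)" for f
    proof -
      have fe: "f ?e \<in> carrier \<Lambda>" by (rule dual_closed[OF f e])
      have "f = bar\<^bsub>\<Lambda>\<^esub> (f ?e) \<odot>\<^bsub>dual \<Lambda> ?F\<^esub> ?\<pi>"
        by (rule dual_eqI[where M = ?F and \<Lambda> = \<Lambda>, OF f dF.smult_closed[OF L.bar_closed[OF fe] \<pi>]])
          (simp add: dual_ops dual_free_one[OF I f] L.bar_bar fe c)
      then have "\<psi> f = bar\<^bsub>\<Lambda>\<^esub> (f ?e) \<otimes>\<^bsub>\<Lambda>\<^esub> \<psi> ?\<pi>"
        using dual_smult[OF \<psi> L.bar_closed[OF fe] \<pi>] by simp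
      also have "\<dots> = bar\<^bsub>\<Lambda>\<^esub> (a \<otimes>\<^bsub>\<Lambda>\<^esub> f ?e)"
        using \<psi>\<pi> fe a by (simp add: L.bar_mult) (simp add: a_def L.bar_bar)
      also have "a \<otimes>\<^bsub>\<Lambda>\<^esub> f ?e = f (a \<odot>\<^bsub>?F\<^esub> ?e)" by (simp add: dual_smult[OF f a e])
      finally show ?thesis .
    qed
    then show "\<exists>x\<in>carrier ?F. \<forall>f\<in>carrier (dual \<Lambda> ?F). \<psi> f = bar\<^bsub>\<Lambda>\<^esub> (f x)"
      using F.smult_closed[OF a e] by blast
  qed
qed

text \<open>A functional is determined by its value at the generator. That value is conjugated
  because a scalar a multiplies it by bar a from the right.\<close>

lemma dual_free_one_isomorphic:
  assumes I: "involution_ring \<Lambda>"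
  shows "isomorphic \<Lambda> (dual \<Lambda> (free_mod \<Lambda> (Suc 0))) (free_mod \<Lambda> (Suc 0))"
proof -
  interpret L: involution_ring \<Lambda> by fact
  let ?F = "free_mod \<Lambda> (Suc 0)"
  let ?e = "\<lambda>i\<in>{..<Suc 0}. \<one>\<^bsub>\<Lambda>\<^esub>"
  interpret F: left_module \<Lambda> ?F by (rule left_module_free[OF L.ring_axioms])
  interpret dF: left_module \<Lambda> "dual \<Lambda> ?F" by (rule left_module_dual[OF I F.left_module_axioms])
  have e: "?e \<in> carrier ?F" by (simp add: free_mod_simps)
  have c: "x 0 \<in> carrier \<Lambda>" if "x \<in> carrier ?F" for x using that by (auto simp: free_mod_simps)
  have "(\<lambda>f. \<lambda>i\<in>{..<Suc 0}. bar\<^bsub>\<Lambda>\<^esub> (f ?e)) \<in> mod_iso \<Lambda> (dual \<Lambda> ?F) ?F"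
  proof (rule mod_isoI'[OF dF.left_module_axioms F.left_module_axioms])
    show "(\<lambda>f. \<lambda>i\<in>{..<Suc 0}. bar\<^bsub>\<Lambda>\<^esub> (f ?e)) \<in> mod_hom \<Lambda> (dual \<Lambda> ?F) ?F"
      by (rule mod_homI)
        (auto simp: free_mod_simps(1,3,4) dual_ops[OF e] dual_closed[OF _ e] L.bar_closed L.bar_add
          L.bar_mult L.bar_bar fun_eq_iff)
  next
    fix f assume f: "f \<in> carrier (dual \<Lambda> ?F)" and "(\<lambda>i\<in>{..<Suc 0}. bar\<^bsub>\<Lambda>\<^esub> (f ?e)) = \<zero>\<^bsub>?F\<^esub>"
    then have "bar\<^bsub>\<Lambda>\<^esub> (f ?e) = \<zero>\<^bsub>\<Lambda>\<^esub>" by (auto simp: free_mod_simps dest: fun_cong[of _ _ 0])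
    then have "f ?e = \<zero>\<^bsub>\<Lambda>\<^esub>" by (simp add: L.bar_eq_zero_iff[OF dual_closed[OF f e]])
    then have "f x = \<zero>\<^bsub>\<Lambda>\<^esub>" if "x \<in> carrier ?F" for x
      using dual_free_one[OF I f that] c[OF that] by simp
    then show "f = \<zero>\<^bsub>dual \<Lambda> ?F\<^esub>"
      by (intro dual_eqI[where M = ?F and \<Lambda> = \<Lambda>] f dF.M.zero_closed) (simp add: dual_ops)
  next
    fix y assume y: "y \<in> carrier ?F"
    then have y0: "y 0 \<in> carrier \<Lambda>" by (rule c)
    let ?f = "\<lambda>x\<in>carrier ?F. x 0 \<otimes>\<^bsub>\<Lambda>\<^esub> bar\<^bsub>\<Lambda>\<^esub> (y 0)"
    have "?f ?e = bar\<^bsub>\<Lambda>\<^esub> (y 0)" using e y0 by (simp add: L.bar_closed)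
    then have "(\<lambda>i\<in>{..<Suc 0}. bar\<^bsub>\<Lambda>\<^esub> (?f ?e)) = y"
      by (intro free_mod_eqI[OF _ y]) (simp_all add: free_mod_simps L.bar_bar y0)
    then show "\<exists>f\<in>carrier (dual \<Lambda> ?F). (\<lambda>i\<in>{..<Suc 0}. bar\<^bsub>\<Lambda>\<^esub> (f ?e)) = y"
      using dual_coordinate[OF I L.bar_closed[OF y0]] by blast
  qed
  then show ?thesis by (rule isomorphicI)
qed

lemma free_mod_zero_eq: "x \<in> carrier (free_mod R 0) \<Longrightarrow> x = \<zero>\<^bsub>free_mod R 0\<^esub>"
  by (simp add: free_mod_simps restrict_def)

lemma reflexive_free:
  assumes I: "involution_ring \<Lambda>"
  shows "reflexive \<Lambda> (free_mod \<Lambda> n)"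
proof (induction n)
  case 0
  interpret L: involution_ring \<Lambda> by fact
  interpret F: left_module \<Lambda> "free_mod \<Lambda> 0" by (rule left_module_free[OF L.ring_axioms])
  note d = left_module_dual[OF I F.left_module_axioms]
  interpret dF: left_module \<Lambda> "dual \<Lambda> (free_mod \<Lambda> 0)" by (rule d)
  have "f = \<zero>\<^bsub>dual \<Lambda> (free_mod \<Lambda> 0)\<^esub>" if f: "f \<in> carrier (dual \<Lambda> (free_mod \<Lambda> 0))" for f
  proof (rule dual_eqI[where M = "free_mod \<Lambda> 0" and \<Lambda> = \<Lambda>, OF f dF.M.zero_closed])
    fix x assume x: "x \<in> carrier (free_mod \<Lambda> 0)"
    then show "f x = \<zero>\<^bsub>dual \<Lambda> (free_mod \<Lambda> 0)\<^esub> x"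
      using dual_at_zero[OF F.left_module_axioms f] unfolding free_mod_zero_eq[OF x]
      by (simp add: dual_ops)
  qed
  then have "\<psi> f = bar\<^bsub>\<Lambda>\<^esub> (f \<zero>\<^bsub>free_mod \<Lambda> 0\<^esub>)"
    if "\<psi> \<in> carrier (dual \<Lambda> (dual \<Lambda> (free_mod \<Lambda> 0)))" "f \<in> carrier (dual \<Lambda> (free_mod \<Lambda> 0))" for \<psi> f
    using dual_at_zero[OF d that(1)] dual_at_zero[OF F.left_module_axioms that(2)] that(2) L.bar_zero
    by metis
  then show ?case
    unfolding reflexive_def using free_mod_zero_eq F.M.zero_closed by blast
next
  case (Suc n)
  interpret L: involution_ring \<Lambda> by fact
  note F = left_module_free[OF L.ring_axioms]
  show ?case
    using reflexive_isomorphic[OF I left_module_dsum[OF F F] F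
        free_mod_add_isomorphic[OF L.ring_axioms, of n "Suc 0"]
        reflexive_dsum[OF I F F Suc.IH reflexive_free_one[OF I]]] by simp
qed

lemma dual_free_isomorphic:
  assumes I: "involution_ring \<Lambda>"
  shows "isomorphic \<Lambda> (dual \<Lambda> (free_mod \<Lambda> n)) (free_mod \<Lambda> n)"
proof (induction n)
  case 0
  interpret L: involution_ring \<Lambda> by fact
  interpret F: left_module \<Lambda> "free_mod \<Lambda> 0" by (rule left_module_free[OF L.ring_axioms])
  note d = left_module_dual[OF I F.left_module_axioms]
  interpret dF: left_module \<Lambda> "dual \<Lambda> (free_mod \<Lambda> 0)" by (rule d)
  have "(\<lambda>f. \<zero>\<^bsub>free_mod \<Lambda> 0\<^esub>) \<in> mod_iso \<Lambda> (dual \<Lambda> (free_mod \<Lambda> 0)) (free_mod \<Lambda> 0)"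
  proof (rule mod_isoI'[OF d F.left_module_axioms mod_hom_const_zero[OF d F.left_module_axioms]])
    fix f assume f: "f \<in> carrier (dual \<Lambda> (free_mod \<Lambda> 0))"
    show "f = \<zero>\<^bsub>dual \<Lambda> (free_mod \<Lambda> 0)\<^esub>"
    proof (rule dual_eqI[where M = "free_mod \<Lambda> 0" and \<Lambda> = \<Lambda>, OF f dF.M.zero_closed])
      fix x assume x: "x \<in> carrier (free_mod \<Lambda> 0)"
      then show "f x = \<zero>\<^bsub>dual \<Lambda> (free_mod \<Lambda> 0)\<^esub> x"
        using dual_at_zero[OF F.left_module_axioms f] unfolding free_mod_zero_eq[OF x]
        by (simp add: dual_ops)
    qed
  next
    fix y assume "y \<in> carrier (free_mod \<Lambda> 0)"
    then show "\<exists>f\<in>carrier (dual \<Lambda> (free_mod \<Lambda> 0)). \<zero>\<^bsub>free_mod \<Lambda> 0\<^esub> = y"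
      using free_mod_zero_eq dF.M.zero_closed by metis
  qed
  then show ?case by (rule isomorphicI)
next
  case (Suc n)
  interpret L: involution_ring \<Lambda> by fact
  note F = left_module_free[OF L.ring_axioms]
  let ?D = "dsum (free_mod \<Lambda> n) (free_mod \<Lambda> (Suc 0))"
  have iso: "isomorphic \<Lambda> ?D (free_mod \<Lambda> (Suc n))"
    using free_mod_add_isomorphic[OF L.ring_axioms, of n "Suc 0"] by simp
  have "isomorphic \<Lambda> (dual \<Lambda> (free_mod \<Lambda> (Suc n))) (dual \<Lambda> ?D)"
    by (rule isomorphic_dual[OF I F left_module_dsum[OF F F] iso])
  also have "isomorphic \<Lambda> \<dots> (dsum (dual \<Lambda> (free_mod \<Lambda> n)) (dual \<Lambda> (free_mod \<Lambda> (Suc 0))))"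
    by (rule dual_dsum_isomorphic[OF I F F])
  also (isomorphic_trans) have "isomorphic \<Lambda> \<dots> ?D"
    by (rule isomorphic_dsum[OF Suc.IH dual_free_one_isomorphic[OF I]])
  also (isomorphic_trans) note iso
  finally (isomorphic_trans) show ?case .
qed

section \<open>Elementary preformations\<close>

context involution_ring
begin

lemma sign_facts:
  assumes "e \<in> {\<one>, \<ominus> \<one>}"
  shows "e \<in> carrier \<Lambda>" and "e \<otimes> e = \<one>" and "bar e = e"
    and "a \<in> carrier \<Lambda> \<Longrightarrow> a \<otimes> e = e \<otimes> a"
    and "a \<in> carrier \<Lambda> \<Longrightarrow> e \<otimes> (e \<otimes> a) = a"
proof -
  show e: "e \<in> carrier \<Lambda>" and ee: "e \<otimes> e = \<one>" using assms by (auto simp: l_minus r_minus)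
  show "bar e = e" using assms by (auto simp: bar_uminus bar_one)
  show "a \<otimes> e = e \<otimes> a" if "a \<in> carrier \<Lambda>" using assms that by (auto simp: l_minus r_minus)
  show "e \<otimes> (e \<otimes> a) = a" if "a \<in> carrier \<Lambda>" using m_assoc[OF e e that] that ee by simp
qed

end

text \<open>Subtraction in the dual comes from the abstract group inverse, while only zero, sum and
  scalar multiple are given pointwise; cancellation bridges the gap.\<close>

lemma dual_minus_apply:
  assumes I: "involution_ring \<Lambda>" and M: "left_module \<Lambda> M"
    and f: "f \<in> carrier (dual \<Lambda> M)" and g: "g \<in> carrier (dual \<Lambda> M)" and x: "x \<in> carrier M"
  shows "(f \<ominus>\<^bsub>dual \<Lambda> M\<^esub> g) x = f x \<ominus>\<^bsub>\<Lambda>\<^esub> g x"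
proof -
  interpret L: involution_ring \<Lambda> by fact
  interpret D: left_module \<Lambda> "dual \<Lambda> M" by (rule left_module_dual[OF I M])
  let ?d = "f \<ominus>\<^bsub>dual \<Lambda> M\<^esub> g"
  have d: "?d \<in> carrier (dual \<Lambda> M)" using f g by simp
  have "?d x \<oplus>\<^bsub>\<Lambda>\<^esub> g x = f x"
    using fun_cong[OF D.diff_add_cancel[OF f g], of x] by (simp add: dual_ops x)
  then have "f x \<ominus>\<^bsub>\<Lambda>\<^esub> g x = (?d x \<oplus>\<^bsub>\<Lambda>\<^esub> g x) \<ominus>\<^bsub>\<Lambda>\<^esub> g x" by simp
  also have "\<dots> = ?d x"
    using dual_closed[OF d x] dual_closed[OF g x] by (simp add: L.minus_eq L.a_assoc L.r_neg)
  finally show ?thesis by simp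
qed

text \<open>
  The maps \<open>\<tau>\<close> and \<open>\<sigma>\<close> stand for complements of the images of \<open>U\<close> under \<open>\<gamma>\<close> and \<open>\<mu>\<close>.
\<close>

locale lagrangian = involution_ring \<Lambda>
  for \<Lambda> :: "'a involution_ring" (structure) and F :: "('a, 'f) module" and G :: "('a, 'g) module"
    and \<gamma> :: "'g \<Rightarrow> 'f" and \<mu> :: "'g \<Rightarrow> 'f \<Rightarrow> 'a" and e :: 'a and U :: "'g set"
    and \<tau> :: "'f \<Rightarrow> 'g" and \<sigma> :: "('f \<Rightarrow> 'a) \<Rightarrow> 'g" +
  assumes F: "left_module \<Lambda> F" and refl: "reflexive \<Lambda> F" and G: "left_module \<Lambda> G"
    and \<gamma>: "\<gamma> \<in> mod_hom \<Lambda> G F" and \<mu>: "\<mu> \<in> mod_hom \<Lambda> G (dual \<Lambda> F)"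
    and e: "e \<in> {\<one>, \<ominus> \<one>}"
    and sym: "\<lbrakk>x \<in> carrier G; y \<in> carrier G\<rbrakk> \<Longrightarrow> \<mu> x (\<gamma> y) = e \<otimes> bar (\<mu> y (\<gamma> x))"
    and U: "submodule U \<Lambda> G"
    and isotropic: "\<lbrakk>x \<in> U; y \<in> U\<rbrakk> \<Longrightarrow> \<mu> x (\<gamma> y) = \<zero>"
    and annihilator: "\<lbrakk>\<phi> \<in> carrier (dual \<Lambda> F); \<And>u. u \<in> U \<Longrightarrow> \<phi> (\<gamma> u) = \<zero>\<rbrakk> \<Longrightarrow> \<phi> \<in> \<mu> ` U"
    and \<tau>: "\<tau> \<in> mod_hom \<Lambda> F (restr_mod G U)" and \<tau>\<gamma>: "u \<in> U \<Longrightarrow> \<tau> (\<gamma> u) = u"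
    and \<sigma>: "\<sigma> \<in> mod_hom \<Lambda> (dual \<Lambda> F) (restr_mod G U)" and \<sigma>\<mu>: "u \<in> U \<Longrightarrow> \<sigma> (\<mu> u) = u"
begin

lemmas dF = left_module_dual[OF involution_ring_axioms F]
  and dG = left_module_dual[OF involution_ring_axioms G]

interpretation F: left_module \<Lambda> F by (rule F)
interpretation G: left_module \<Lambda> G by (rule G)
interpretation dF: left_module \<Lambda> "dual \<Lambda> F" by (rule dF)
interpretation dG: left_module \<Lambda> "dual \<Lambda> G" by (rule dG)

abbreviation "H \<equiv> restr_mod G U"

lemmas H = left_module_restr[OF G U]
lemmas W = left_module_dual[OF involution_ring_axioms H]

lemma UG: "u \<in> U \<Longrightarrow> u \<in> carrier G"
  using submodule_subset[OF U] by auto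

lemma \<tau>U: "f \<in> carrier F \<Longrightarrow> \<tau> f \<in> U" and \<sigma>U: "\<phi> \<in> carrier (dual \<Lambda> F) \<Longrightarrow> \<sigma> \<phi> \<in> U"
  using mod_hom_closed[OF \<tau>] mod_hom_closed[OF \<sigma>] by simp_all

lemma \<tau>_hom: "\<tau> \<in> mod_hom \<Lambda> F G" and \<sigma>_hom: "\<sigma> \<in> mod_hom \<Lambda> (dual \<Lambda> F) G"
  using \<tau> \<sigma> UG by (auto simp: mod_hom_def)

lemma \<gamma>_hom_H: "\<gamma> \<in> mod_hom \<Lambda> H F"
  using \<gamma> UG by (auto simp: mod_hom_def)

lemmas \<gamma>c = mod_hom_closed[OF \<gamma>] and \<mu>c = mod_hom_closed[OF \<mu>]
  and \<tau>c = mod_hom_closed[OF \<tau>_hom] and \<sigma>c = mod_hom_closed[OF \<sigma>_hom]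

lemma \<mu>\<gamma>c: "\<lbrakk>x \<in> carrier G; f \<in> carrier F\<rbrakk> \<Longrightarrow> \<mu> x f \<in> carrier \<Lambda>"
  by (rule dual_closed[OF \<mu>c])

text \<open>\<open>annihilator\<close> puts the difference of the two functionals into \<mu>
  U.\<close>

lemma dual_F_eq_modulo:
  assumes "\<phi> \<in> carrier (dual \<Lambda> F)" "\<psi> \<in> carrier (dual \<Lambda> F)"
    and "\<And>u. u \<in> U \<Longrightarrow> \<phi> (\<gamma> u) = \<psi> (\<gamma> u)"
  obtains u where "u \<in> U" "\<phi> = \<psi> \<oplus>\<^bsub>dual \<Lambda> F\<^esub> \<mu> u"
proof -
  have "\<phi> \<ominus>\<^bsub>dual \<Lambda> F\<^esub> \<psi> \<in> \<mu> ` U"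
  proof (rule annihilator)
    show "\<phi> \<ominus>\<^bsub>dual \<Lambda> F\<^esub> \<psi> \<in> carrier (dual \<Lambda> F)" using assms by simp
    fix u assume u: "u \<in> U"
    show "(\<phi> \<ominus>\<^bsub>dual \<Lambda> F\<^esub> \<psi>) (\<gamma> u) = \<zero>"
      unfolding dual_minus_apply[OF involution_ring_axioms F assms(1,2) \<gamma>c[OF UG[OF u]]] assms(3)[OF u]
      using dual_closed[OF assms(2) \<gamma>c[OF UG[OF u]]] by (simp add: minus_eq r_neg)
  qed
  then obtain u where u: "u \<in> U" "\<phi> \<ominus>\<^bsub>dual \<Lambda> F\<^esub> \<psi> = \<mu> u" by auto
  then have "\<phi> = \<psi> \<oplus>\<^bsub>dual \<Lambda> F\<^esub> \<mu> u" using dF.add_diff_cancel[OF assms(1,2)] by simp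
  with u(1) show ?thesis by (rule that)
qed

text \<open>The counterpart of \<open>dual_F_eq_modulo\<close> in F: what \<mu> U annihilates lies
  in \<gamma> U. Reflexivity of F reduces this to testing d = f - f' against all
  functionals.\<close>

lemma F_eq_modulo:
  assumes f: "f \<in> carrier F" and f': "f' \<in> carrier F" and eq: "\<And>u. u \<in> U \<Longrightarrow> \<mu> u f = \<mu> u f'"
  shows "f = f' \<oplus>\<^bsub>F\<^esub> \<gamma> (\<tau> (f \<ominus>\<^bsub>F\<^esub> f'))"
proof -
  define d where "d = f \<ominus>\<^bsub>F\<^esub> f'"
  have d: "d \<in> carrier F" using f f' by (simp add: d_def)
  note \<gamma>\<tau> = mod_hom_comp[OF \<tau>_hom \<gamma>]
  have \<mu>d: "\<mu> u d = \<zero>" if u: "u \<in> U" for u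
  proof -
    note uc = \<mu>c[OF UG[OF u]]
    have "\<mu> u (d \<oplus>\<^bsub>F\<^esub> f') = \<mu> u f'"
      using eq[OF u] F.diff_add_cancel[OF f f'] by (simp add: d_def)
    then show ?thesis
      using dual_closed[OF uc d] dual_closed[OF uc f'] by (simp add: dual_add[OF uc d f'])
  qed
  \<comment> \<open>\<phi> and its pullback along \<open>\<gamma> \<circ> \<tau>\<close> agree on
    \<gamma> U, so they differ by some \<mu> u, which vanishes at d. Hence \<phi> has the same value
    at d and at \<gamma> (\<tau> d).\<close>
  have "\<phi> (d \<ominus>\<^bsub>F\<^esub> \<gamma> (\<tau> d)) = \<zero>" if \<phi>: "\<phi> \<in> carrier (dual \<Lambda> F)" for \<phi>
  proof -
    have c: "dual_map F (\<gamma> \<circ> \<tau>) \<phi> \<in> carrier (dual \<Lambda> F)"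
      by (rule dual_map_closed[OF F \<gamma>\<tau> \<phi>])
    obtain u where u: "u \<in> U" "\<phi> = dual_map F (\<gamma> \<circ> \<tau>) \<phi> \<oplus>\<^bsub>dual \<Lambda> F\<^esub> \<mu> u"
      by (rule dual_F_eq_modulo[OF \<phi> c]) (auto simp: dual_map_apply \<gamma>c UG \<tau>\<gamma>)
    have "\<phi> d = \<phi> (\<gamma> (\<tau> d))"
      using fun_cong[OF u(2), of d] d \<mu>d[OF u(1)] dual_closed[OF \<phi> \<gamma>c[OF \<tau>c[OF d]]]
      by (simp add: dual_ops dual_map_apply)
    moreover have "\<phi> (d \<ominus>\<^bsub>F\<^esub> \<gamma> (\<tau> d)) \<oplus> \<phi> (\<gamma> (\<tau> d)) = \<phi> d"
      using F.diff_add_cancel[OF d \<gamma>c[OF \<tau>c[OF d]]] d \<gamma>c[OF \<tau>c[OF d]]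
      by (simp flip: dual_add[OF \<phi>])
    ultimately show ?thesis
      using dual_closed[OF \<phi> d] dual_closed[OF \<phi>, of "d \<ominus>\<^bsub>F\<^esub> \<gamma> (\<tau> d)"] d \<gamma>c[OF \<tau>c[OF d]] by simp
  qed
  then have "d \<ominus>\<^bsub>F\<^esub> \<gamma> (\<tau> d) = \<zero>\<^bsub>F\<^esub>"
    using refl d \<gamma>c[OF \<tau>c[OF d]] unfolding reflexive_def by blast
  then have "d = \<gamma> (\<tau> d)" using d \<gamma>c[OF \<tau>c[OF d]] by (simp add: F.minus_eq_zero_iff)
  then show ?thesis using F.add_diff_cancel[OF f f'] by (simp add: d_def)
qed

lemma \<mu>\<sigma>: "\<phi> \<in> \<mu> ` U \<Longrightarrow> \<mu> (\<sigma> \<phi>) = \<phi>"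
  by (auto simp: \<sigma>\<mu>)

lemma ker_\<gamma>_\<mu>: "isomorphic \<Lambda> (ker_mod G F \<gamma>) (ker_mod G (dual \<Lambda> F) \<mu>)"
proof (rule ker_isomorphic[OF G F G dF \<gamma> \<mu>])
  note \<sigma>\<mu>_hom = mod_hom_comp[OF \<mu> \<sigma>_hom]
  show "(\<lambda>x. x \<ominus>\<^bsub>G\<^esub> \<sigma> (\<mu> x)) \<in> mod_hom \<Lambda> G G"
    by (rule mod_homI)
      (simp_all add: \<sigma>c \<mu>c mod_hom_add[OF \<mu>] mod_hom_add[OF \<sigma>_hom] mod_hom_smult[OF \<mu>]
        mod_hom_smult[OF \<sigma>_hom] G.add_minus_add G.smult_minus)
  \<comment> \<open>By symmetry, \<gamma> x = 0 makes \<mu> x vanish on \<gamma> U, so \<mu> x lies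
    in \<mu> U. There \<sigma> is a section of \<mu>, and subtracting \<sigma> (\<mu> x) from x
    kills \<mu> x.\<close>
  have \<mu>U: "\<mu> x \<in> \<mu> ` U" if "x \<in> carrier G" "\<gamma> x = \<zero>\<^bsub>F\<^esub>" for x
    using that by (intro annihilator \<mu>c)
      (simp_all add: sym UG dual_at_zero[OF F \<mu>c] bar_zero sign_facts[OF e])
  show "\<mu> (x \<ominus>\<^bsub>G\<^esub> \<sigma> (\<mu> x)) = \<zero>\<^bsub>dual \<Lambda> F\<^esub>" if "x \<in> carrier G" "\<gamma> x = \<zero>\<^bsub>F\<^esub>" for x
    using that \<mu>\<sigma>[OF \<mu>U[OF that]]
    by (simp add: mod_hom_minus[OF G dF \<mu>] \<sigma>c \<mu>c dF.minus_eq_zero_iff)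
  \<comment> \<open>Such an x equals \<sigma> (\<mu> x), so it lies in U, where \<gamma> is
    injective.\<close>
  show "x = \<zero>\<^bsub>G\<^esub>" if "x \<in> carrier G" "\<gamma> x = \<zero>\<^bsub>F\<^esub>" "x \<ominus>\<^bsub>G\<^esub> \<sigma> (\<mu> x) = \<zero>\<^bsub>G\<^esub>" for x
  proof -
    have "x = \<sigma> (\<mu> x)" using that by (simp add: G.minus_eq_zero_iff \<sigma>c \<mu>c)
    then have "x \<in> U" using \<sigma>U[OF \<mu>c[OF that(1)]] by simp
    then show ?thesis using \<tau>\<gamma>[of x] that(2) by (simp add: mod_hom_zero[OF F G \<tau>_hom])
  qed
  fix y assume y: "y \<in> carrier G" "\<mu> y = \<zero>\<^bsub>dual \<Lambda> F\<^esub>"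
  have z: "\<mu> u (\<gamma> y) = \<zero>" if "u \<in> U" for u
    using y that by (simp add: sym[of u y] UG dual_ops \<gamma>c bar_zero sign_facts[OF e])
  \<comment> \<open>The preimage of y is y - t, where t in U satisfies \<gamma> t = \<gamma> y. It
    lies in ker \<gamma>, and \<sigma> (\<mu> (y - t)) = -t because \<mu> y = 0, so the correction
    restores y.\<close>
  let ?t = "\<tau> (\<gamma> y)"
  have t: "?t \<in> U" "?t \<in> carrier G" using y by (simp_all add: \<tau>U \<gamma>c \<tau>c)
  have g: "\<gamma> y = \<gamma> ?t"
    using F_eq_modulo[of "\<gamma> y" "\<zero>\<^bsub>F\<^esub>"] z y
    by (simp add: \<gamma>c dual_at_zero[OF F \<mu>c[OF UG]] \<tau>c F.minus_zero)
  have m: "\<mu> (y \<ominus>\<^bsub>G\<^esub> ?t) = \<ominus>\<^bsub>dual \<Lambda> F\<^esub> \<mu> ?t"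
    using y t by (simp add: mod_hom_minus[OF G dF \<mu>] \<mu>c dF.M.minus_eq)
  have "\<sigma> (\<mu> (y \<ominus>\<^bsub>G\<^esub> ?t)) = \<ominus>\<^bsub>G\<^esub> ?t"
    using t by (simp add: m mod_hom_uminus[OF dF G \<sigma>_hom] \<mu>c \<sigma>\<mu>)
  then have "(y \<ominus>\<^bsub>G\<^esub> ?t) \<ominus>\<^bsub>G\<^esub> \<sigma> (\<mu> (y \<ominus>\<^bsub>G\<^esub> ?t)) = y"
    using G.diff_add_cancel[OF y(1) t(2)] t y by (simp add: G.M.minus_eq)
  moreover have "\<gamma> (y \<ominus>\<^bsub>G\<^esub> ?t) = \<zero>\<^bsub>F\<^esub>"
    using y t g by (simp add: mod_hom_minus[OF G F \<gamma>] F.minus_eq_zero_iff \<gamma>c)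
  ultimately show "\<exists>x\<in>carrier G. \<gamma> x = \<zero>\<^bsub>F\<^esub> \<and> x \<ominus>\<^bsub>G\<^esub> \<sigma> (\<mu> x) = y"
    using y t by (intro bexI[of _ "y \<ominus>\<^bsub>G\<^esub> ?t"]) simp_all
qed

text \<open>This is evaluation at f followed by the dual of \<mu> restricted to U; hence the bar, as
  in \<open>reflexive\<close>.\<close>

definition A :: "'f \<Rightarrow> 'g \<Rightarrow> 'a" where "A f = (\<lambda>u\<in>U. bar (\<mu> u f))"

definition B :: "('f \<Rightarrow> 'a) \<Rightarrow> 'g \<Rightarrow> 'a" where "B = dual_map H \<gamma>"

lemma A_hom: "A \<in> mod_hom \<Lambda> F (dual \<Lambda> H)"
proof -
  interpret W: left_module \<Lambda> "dual \<Lambda> H" by (rule W)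
  have Ac: "A f \<in> carrier (dual \<Lambda> H)" if f: "f \<in> carrier F" for f
  proof -
    have "(\<lambda>u\<in>carrier H. bar (\<mu> u f)) \<in> carrier (dual \<Lambda> H)"
      by (rule dual_carrierI[OF H])
        (simp_all add: f UG \<mu>\<gamma>c bar_closed mod_hom_add[OF \<mu>] mod_hom_smult[OF \<mu>] dual_ops bar_add
          bar_mult bar_bar)
    then show ?thesis by (simp add: A_def)
  qed
  show ?thesis
  proof (rule mod_homI)
    show "A f \<in> carrier (dual \<Lambda> H)" if "f \<in> carrier F" for f using that by (rule Ac)
    show "A (f \<oplus>\<^bsub>F\<^esub> f') = A f \<oplus>\<^bsub>dual \<Lambda> H\<^esub> A f'" if f: "f \<in> carrier F" "f' \<in> carrier F" for f f'
      by (rule dual_eqI[where M = H and \<Lambda> = \<Lambda>])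
        (simp_all add: Ac f dual_ops, simp add: A_def f UG dual_add[OF \<mu>c] \<mu>\<gamma>c bar_add)
    show "A (a \<odot>\<^bsub>F\<^esub> f) = a \<odot>\<^bsub>dual \<Lambda> H\<^esub> A f" if f: "a \<in> carrier \<Lambda>" "f \<in> carrier F" for a f
      by (rule dual_eqI[where M = H and \<Lambda> = \<Lambda>])
        (simp_all add: Ac f dual_ops F.smult_closed W.smult_closed,
          simp add: A_def f UG dual_smult[OF \<mu>c] \<mu>\<gamma>c bar_mult)
  qed
qed

lemma B_hom: "B \<in> mod_hom \<Lambda> (dual \<Lambda> F) (dual \<Lambda> H)"
  unfolding B_def by (rule dual_map_hom[OF involution_ring_axioms H F \<gamma>_hom_H])

lemma A_apply: "u \<in> U \<Longrightarrow> A f u = bar (\<mu> u f)"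
  by (simp add: A_def)

lemma B_apply: "u \<in> U \<Longrightarrow> B \<phi> u = \<phi> (\<gamma> u)"
  by (simp add: B_def dual_map_apply)

text \<open>\<open>\<chi> \<circ> \<sigma>\<close> is a functional on the dual of F. By reflexivity
  it is evaluation at some f, and its value at \<mu> u is \<chi> u.\<close>

lemma A_surj:
  assumes \<chi>: "\<chi> \<in> carrier (dual \<Lambda> H)"
  obtains f where "f \<in> carrier F" "A f = \<chi>"
proof -
  have "dual_map (dual \<Lambda> F) \<sigma> \<chi> \<in> carrier (dual \<Lambda> (dual \<Lambda> F))"
    by (rule dual_map_closed[OF dF \<sigma> \<chi>])
  then obtain f where f: "f \<in> carrier F"
    and e: "\<And>\<phi>. \<phi> \<in> carrier (dual \<Lambda> F) \<Longrightarrow> dual_map (dual \<Lambda> F) \<sigma> \<chi> \<phi> = bar (\<phi> f)"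
    using refl unfolding reflexive_def by blast
  have "A f = \<chi>"
  proof (rule dual_eqI[where M = H and \<Lambda> = \<Lambda>, OF mod_hom_closed[OF A_hom f] \<chi>])
    fix u assume "u \<in> carrier H"
    then have u: "u \<in> U" by simp
    show "A f u = \<chi> u"
      using e[OF \<mu>c[OF UG[OF u]]] \<mu>c[OF UG[OF u]] u by (simp add: A_apply dual_map_apply \<sigma>\<mu>)
  qed
  with f show ?thesis by (rule that)
qed

lemma B_surj:
  assumes \<chi>: "\<chi> \<in> carrier (dual \<Lambda> H)"
  obtains \<phi> where "\<phi> \<in> carrier (dual \<Lambda> F)" "B \<phi> = \<chi>"
proof
  show c: "dual_map F \<tau> \<chi> \<in> carrier (dual \<Lambda> F)" by (rule dual_map_closed[OF F \<tau> \<chi>])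
  show "B (dual_map F \<tau> \<chi>) = \<chi>"
    by (rule dual_eqI[where M = H and \<Lambda> = \<Lambda>, OF mod_hom_closed[OF B_hom c] \<chi>])
      (simp add: B_apply dual_map_apply \<gamma>c UG \<tau>\<gamma>)
qed

text \<open>The symmetry of \<open>\<gamma>\<^sup>*\<mu>\<close>, read on U. The sign is moved
  inside as a scalar on x, so that the images of \<open>A \<circ> \<gamma>\<close> and
  \<open>B \<circ> \<mu>\<close> can be compared directly.\<close>

lemma A\<gamma>:
  assumes x: "x \<in> carrier G"
  shows "A (\<gamma> x) = B (\<mu> (e \<odot>\<^bsub>G\<^esub> x))"
proof (rule dual_eqI[where M = H and \<Lambda> = \<Lambda>])
  note ec = sign_facts(1)[OF e]
  show "A (\<gamma> x) \<in> carrier (dual \<Lambda> H)" by (rule mod_hom_closed[OF A_hom \<gamma>c[OF x]])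
  show "B (\<mu> (e \<odot>\<^bsub>G\<^esub> x)) \<in> carrier (dual \<Lambda> H)"
    by (rule mod_hom_closed[OF B_hom \<mu>c[OF G.smult_closed[OF ec x]]])
  fix u assume "u \<in> carrier H"
  then have u: "u \<in> U" by simp
  note \<mu>u = \<mu>\<gamma>c[OF UG[OF u] \<gamma>c[OF x]]
  have "B (\<mu> (e \<odot>\<^bsub>G\<^esub> x)) u = \<mu> x (\<gamma> u) \<otimes> e"
    using u by (simp add: B_apply mod_hom_smult[OF \<mu> ec x] dual_ops \<gamma>c UG sign_facts(3)[OF e])
  also have "\<dots> = bar (\<mu> u (\<gamma> x))"
    unfolding sym[OF x UG[OF u]] sign_facts(4)[OF e m_closed[OF ec bar_closed[OF \<mu>u]]]
    by (rule sign_facts(5)[OF e bar_closed[OF \<mu>u]])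
  finally show "A (\<gamma> x) u = B (\<mu> (e \<odot>\<^bsub>G\<^esub> x)) u" using u by (simp add: A_apply)
qed

lemma coker_\<gamma>_\<mu>: "isomorphic \<Lambda> (coker_mod G F \<gamma>) (coker_mod G (dual \<Lambda> F) \<mu>)"
proof -
  interpret W: left_module \<Lambda> "dual \<Lambda> H" by (rule W)
  note B\<mu> = mod_hom_comp[OF \<mu> B_hom]
  note eG = G.smult_closed[OF sign_facts(1)[OF e]]
  have eeG: "e \<odot>\<^bsub>G\<^esub> (e \<odot>\<^bsub>G\<^esub> x) = x" if "x \<in> carrier G" for x
    using G.smult_assoc[OF sign_facts(1)[OF e] sign_facts(1)[OF e] that] that
    by (simp add: sign_facts[OF e] G.smult_one)
  \<comment> \<open>A and B are onto, so the term from the image can be taken to be zero; it is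
    spelled out to fit the shape of \<open>coker_isomorphic\<close>.\<close>
  have right: "y' = y' \<oplus>\<^bsub>dual \<Lambda> H\<^esub> (B \<circ> \<mu>) \<zero>\<^bsub>G\<^esub>" if "y' \<in> carrier (dual \<Lambda> H)" for y'
    using that by (simp only: mod_hom_zero[OF G W B\<mu>] W.M.r_zero)
  have 1: "isomorphic \<Lambda> (coker_mod G F \<gamma>) (coker_mod G (dual \<Lambda> H) (B \<circ> \<mu>))"
  proof (rule coker_isomorphic[OF G F G W \<gamma> B\<mu> A_hom])
    show "A (\<gamma> x) \<in> (B \<circ> \<mu>) ` carrier G" if "x \<in> carrier G" for x
      using A\<gamma>[OF that] eG[OF that] by auto
    show "f \<in> \<gamma> ` carrier G" if f: "f \<in> carrier F" and x: "x \<in> carrier G" and eq: "A f = (B \<circ> \<mu>) x" for f x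
    proof -
      \<comment> \<open>Since e squares to one, e x undoes the sign in \<open>A\<gamma>\<close>.
        Then f and \<gamma> (e x) have the same image under A and differ by an element of \<gamma>
        U.\<close>
      let ?x = "e \<odot>\<^bsub>G\<^esub> x"
      have "A f = A (\<gamma> ?x)" using A\<gamma>[OF eG[OF x]] eeG[OF x] eq by simp
      then have "bar (\<mu> u f) = bar (\<mu> u (\<gamma> ?x))" if "u \<in> U" for u
        using A_apply[OF that, of f] A_apply[OF that, of "\<gamma> ?x"] by simp
      then have "\<mu> u f = \<mu> u (\<gamma> ?x)" if u: "u \<in> U" for u
        using u bar_bar[OF \<mu>\<gamma>c[OF UG[OF u] f]] bar_bar[OF \<mu>\<gamma>c[OF UG[OF u] \<gamma>c[OF eG[OF x]]]]
        by metis
      then have "f = \<gamma> ?x \<oplus>\<^bsub>F\<^esub> \<gamma> (\<tau> (f \<ominus>\<^bsub>F\<^esub> \<gamma> ?x))"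
        by (rule F_eq_modulo[OF f \<gamma>c[OF eG[OF x]]])
      also have "\<dots> = \<gamma> (?x \<oplus>\<^bsub>G\<^esub> \<tau> (f \<ominus>\<^bsub>F\<^esub> \<gamma> ?x))"
        using f x by (simp add: mod_hom_add[OF \<gamma>] eG \<gamma>c \<tau>c)
      also have "\<dots> \<in> \<gamma> ` carrier G" using f x by (intro imageI) (simp add: eG \<gamma>c \<tau>c)
      finally show ?thesis .
    qed
    show "\<exists>f\<in>carrier F. \<exists>x\<in>carrier G. y' = A f \<oplus>\<^bsub>dual \<Lambda> H\<^esub> (B \<circ> \<mu>) x"
      if y': "y' \<in> carrier (dual \<Lambda> H)" for y'
    proof -
      obtain f where f: "f \<in> carrier F" "A f = y'" by (rule A_surj[OF y'])
      have "y' = A f \<oplus>\<^bsub>dual \<Lambda> H\<^esub> (B \<circ> \<mu>) \<zero>\<^bsub>G\<^esub>" unfolding f(2) by (rule right[OF y'])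
      then show ?thesis using f(1) G.M.zero_closed by blast
    qed
  qed
  have 2: "isomorphic \<Lambda> (coker_mod G (dual \<Lambda> F) \<mu>) (coker_mod G (dual \<Lambda> H) (B \<circ> \<mu>))"
  proof (rule coker_isomorphic[OF G dF G W \<mu> B\<mu> B_hom])
    show "\<phi> \<in> \<mu> ` carrier G"
      if \<phi>: "\<phi> \<in> carrier (dual \<Lambda> F)" and x: "x \<in> carrier G" and eq: "B \<phi> = (B \<circ> \<mu>) x" for \<phi> x
    proof -
      have "\<phi> (\<gamma> u) = \<mu> x (\<gamma> u)" if "u \<in> U" for u
        using fun_cong[OF eq, of u] that by (simp add: B_apply)
      then obtain u where "u \<in> U" "\<phi> = \<mu> x \<oplus>\<^bsub>dual \<Lambda> F\<^esub> \<mu> u"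
        by (rule dual_F_eq_modulo[OF \<phi> \<mu>c[OF x]])
      then show ?thesis using x by (auto simp: UG simp flip: mod_hom_add[OF \<mu>])
    qed
    show "\<exists>\<phi>\<in>carrier (dual \<Lambda> F). \<exists>x\<in>carrier G. y' = B \<phi> \<oplus>\<^bsub>dual \<Lambda> H\<^esub> (B \<circ> \<mu>) x"
      if y': "y' \<in> carrier (dual \<Lambda> H)" for y'
    proof -
      obtain \<phi> where \<phi>: "\<phi> \<in> carrier (dual \<Lambda> F)" "B \<phi> = y'" by (rule B_surj[OF y'])
      have "y' = B \<phi> \<oplus>\<^bsub>dual \<Lambda> H\<^esub> (B \<circ> \<mu>) \<zero>\<^bsub>G\<^esub>" unfolding \<phi>(2) by (rule right[OF y'])
      then show ?thesis using \<phi>(1) G.M.zero_closed by blast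
    qed
  qed auto
  show ?thesis
    by (rule isomorphic_trans[OF 1 isomorphic_sym[OF left_module_coker[OF G dF \<mu>] 2]])
qed

section \<open>Kernel and cokernel of the composite, and the decomposition of F\<close>

lemmas \<gamma>' = dual_map_hom[OF involution_ring_axioms G F \<gamma>]
lemmas \<gamma>'c = mod_hom_closed[OF \<gamma>']
lemmas \<mu>_\<gamma>' = map_prod_hom[OF \<mu> \<gamma>']
lemmas \<gamma>'\<mu> = mod_hom_comp[OF \<mu> \<gamma>']

lemma ker_\<gamma>'\<mu>: "isomorphic \<Lambda> (ker_mod G (dual \<Lambda> G) (dual_map G \<gamma> \<circ> \<mu>))
  (dsum (ker_mod G F \<gamma>) (ker_mod (dual \<Lambda> F) (dual \<Lambda> G) (dual_map G \<gamma>)))"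
proof -
  let ?D = "dsum G (dual \<Lambda> F)" and ?D' = "dsum (dual \<Lambda> F) (dual \<Lambda> G)"
  note D = left_module_dsum[OF G dF] and D' = left_module_dsum[OF dF dG]
  \<comment> \<open>A functional in the kernel of the dual of \<gamma> vanishes on \<gamma> G, hence
    on \<gamma> U, and so lies in \<mu> U, where \<sigma> is a section of \<mu>.\<close>
  have \<mu>\<sigma>': "\<mu> (\<sigma> \<phi>) = \<phi>" if "\<phi> \<in> carrier (dual \<Lambda> F)" "dual_map G \<gamma> \<phi> = \<zero>\<^bsub>dual \<Lambda> G\<^esub>" for \<phi>
    using that(1)
  proof (intro \<mu>\<sigma> annihilator)
    fix u assume "u \<in> U"
    then show "\<phi> (\<gamma> u) = \<zero>" using fun_cong[OF that(2), of u] by (simp add: dual_map_apply dual_ops UG)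
  qed
  have "isomorphic \<Lambda> (ker_mod ?D ?D' (map_prod \<mu> (dual_map G \<gamma>))) (ker_mod G (dual \<Lambda> G) (dual_map G \<gamma> \<circ> \<mu>))"
  proof (rule ker_isomorphic[OF D D' G dG \<mu>_\<gamma>' \<gamma>'\<mu>])
    show "(\<lambda>(x, \<phi>). x \<oplus>\<^bsub>G\<^esub> \<sigma> \<phi>) \<in> mod_hom \<Lambda> ?D G"
      by (rule mod_homI)
        (auto simp: \<sigma>c mod_hom_add[OF \<sigma>_hom] mod_hom_smult[OF \<sigma>_hom] G.smult_r_distr G.M.a_ac)
  next
    fix v assume "v \<in> carrier ?D" "map_prod \<mu> (dual_map G \<gamma>) v = \<zero>\<^bsub>?D'\<^esub>"
    then obtain x \<phi> where v: "v = (x, \<phi>)" and x: "x \<in> carrier G" "\<mu> x = \<zero>\<^bsub>dual \<Lambda> F\<^esub>"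
      and \<phi>: "\<phi> \<in> carrier (dual \<Lambda> F)" "dual_map G \<gamma> \<phi> = \<zero>\<^bsub>dual \<Lambda> G\<^esub>" by auto
    have m: "\<mu> (x \<oplus>\<^bsub>G\<^esub> \<sigma> \<phi>) = \<phi>"
      using x \<phi>(1) by (simp add: mod_hom_add[OF \<mu>] \<sigma>c \<mu>\<sigma>'[OF \<phi>])
    show "(dual_map G \<gamma> \<circ> \<mu>) (case v of (x, \<phi>) \<Rightarrow> x \<oplus>\<^bsub>G\<^esub> \<sigma> \<phi>) = \<zero>\<^bsub>dual \<Lambda> G\<^esub>"
      using m \<phi>(2) by (simp add: v)
    show "v = \<zero>\<^bsub>?D\<^esub>" if "(case v of (x, \<phi>) \<Rightarrow> x \<oplus>\<^bsub>G\<^esub> \<sigma> \<phi>) = \<zero>\<^bsub>G\<^esub>"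
    proof -
      have "\<phi> = \<zero>\<^bsub>dual \<Lambda> F\<^esub>" using m that by (simp add: v mod_hom_zero[OF G dF \<mu>])
      then show ?thesis using that x(1) by (simp add: v mod_hom_zero[OF dF G \<sigma>_hom])
    qed
  next
    fix y assume y: "y \<in> carrier G" "(dual_map G \<gamma> \<circ> \<mu>) y = \<zero>\<^bsub>dual \<Lambda> G\<^esub>"
    have m: "\<mu> (\<sigma> (\<mu> y)) = \<mu> y" using \<mu>\<sigma>'[OF \<mu>c[OF y(1)]] y(2) by simp
    have "\<mu> (y \<ominus>\<^bsub>G\<^esub> \<sigma> (\<mu> y)) = \<zero>\<^bsub>dual \<Lambda> F\<^esub>"
      using y(1) m by (simp add: mod_hom_minus[OF G dF \<mu>] \<sigma>c \<mu>c dF.minus_eq_zero_iff)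
    moreover have "(y \<ominus>\<^bsub>G\<^esub> \<sigma> (\<mu> y)) \<oplus>\<^bsub>G\<^esub> \<sigma> (\<mu> y) = y"
      using y(1) by (simp add: G.diff_add_cancel \<sigma>c \<mu>c)
    ultimately show "\<exists>v\<in>carrier ?D. map_prod \<mu> (dual_map G \<gamma>) v = \<zero>\<^bsub>?D'\<^esub>
        \<and> (case v of (x, \<phi>) \<Rightarrow> x \<oplus>\<^bsub>G\<^esub> \<sigma> \<phi>) = y"
      using y by (intro bexI[of _ "(y \<ominus>\<^bsub>G\<^esub> \<sigma> (\<mu> y), \<mu> y)"]) (simp_all add: \<sigma>c \<mu>c)
  qed
  from isomorphic_sym[OF left_module_ker[OF D D' \<mu>_\<gamma>'] this]
  have "isomorphic \<Lambda> (ker_mod G (dual \<Lambda> G) (dual_map G \<gamma> \<circ> \<mu>)) (ker_mod ?D ?D' (map_prod \<mu> (dual_map G \<gamma>)))" .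
  also note ker_map_prod_isomorphic
  \<comment> \<open>The splitting produces ker \<mu> as first summand;
    \<open>ker_\<gamma>_\<mu>\<close> replaces it by ker \<gamma>.\<close>
  also (isomorphic_trans) note isomorphic_dsum[OF
      isomorphic_sym[OF left_module_ker[OF G F \<gamma>] ker_\<gamma>_\<mu>] isomorphic_refl]
  finally (isomorphic_trans) show ?thesis .
qed

lemma coker_\<gamma>'\<mu>: "isomorphic \<Lambda> (coker_mod G (dual \<Lambda> G) (dual_map G \<gamma> \<circ> \<mu>))
  (dsum (coker_mod G F \<gamma>) (coker_mod (dual \<Lambda> F) (dual \<Lambda> G) (dual_map G \<gamma>)))"
proof -
  let ?D = "dsum G (dual \<Lambda> F)" and ?D' = "dsum (dual \<Lambda> F) (dual \<Lambda> G)"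
  note D = left_module_dsum[OF G dF] and D' = left_module_dsum[OF dF dG]
  note \<tau>' = dual_map_hom[OF involution_ring_axioms F G \<tau>_hom]
  note \<tau>'c = mod_hom_closed[OF \<tau>']
  \<comment> \<open>\<open>\<gamma> \<circ> \<tau>\<close> is the identity on \<gamma> U, so pulling
    \<phi> back along it changes \<phi> only by an element of \<mu> U.\<close>
  have mod_U: "\<exists>u\<in>U. \<phi> = dual_map F \<tau> (dual_map G \<gamma> \<phi>) \<oplus>\<^bsub>dual \<Lambda> F\<^esub> \<mu> u"
    if \<phi>: "\<phi> \<in> carrier (dual \<Lambda> F)" for \<phi>
    by (rule dual_F_eq_modulo[OF \<phi> \<tau>'c[OF \<gamma>'c[OF \<phi>]]])
      (auto simp: dual_map_apply \<gamma>c \<tau>c UG \<tau>\<gamma>)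
  have "isomorphic \<Lambda> (coker_mod G (dual \<Lambda> G) (dual_map G \<gamma> \<circ> \<mu>)) (coker_mod ?D ?D' (map_prod \<mu> (dual_map G \<gamma>)))"
  proof (rule coker_isomorphic[OF G dG D D' \<gamma>'\<mu> \<mu>_\<gamma>'])
    show "(\<lambda>h. (dual_map F \<tau> h, h)) \<in> mod_hom \<Lambda> (dual \<Lambda> G) ?D'"
      by (rule mod_homI) (simp_all add: \<tau>'c mod_hom_add[OF \<tau>'] mod_hom_smult[OF \<tau>'])
  next
    fix x assume x: "x \<in> carrier G"
    \<comment> \<open>The first component of the image of \<open>\<gamma>\<^sup>*\<mu> x\<close> is
      \<mu> x only up to some \<mu> u. This explains the preimage (x - u, \<mu> x), whose second
      entry produces the second component.\<close>
    obtain u where u: "u \<in> U" "\<mu> x = dual_map F \<tau> (dual_map G \<gamma> (\<mu> x)) \<oplus>\<^bsub>dual \<Lambda> F\<^esub> \<mu> u"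
      using mod_U[OF \<mu>c[OF x]] by auto
    have "dual_map F \<tau> (dual_map G \<gamma> (\<mu> x)) = \<mu> x \<ominus>\<^bsub>dual \<Lambda> F\<^esub> \<mu> u"
      using dF.add_minus_cancel[OF \<tau>'c[OF \<gamma>'c[OF \<mu>c[OF x]]] \<mu>c[OF UG[OF u(1)]]] u(2) by simp
    also have "\<dots> = \<mu> (x \<ominus>\<^bsub>G\<^esub> u)" using x u(1) by (simp add: mod_hom_minus[OF G dF \<mu>] UG)
    finally have "(dual_map F \<tau> ((dual_map G \<gamma> \<circ> \<mu>) x), (dual_map G \<gamma> \<circ> \<mu>) x)
      = map_prod \<mu> (dual_map G \<gamma>) (x \<ominus>\<^bsub>G\<^esub> u, \<mu> x)" by simp
    then show "(dual_map F \<tau> ((dual_map G \<gamma> \<circ> \<mu>) x), (dual_map G \<gamma> \<circ> \<mu>) x)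
      \<in> map_prod \<mu> (dual_map G \<gamma>) ` carrier ?D"
      using x u(1) by (intro image_eqI[where x = "(x \<ominus>\<^bsub>G\<^esub> u, \<mu> x)"]) (simp_all add: \<mu>c UG)
  next
    fix h v assume h: "h \<in> carrier (dual \<Lambda> G)" and "v \<in> carrier ?D"
      and "(dual_map F \<tau> h, h) = map_prod \<mu> (dual_map G \<gamma>) v"
    then obtain x \<phi> where x: "x \<in> carrier G" and \<phi>: "\<phi> \<in> carrier (dual \<Lambda> F)"
      and eq: "dual_map F \<tau> h = \<mu> x" "h = dual_map G \<gamma> \<phi>" by auto
    obtain u where u: "u \<in> U" "\<phi> = \<mu> x \<oplus>\<^bsub>dual \<Lambda> F\<^esub> \<mu> u"
      using mod_U[OF \<phi>] eq by auto
    then have "\<phi> = \<mu> (x \<oplus>\<^bsub>G\<^esub> u)" using x by (simp add: mod_hom_add[OF \<mu>] UG)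
    then show "h \<in> (dual_map G \<gamma> \<circ> \<mu>) ` carrier G" using x u(1) eq(2) by (simp add: UG)
  next
    fix y' assume "y' \<in> carrier ?D'"
    then obtain \<phi> h where y': "y' = (\<phi>, h)" and \<phi>: "\<phi> \<in> carrier (dual \<Lambda> F)" and h: "h \<in> carrier (dual \<Lambda> G)"
      by auto
    \<comment> \<open>To be solved: \<open>\<phi> = \<tau>\<^sup>* h' + \<mu> x\<close> and
      \<open>h = h' + \<gamma>\<^sup>* k\<close>. With this k, \<open>\<tau>\<^sup>* h' = \<phi> +
      (k - \<tau>\<^sup>* \<gamma>\<^sup>* k)\<close>, and the bracket is some \<mu> u by
      \<open>mod_U\<close>; so x = -u works.\<close>
    define k where "k = dual_map F \<tau> h \<ominus>\<^bsub>dual \<Lambda> F\<^esub> \<phi>"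
    have k: "k \<in> carrier (dual \<Lambda> F)" using \<phi> h by (simp add: k_def \<tau>'c)
    obtain u where u: "u \<in> U" "k = dual_map F \<tau> (dual_map G \<gamma> k) \<oplus>\<^bsub>dual \<Lambda> F\<^esub> \<mu> u"
      using mod_U[OF k] by auto
    let ?h = "h \<ominus>\<^bsub>dual \<Lambda> G\<^esub> dual_map G \<gamma> k"
    let ?t = "dual_map F \<tau> (dual_map G \<gamma> k)"
    have t: "?t \<in> carrier (dual \<Lambda> F)" by (rule \<tau>'c[OF \<gamma>'c[OF k]])
    note uc = \<mu>c[OF UG[OF u(1)]]
    have "dual_map F \<tau> h = k \<oplus>\<^bsub>dual \<Lambda> F\<^esub> \<phi>"
      unfolding k_def using dF.diff_add_cancel[OF \<tau>'c[OF h] \<phi>] by simp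
    also have "\<dots> = (\<phi> \<oplus>\<^bsub>dual \<Lambda> F\<^esub> \<mu> u) \<oplus>\<^bsub>dual \<Lambda> F\<^esub> ?t"
      using t uc \<phi> by (subst u(2)) (simp add: dF.M.a_ac)
    finally have "dual_map F \<tau> ?h = \<phi> \<oplus>\<^bsub>dual \<Lambda> F\<^esub> \<mu> u"
      using dF.add_minus_cancel[OF dF.M.a_closed[OF \<phi> uc] t]
      by (simp add: mod_hom_minus[OF dG dF \<tau>'] h \<gamma>'c k)
    then have "\<phi> = dual_map F \<tau> ?h \<oplus>\<^bsub>dual \<Lambda> F\<^esub> \<mu> (\<ominus>\<^bsub>G\<^esub> u)"
      using dF.add_minus_cancel[OF \<phi> uc] u(1)
      by (simp add: mod_hom_uminus[OF G dF \<mu>] UG dF.M.minus_eq)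
    moreover have "h = ?h \<oplus>\<^bsub>dual \<Lambda> G\<^esub> dual_map G \<gamma> k"
      using dG.diff_add_cancel[OF h \<gamma>'c[OF k]] by simp
    ultimately have "y' = (dual_map F \<tau> ?h, ?h) \<oplus>\<^bsub>?D'\<^esub> map_prod \<mu> (dual_map G \<gamma>) (\<ominus>\<^bsub>G\<^esub> u, k)"
      by (simp add: y')
    moreover have "(\<ominus>\<^bsub>G\<^esub> u, k) \<in> carrier ?D" "?h \<in> carrier (dual \<Lambda> G)"
      using u(1) k h by (simp_all add: UG \<gamma>'c)
    ultimately show "\<exists>h\<in>carrier (dual \<Lambda> G). \<exists>v\<in>carrier ?D.
      y' = (dual_map F \<tau> h, h) \<oplus>\<^bsub>?D'\<^esub> map_prod \<mu> (dual_map G \<gamma>) v" by blast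
  qed
  also note coker_map_prod_isomorphic[OF G dF dF dG \<mu> \<gamma>']
  also (isomorphic_trans) note isomorphic_dsum[OF
      isomorphic_sym[OF left_module_coker[OF G F \<gamma>] coker_\<gamma>_\<mu>] isomorphic_refl]
  finally (isomorphic_trans) show ?thesis .
qed

lemma F_decomposition: "isomorphic \<Lambda> F (dsum H (dual \<Lambda> H))"
proof -
  have "(\<lambda>f. (\<tau> f, A f)) \<in> mod_iso \<Lambda> F (dsum H (dual \<Lambda> H))"
  proof (rule mod_isoI'[OF F left_module_dsum[OF H W]])
    show "(\<lambda>f. (\<tau> f, A f)) \<in> mod_hom \<Lambda> F (dsum H (dual \<Lambda> H))"
      using mod_hom_add[OF \<tau>] mod_hom_smult[OF \<tau>]
      by (intro mod_homI)
        (simp_all add: \<tau>U mod_hom_closed[OF A_hom] mod_hom_add[OF A_hom] mod_hom_smult[OF A_hom])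
  next
    fix f assume f: "f \<in> carrier F" and z: "(\<tau> f, A f) = \<zero>\<^bsub>dsum H (dual \<Lambda> H)\<^esub>"
    have "\<mu> u f = \<zero>" if u: "u \<in> U" for u
    proof -
      have "bar (\<mu> u f) = \<zero>" using z A_apply[OF u, of f] u by (simp add: dual_ops)
      then show ?thesis by (simp add: bar_eq_zero_iff[OF \<mu>\<gamma>c[OF UG[OF u] f]])
    qed
    \<comment> \<open>Vanishing of A f gives f = \<gamma> (\<tau> f), and \<tau> f is zero as
      well.\<close>
    then have "f = \<zero>\<^bsub>F\<^esub> \<oplus>\<^bsub>F\<^esub> \<gamma> (\<tau> (f \<ominus>\<^bsub>F\<^esub> \<zero>\<^bsub>F\<^esub>))"
      by (intro F_eq_modulo f F.M.zero_closed) (simp add: dual_at_zero[OF F \<mu>c[OF UG]])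
    then show "f = \<zero>\<^bsub>F\<^esub>" using f z by (simp add: F.minus_zero mod_hom_zero[OF G F \<gamma>])
  next
    fix v assume "v \<in> carrier (dsum H (dual \<Lambda> H))"
    then obtain u \<chi> where v: "v = (u, \<chi>)" and u: "u \<in> U" and \<chi>: "\<chi> \<in> carrier (dual \<Lambda> H)" by auto
    interpret W: left_module \<Lambda> "dual \<Lambda> H" by (rule W)
    obtain f where f: "f \<in> carrier F" "A f = \<chi>" using A_surj[OF \<chi>] .
    \<comment> \<open>An f with A f = \<chi> may be shifted by \<gamma> w with w in U: isotropy
      leaves A f unchanged, while \<tau> (\<gamma> w) = w adjusts the first component to u.\<close>
    define w where "w = u \<ominus>\<^bsub>G\<^esub> \<tau> f"
    have w: "w \<in> U" unfolding w_def by (rule submodule_minus[OF G U u \<tau>U[OF f(1)]])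
    have "A (\<gamma> w) = \<zero>\<^bsub>dual \<Lambda> H\<^esub>"
      by (rule dual_eqI[where M = H and \<Lambda> = \<Lambda>])
        (simp_all add: mod_hom_closed[OF A_hom] \<gamma>c UG w dual_ops A_apply isotropic bar_zero)
    then have "A (f \<oplus>\<^bsub>F\<^esub> \<gamma> w) = \<chi>"
      using f w \<chi> by (simp add: mod_hom_add[OF A_hom] \<gamma>c UG)
    moreover have "\<tau> (f \<oplus>\<^bsub>F\<^esub> \<gamma> w) = u"
      using f w u G.add_diff_cancel[OF UG[OF u] \<tau>c[OF f(1)]]
      by (simp add: mod_hom_add[OF \<tau>_hom] \<gamma>c UG \<tau>\<gamma>) (simp add: w_def)
    ultimately show "\<exists>f\<in>carrier F. (\<tau> f, A f) = v"
      using f w by (intro bexI[of _ "f \<oplus>\<^bsub>F\<^esub> \<gamma> w"]) (simp_all add: v \<gamma>c UG)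
  qed
  then show ?thesis by (rule isomorphicI)
qed

end

section \<open>From direct summands to retractions, and from elementary preformations to the
  locale\<close>

lemma direct_summand_projection:
  assumes F: "left_module R F" and ds: "direct_summand R F V"
  obtains \<pi> where "\<pi> \<in> mod_hom R F (restr_mod F V)" "\<And>v. v \<in> V \<Longrightarrow> \<pi> v = v"
proof -
  interpret F: left_module R F by fact
  obtain W where V: "submodule V R F" and W: "submodule W R F"
    and VW: "V \<inter> W = {\<zero>\<^bsub>F\<^esub>}" and sum: "V <+>\<^bsub>F\<^esub> W = carrier F"
    using ds by (auto simp: direct_summand_def)
  have Vc: "v \<in> carrier F" if "v \<in> V" for v using submodule_subset[OF V] that by auto
  have Wc: "w \<in> carrier F" if "w \<in> W" for w using submodule_subset[OF W] that by auto
  \<comment> \<open>V and W meet only in zero, so the component in V is unique, and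
    \<open>eq\<close> computes \<pi> from any decomposition.\<close>
  define \<pi> where "\<pi> f = (SOME v. v \<in> V \<and> f \<ominus>\<^bsub>F\<^esub> v \<in> W)" for f
  have eq: "\<pi> f = v" if v: "v \<in> V" and f: "f \<in> carrier F" and fv: "f \<ominus>\<^bsub>F\<^esub> v \<in> W" for f v
    unfolding \<pi>_def
  proof (rule some_equality)
    show "v \<in> V \<and> f \<ominus>\<^bsub>F\<^esub> v \<in> W" using v fv by simp
    fix v' assume v': "v' \<in> V \<and> f \<ominus>\<^bsub>F\<^esub> v' \<in> W"
    have "(f \<ominus>\<^bsub>F\<^esub> v) \<ominus>\<^bsub>F\<^esub> (f \<ominus>\<^bsub>F\<^esub> v') = (f \<ominus>\<^bsub>F\<^esub> f) \<oplus>\<^bsub>F\<^esub> (v' \<ominus>\<^bsub>F\<^esub> v)"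
      using f Vc v v' by (simp add: F.M.minus_eq F.M.minus_add F.M.a_ac)
    also have "\<dots> = v' \<ominus>\<^bsub>F\<^esub> v"
      using f Vc v v' by (simp add: F.M.minus_eq F.M.r_neg)
    finally have "v' \<ominus>\<^bsub>F\<^esub> v \<in> W" using submodule_minus[OF F W fv, of "f \<ominus>\<^bsub>F\<^esub> v'"] v' by simp
    moreover have "v' \<ominus>\<^bsub>F\<^esub> v \<in> V" using submodule_minus[OF F V] v v' by simp
    ultimately have "v' \<ominus>\<^bsub>F\<^esub> v = \<zero>\<^bsub>F\<^esub>" using VW by blast
    then show "v' = v" using F.minus_eq_zero_iff[of v' v] Vc v v' by simp
  qed
  have ex: "\<exists>v\<in>V. f \<ominus>\<^bsub>F\<^esub> v \<in> W" if f: "f \<in> carrier F" for f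
  proof -
    obtain v w where vw: "v \<in> V" "w \<in> W" "f = v \<oplus>\<^bsub>F\<^esub> w"
      using f unfolding sum[symmetric] set_add_def' by auto
    have "f \<ominus>\<^bsub>F\<^esub> v = w"
      unfolding vw(3) F.M.a_comm[OF Vc[OF vw(1)] Wc[OF vw(2)]]
      by (rule F.add_minus_cancel[OF Wc[OF vw(2)] Vc[OF vw(1)]])
    with vw(1,2) show ?thesis by (intro bexI[of _ v]) simp_all
  qed
  have \<pi>: "\<pi> f \<in> V" "f \<ominus>\<^bsub>F\<^esub> \<pi> f \<in> W" if "f \<in> carrier F" for f
    using ex[OF that] eq that by auto
  have "\<pi> \<in> mod_hom R F (restr_mod F V)"
  proof (rule mod_homI)
    fix f g assume fg: "f \<in> carrier F" "g \<in> carrier F"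
    have "\<pi> (f \<oplus>\<^bsub>F\<^esub> g) = \<pi> f \<oplus>\<^bsub>F\<^esub> \<pi> g"
      by (rule eq) (use fg \<pi> Vc submodule_add[OF V] submodule_add[OF W] in \<open>simp_all add: F.add_minus_add\<close>)
    then show "\<pi> (f \<oplus>\<^bsub>F\<^esub> g) = \<pi> f \<oplus>\<^bsub>restr_mod F V\<^esub> \<pi> g" by simp
  next
    fix a f assume af: "a \<in> carrier R" "f \<in> carrier F"
    have "\<pi> (a \<odot>\<^bsub>F\<^esub> f) = a \<odot>\<^bsub>F\<^esub> \<pi> f"
      by (rule eq) (use af \<pi>[OF af(2)] Vc submodule_smult[OF V] submodule_smult[OF W, of a "f \<ominus>\<^bsub>F\<^esub> \<pi> f"] in
        \<open>simp_all add: F.smult_closed F.smult_minus\<close>)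
    then show "\<pi> (a \<odot>\<^bsub>F\<^esub> f) = a \<odot>\<^bsub>restr_mod F V\<^esub> \<pi> f" by simp
  qed (simp add: \<pi>)
  moreover have "\<pi> v = v" if "v \<in> V" for v
    using that Vc submodule_zero[OF W] by (intro eq) (simp_all add: F.M.minus_eq F.M.r_neg)
  ultimately show ?thesis by (rule that)
qed

text \<open>Project onto f U, then undo f, which maps U isomorphically onto its image.\<close>

lemma direct_summand_retraction:
  assumes G: "left_module R G" and F: "left_module R F" and f: "f \<in> mod_hom R G F"
    and U: "submodule U R G" and inj: "inj_on f U" and ds: "direct_summand R F (f ` U)"
  obtains \<tau> where "\<tau> \<in> mod_hom R F (restr_mod G U)" "\<And>u. u \<in> U \<Longrightarrow> \<tau> (f u) = u"
proof -
  obtain \<pi> where \<pi>: "\<pi> \<in> mod_hom R F (restr_mod F (f ` U))" "\<And>v. v \<in> f ` U \<Longrightarrow> \<pi> v = v"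
    by (rule direct_summand_projection[OF F ds]) blast
  have "f \<in> mod_iso R (restr_mod G U) (restr_mod F (f ` U))"
    using inj submodule_subset[OF U]
    by (intro mod_isoI mod_homI) (auto simp: bij_betw_def subset_iff mod_hom_add[OF f] mod_hom_smult[OF f])
  from mod_iso_hom[OF mod_iso_inv[OF left_module_restr[OF G U] this]]
  have "inv_into U f \<circ> \<pi> \<in> mod_hom R F (restr_mod G U)"
    by (intro mod_hom_comp[OF \<pi>(1)]) simp
  then show ?thesis by (rule that) (simp add: \<pi>(2) inj)
qed

lemma fg_free_reflexive:
  assumes I: "involution_ring \<Lambda>" and M: "fg_free_mod \<Lambda> M"
  shows "reflexive \<Lambda> M"
proof -
  interpret involution_ring \<Lambda> by fact
  obtain n where n: "isomorphic \<Lambda> M (free_mod \<Lambda> n)" and lm: "left_module \<Lambda> M"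
    using M by (auto simp: fg_free_mod_def)
  show ?thesis
    by (rule reflexive_isomorphic[OF I left_module_free[OF ring_axioms] lm
          isomorphic_sym[OF lm n] reflexive_free[OF I]])
qed

text \<open>The complements of \<gamma> U and \<mu> U become \<tau> and \<sigma>, the symmetry of
  \<open>\<gamma>\<^sup>*\<mu>\<close> becomes \<open>sym\<close> with sign -\<epsilon>, and
  injectivity of restriction modulo \<mu> U becomes \<open>annihilator\<close>.\<close>

lemma elementary_lagrangian:
  assumes I: "involution_ring \<Lambda>" and z: "split_preformation \<Lambda> \<epsilon> z"
    and e: "\<ominus>\<^bsub>\<Lambda>\<^esub> \<epsilon> \<in> {\<one>\<^bsub>\<Lambda>\<^esub>, \<ominus>\<^bsub>\<Lambda>\<^esub> \<one>\<^bsub>\<Lambda>\<^esub>}" and el: "elementary_preformation \<Lambda> \<epsilon> z"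
  obtains U \<tau> \<sigma> where "lagrangian \<Lambda> (Fmod z) (Gmod z) (gam z) (mu z) (\<ominus>\<^bsub>\<Lambda>\<^esub> \<epsilon>) U \<tau> \<sigma>"
    and "fg_free_mod \<Lambda> (restr_mod (Gmod z) U)"
proof -
  let ?F = "Fmod z" and ?G = "Gmod z" and ?\<gamma> = "gam z" and ?\<mu> = "mu z"
  have F: "left_module \<Lambda> ?F" and refl: "reflexive \<Lambda> ?F" and G: "left_module \<Lambda> ?G"
    and \<gamma>: "?\<gamma> \<in> mod_hom \<Lambda> ?G ?F" and \<mu>: "?\<mu> \<in> mod_hom \<Lambda> ?G (dual \<Lambda> ?F)"
    using z fg_free_reflexive[OF I] by (auto simp: split_preformation_def fg_mod_def fg_free_mod_def)
  have sym: "?\<mu> x (?\<gamma> y) = (\<ominus>\<^bsub>\<Lambda>\<^esub> \<epsilon>) \<otimes>\<^bsub>\<Lambda>\<^esub> bar\<^bsub>\<Lambda>\<^esub> (?\<mu> y (?\<gamma> x))"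
    if "x \<in> carrier ?G" "y \<in> carrier ?G" for x y
  proof -
    have "gam_mu z x y = (\<ominus>\<^bsub>\<Lambda>\<^esub> \<epsilon>) \<otimes>\<^bsub>\<Lambda>\<^esub> bar\<^bsub>\<Lambda>\<^esub> (gam_mu z y x)"
      using z that unfolding split_preformation_def quadratic_form_def symmetric_form_def by blast
    then show ?thesis by (simp only: gam_mu_def dual_map_apply that)
  qed
  from el show thesis
    unfolding elementary_preformation_def Let_def
  proof (elim exE conjE bexE)
    fix U h
    assume U: "submodule U \<Lambda> ?G" and free: "fg_free_mod \<Lambda> (restr_mod ?G U)"
      and iso: "\<forall>x\<in>U. \<forall>y\<in>U. gam_mu z x y = \<zero>\<^bsub>\<Lambda>\<^esub>"
      and inj: "inj_on ?\<gamma> U" "inj_on ?\<mu> U"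
      and ds: "direct_summand \<Lambda> ?F (?\<gamma> ` U)" "direct_summand \<Lambda> (dual \<Lambda> ?F) (?\<mu> ` U)"
      and h: "h \<in> mod_iso \<Lambda> (quot_mod (dual \<Lambda> ?F) (?\<mu> ` U)) (dual \<Lambda> (restr_mod ?F (?\<gamma> ` U)))"
      and hr': "\<forall>f\<in>carrier (dual \<Lambda> ?F). h (?\<mu> ` U +>\<^bsub>dual \<Lambda> ?F\<^esub> f) = restrict f (?\<gamma> ` U)"
    note hr = hr'[rule_format]
    note dF = left_module_dual[OF I F]
    interpret dF: left_module \<Lambda> "dual \<Lambda> ?F" by (rule dF)
    have UG: "u \<in> carrier ?G" if "u \<in> U" for u using submodule_subset[OF U] that by auto
    obtain \<tau> where \<tau>: "\<tau> \<in> mod_hom \<Lambda> ?F (restr_mod ?G U)" "\<And>u. u \<in> U \<Longrightarrow> \<tau> (?\<gamma> u) = u"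
      by (rule direct_summand_retraction[OF G F \<gamma> U inj(1) ds(1)]) blast
    obtain \<sigma> where \<sigma>: "\<sigma> \<in> mod_hom \<Lambda> (dual \<Lambda> ?F) (restr_mod ?G U)" "\<And>u. u \<in> U \<Longrightarrow> \<sigma> (?\<mu> u) = u"
      by (rule direct_summand_retraction[OF G dF \<mu> U inj(2) ds(2)]) blast
    have U1: "submodule (?\<mu> ` U) \<Lambda> (dual \<Lambda> ?F)" by (rule submodule_image[OF G dF \<mu> U])
    note q = quot_mod_carrier[OF dF U1] and cs = coset_eq_subgroup_iff[OF dF U1]
    \<comment> \<open>If \<phi> vanishes on \<gamma> U, then h sends the cosets of \<phi> and of
      zero to the same restriction; injectivity of h puts \<phi> into \<mu> U.\<close>
    have ann: "\<phi> \<in> ?\<mu> ` U" if \<phi>: "\<phi> \<in> carrier (dual \<Lambda> ?F)" and 0: "\<And>u. u \<in> U \<Longrightarrow> \<phi> (?\<gamma> u) = \<zero>\<^bsub>\<Lambda>\<^esub>" for \<phi>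
    proof -
      have z: "\<zero>\<^bsub>dual \<Lambda> ?F\<^esub> \<in> carrier (dual \<Lambda> ?F)" by simp
      have "restrict \<phi> (?\<gamma> ` U) = restrict \<zero>\<^bsub>dual \<Lambda> ?F\<^esub> (?\<gamma> ` U)"
        by (rule restrict_ext) (auto simp: 0 dual_ops mod_hom_closed[OF \<gamma>] UG)
      then have "h (?\<mu> ` U +>\<^bsub>dual \<Lambda> ?F\<^esub> \<phi>) = h (?\<mu> ` U +>\<^bsub>dual \<Lambda> ?F\<^esub> \<zero>\<^bsub>dual \<Lambda> ?F\<^esub>)"
        by (simp only: hr[OF \<phi>] hr[OF z])
      then have "?\<mu> ` U +>\<^bsub>dual \<Lambda> ?F\<^esub> \<phi> = ?\<mu> ` U +>\<^bsub>dual \<Lambda> ?F\<^esub> \<zero>\<^bsub>dual \<Lambda> ?F\<^esub>"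
        using mod_iso_bij[OF h] \<phi> z unfolding bij_betw_def q by (auto dest: inj_onD)
      also have "\<dots> = ?\<mu> ` U" by (simp only: cs[OF z] submodule_zero[OF U1])
      finally show ?thesis by (simp only: cs[OF \<phi>])
    qed
    have iso': "?\<mu> x (?\<gamma> y) = \<zero>\<^bsub>\<Lambda>\<^esub>" if "x \<in> U" "y \<in> U" for x y
      using iso that by (simp add: gam_mu_def dual_map_apply UG)
    have "lagrangian \<Lambda> ?F ?G ?\<gamma> ?\<mu> (\<ominus>\<^bsub>\<Lambda>\<^esub> \<epsilon>) U \<tau> \<sigma>"
      by (intro lagrangian.intro lagrangian_axioms.intro)
        (rule I F refl G \<gamma> \<mu> e U \<tau>(1) \<sigma>(1) | (rule sym iso' ann \<tau>(2) \<sigma>(2); blast))+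
    then show ?thesis using free by (rule that)
  qed
qed

section \<open>Invariance under stable strong isomorphism\<close>

text \<open>The claims about kernels and cokernels, bundled into one property so that its invariance
  can be stated as an equivalence and used in both directions.\<close>

definition ker_coker_split :: "'a involution_ring \<Rightarrow> ('a, 'f, 'g) preform \<Rightarrow> bool"
  where "ker_coker_split \<Lambda> z \<longleftrightarrow>
    (let F = Fmod z; G = Gmod z; \<gamma> = gam z; \<mu> = mu z in
      isomorphic \<Lambda> (ker_mod G F \<gamma>) (ker_mod G (dual \<Lambda> F) \<mu>) \<and>
      isomorphic \<Lambda> (coker_mod G F \<gamma>) (coker_mod G (dual \<Lambda> F) \<mu>) \<and>
      isomorphic \<Lambda> (ker_mod G (dual \<Lambda> G) (dual_map G \<gamma> \<circ> \<mu>))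
        (dsum (ker_mod G F \<gamma>) (ker_mod (dual \<Lambda> F) (dual \<Lambda> G) (dual_map G \<gamma>))) \<and>
      isomorphic \<Lambda> (coker_mod G (dual \<Lambda> G) (dual_map G \<gamma> \<circ> \<mu>))
        (dsum (coker_mod G F \<gamma>) (coker_mod (dual \<Lambda> F) (dual \<Lambda> G) (dual_map G \<gamma>))))"

lemma isomorphic_cong:
  assumes "left_module R X" "left_module R Y" "isomorphic R X X'" "isomorphic R Y Y'"
  shows "isomorphic R X Y \<longleftrightarrow> isomorphic R X' Y'"
  using isomorphic_trans[OF isomorphic_sym[OF assms(1,3)] isomorphic_trans[OF _ assms(4)]]
    isomorphic_trans[OF assms(3) isomorphic_trans[OF _ isomorphic_sym[OF assms(2,4)]]]
  by blast

text \<open>On the dual of F, the inclusion and projection for \<mu> are required to be the duals of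
  r and j. These are what the dualised stabilisation of \<gamma> has on its source, so
  \<open>s2\<close> and \<open>s3\<close> compose, and all four maps keep their kernels and
  cokernels up to isomorphism.\<close>

lemma ker_coker_split_stabilization:
  assumes I: "involution_ring \<Lambda>"
    and s1: "stabilization \<Lambda> (Gmod z) (Fmod z) (gam z) (Gmod z') (Fmod z') (gam z') i p j r g"
    and s2: "stabilization \<Lambda> (Gmod z) (dual \<Lambda> (Fmod z)) (mu z) (Gmod z') (dual \<Lambda> (Fmod z')) (mu z')
      i p (dual_map (Fmod z') r) (dual_map (Fmod z) j) h"
  shows "ker_coker_split \<Lambda> z \<longleftrightarrow> ker_coker_split \<Lambda> z'"
proof -
  note s3 = stabilization_dual[OF I s1]
  note s4 = stabilization_comp[OF s2 s3]
  interpret s1: stabilization \<Lambda> "Gmod z" "Fmod z" "gam z" "Gmod z'" "Fmod z'" "gam z'" i p j r g by (rule s1)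
  interpret s2: stabilization \<Lambda> "Gmod z" "dual \<Lambda> (Fmod z)" "mu z" "Gmod z'" "dual \<Lambda> (Fmod z')" "mu z'"
    i p "dual_map (Fmod z') r" "dual_map (Fmod z) j" h by (rule s2)
  note lm = left_module_ker left_module_coker left_module_dsum s1.M s1.N s2.N left_module_dual[OF I]
    s1.f s2.f dual_map_hom[OF I] mod_hom_comp[OF s2.f dual_map_hom[OF I s1.M s1.N s1.f]]
  note isos = s1.ker_iso s1.coker_iso s2.ker_iso s2.coker_iso s3[THEN stabilization.ker_iso]
    s3[THEN stabilization.coker_iso] s4[THEN stabilization.ker_iso] s4[THEN stabilization.coker_iso]
  show ?thesis
    unfolding ker_coker_split_def Let_def
    by (intro arg_cong2[where f = "(\<and>)"] isomorphic_cong isomorphic_dsum isos lm)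
qed

lemma preform_sum_simps:
  "Fmod (preform_sum \<Lambda> z y) = dsum (Fmod z) (Fmod y)"
  "Gmod (preform_sum \<Lambda> z y) = dsum (Gmod z) (Gmod y)"
  "gam (preform_sum \<Lambda> z y) = map_prod (gam z) (gam y)"
  "mu (preform_sum \<Lambda> z y) =
    (\<lambda>(x, x'). \<lambda>(u, v)\<in>carrier (dsum (Fmod z) (Fmod y)). mu z x u \<oplus>\<^bsub>\<Lambda>\<^esub> mu y x' v)"
  by (simp_all add: preform_sum_def map_prod_def)

section \<open>Adding a preformation whose two maps are isomorphisms\<close>

context
  fixes \<Lambda> :: "'a involution_ring" and z :: "('a, 'f, 'g) preform" and y :: "('a, 'f2, 'g2) preform"
  assumes I: "involution_ring \<Lambda>"
    and F: "left_module \<Lambda> (Fmod z)" and G: "left_module \<Lambda> (Gmod z)"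
    and \<gamma>: "gam z \<in> mod_hom \<Lambda> (Gmod z) (Fmod z)"
    and \<mu>: "mu z \<in> mod_hom \<Lambda> (Gmod z) (dual \<Lambda> (Fmod z))"
    and F2: "left_module \<Lambda> (Fmod y)" and G2: "left_module \<Lambda> (Gmod y)"
    and \<gamma>2: "gam y \<in> mod_iso \<Lambda> (Gmod y) (Fmod y)"
    and \<mu>2: "mu y \<in> mod_iso \<Lambda> (Gmod y) (dual \<Lambda> (Fmod y))"
begin

interpretation L: involution_ring \<Lambda> by (rule I)
interpretation F: left_module \<Lambda> "Fmod z" by (rule F)
interpretation G: left_module \<Lambda> "Gmod z" by (rule G)
interpretation F2: left_module \<Lambda> "Fmod y" by (rule F2)
interpretation G2: left_module \<Lambda> "Gmod y" by (rule G2)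

lemma sum_stabilization_gam:
  "stabilization \<Lambda> (Gmod z) (Fmod z) (gam z)
    (dsum (Gmod z) (Gmod y)) (dsum (Fmod z) (Fmod y)) (map_prod (gam z) (gam y))
    (\<lambda>x. (x, \<zero>\<^bsub>Gmod y\<^esub>)) fst (\<lambda>x. (x, \<zero>\<^bsub>Fmod y\<^esub>)) fst
    ((\<lambda>x. (\<zero>\<^bsub>Gmod z\<^esub>, x)) \<circ> (inv_into (carrier (Gmod y)) (gam y) \<circ> snd))"
proof -
  note k = mod_iso_hom[OF mod_iso_inv[OF G2 \<gamma>2]] and h = mod_iso_hom[OF \<gamma>2]
  note kh = bij_betw_inv_into_left[OF mod_iso_bij[OF \<gamma>2]] bij_betw_inv_into_right[OF mod_iso_bij[OF \<gamma>2]]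
  note c = mod_hom_closed[OF \<gamma>] mod_hom_closed[OF h] mod_hom_closed[OF k]
  show ?thesis
    by (rule stabilization.intro)
      (intro left_module_dsum map_prod_hom inl_hom inr_hom fst_hom snd_hom F G F2 G2 \<gamma> h k
        mod_hom_comp[OF mod_hom_comp[OF snd_hom k] inr_hom]
       | auto simp: c kh mod_hom_zero[OF G2 F2 h] mod_hom_zero[OF F2 G2 k] mod_hom_zero[OF G F \<gamma>]; fail)+
qed

text \<open>In the sum, \<mu> takes values in the dual of a direct sum, not in a direct sum of
  duals, so it is no \<open>map_prod\<close>. Pullbacks along projections and inclusions mediate
  between the two, in the form that \<open>ker_coker_split_stabilization\<close> asks for.\<close>

lemma sum_stabilization_mu:
  "stabilization \<Lambda> (Gmod z) (dual \<Lambda> (Fmod z)) (mu z)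
    (dsum (Gmod z) (Gmod y)) (dual \<Lambda> (dsum (Fmod z) (Fmod y))) (mu (preform_sum \<Lambda> z y))
    (\<lambda>x. (x, \<zero>\<^bsub>Gmod y\<^esub>)) fst
    (dual_map (dsum (Fmod z) (Fmod y)) fst) (dual_map (Fmod z) (\<lambda>x. (x, \<zero>\<^bsub>Fmod y\<^esub>)))
    ((\<lambda>x. (\<zero>\<^bsub>Gmod z\<^esub>, x)) \<circ>
      (inv_into (carrier (Gmod y)) (mu y) \<circ> dual_map (Fmod y) (\<lambda>x. (\<zero>\<^bsub>Fmod z\<^esub>, x))))"
proof -
  let ?D = "dsum (Fmod z) (Fmod y)" and ?E = "dsum (Gmod z) (Gmod y)"
  let ?\<mu> = "mu (preform_sum \<Lambda> z y)" and ?k = "inv_into (carrier (Gmod y)) (mu y)"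
  let ?r = "dual_map (Fmod y) (\<lambda>x. (\<zero>\<^bsub>Fmod z\<^esub>, x))"
  note D = left_module_dsum[OF F F2] and d = left_module_dual[OF I]
  interpret dD: left_module \<Lambda> "dual \<Lambda> ?D" by (rule d[OF D])
  interpret dF: left_module \<Lambda> "dual \<Lambda> (Fmod z)" by (rule d[OF F])
  interpret dF2: left_module \<Lambda> "dual \<Lambda> (Fmod y)" by (rule d[OF F2])
  note k = mod_iso_hom[OF mod_iso_inv[OF G2 \<mu>2]] and h = mod_iso_hom[OF \<mu>2]
  note kh = bij_betw_inv_into_left[OF mod_iso_bij[OF \<mu>2]] bij_betw_inv_into_right[OF mod_iso_bij[OF \<mu>2]]
  note i1 = dual_map_hom[OF I F D inl_hom[OF F2]] and i2 = dual_map_hom[OF I F2 D inr_hom[OF F]]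
    and p1 = dual_map_hom[OF I D F fst_hom] and p2 = dual_map_hom[OF I D F2 snd_hom]
  note c = mod_hom_closed[OF \<mu>] mod_hom_closed[OF h] mod_hom_closed[OF k]
    mod_hom_closed[OF i1] mod_hom_closed[OF i2] mod_hom_closed[OF p1] mod_hom_closed[OF p2]
  have app: "?\<mu> (x, x') (u, v) = mu z x u \<oplus>\<^bsub>\<Lambda>\<^esub> mu y x' v"
    if "u \<in> carrier (Fmod z)" "v \<in> carrier (Fmod y)" for x x' u v
    using that by (simp add: preform_sum_simps)
  \<comment> \<open>As a sum of pullbacks, the map is built from known homomorphisms, which yields
    its linearity. Both sides are extensional, so the equation holds for arbitrary x and x'.\<close>
  have \<mu>_eq: "?\<mu> (x, x') = dual_map ?D fst (mu z x) \<oplus>\<^bsub>dual \<Lambda> ?D\<^esub> dual_map ?D snd (mu y x')" for x x'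
    by (rule extensionalityI[of _ "carrier ?D"])
      (auto simp: preform_sum_simps dual_ops dual_map_apply
        intro: dual_ops_extensional(2)[where M = ?D, simplified])
  have \<mu>c: "?\<mu> (x, x') \<in> carrier (dual \<Lambda> ?D)" if "x \<in> carrier (Gmod z)" "x' \<in> carrier (Gmod y)" for x x'
    unfolding \<mu>_eq using that by (simp add: c)
  note z0 = dual_at_zero[OF F mod_hom_closed[OF \<mu>]] dual_at_zero[OF F2 mod_hom_closed[OF h]]
  note cl = dual_closed[OF mod_hom_closed[OF \<mu>]] dual_closed[OF mod_hom_closed[OF h]]
  have r\<mu>: "?r (?\<mu> (x, x')) = mu y x'" if "x \<in> carrier (Gmod z)" "x' \<in> carrier (Gmod y)" for x x'
    by (rule dual_eqI[where M = "Fmod y" and \<Lambda> = \<Lambda>]) (simp_all add: c \<mu>c that dual_map_apply app z0 cl)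
  have \<mu>k: "mu y (?k \<phi>) = \<phi>" if "\<phi> \<in> carrier (dual \<Lambda> (Fmod y))" for \<phi> using that by (rule kh(2))
  show ?thesis
  proof (rule stabilization.intro)
    show "?\<mu> \<in> mod_hom \<Lambda> ?E (dual \<Lambda> ?D)"
    proof (rule mod_homI)
      fix v w assume "v \<in> carrier ?E" "w \<in> carrier ?E"
      then obtain x x' u u' where v: "v = (x, x')" "x \<in> carrier (Gmod z)" "x' \<in> carrier (Gmod y)"
        and w: "w = (u, u')" "u \<in> carrier (Gmod z)" "u' \<in> carrier (Gmod y)" by auto
      show "?\<mu> v \<in> carrier (dual \<Lambda> ?D)" using v by (simp add: \<mu>c)
      show "?\<mu> (v \<oplus>\<^bsub>?E\<^esub> w) = ?\<mu> v \<oplus>\<^bsub>dual \<Lambda> ?D\<^esub> ?\<mu> w"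
        using v(2,3) w(2,3)
        by (simp add: v(1) w(1) \<mu>_eq c mod_hom_add[OF \<mu>] mod_hom_add[OF h] mod_hom_add[OF p1]
            mod_hom_add[OF p2] dD.M.a_ac)
      show "?\<mu> (a \<odot>\<^bsub>?E\<^esub> v) = a \<odot>\<^bsub>dual \<Lambda> ?D\<^esub> ?\<mu> v" if "a \<in> carrier \<Lambda>" for a
        using v(2,3) that
        by (simp add: v(1) \<mu>_eq c mod_hom_smult[OF \<mu>] mod_hom_smult[OF h] mod_hom_smult[OF p1]
            mod_hom_smult[OF p2] dD.smult_r_distr)
    qed
  next
    fix x assume x: "x \<in> carrier (Gmod z)"
    show "?\<mu> (x, \<zero>\<^bsub>Gmod y\<^esub>) = dual_map ?D fst (mu z x)"
      using x by (simp add: \<mu>_eq mod_hom_zero[OF G2 d[OF F2] h] mod_hom_zero[OF d[OF F2] d[OF D] p2] c)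
  next
    fix \<phi> assume \<phi>: "\<phi> \<in> carrier (dual \<Lambda> (Fmod z))"
    show "dual_map (Fmod z) (\<lambda>x. (x, \<zero>\<^bsub>Fmod y\<^esub>)) (dual_map ?D fst \<phi>) = \<phi>"
      by (rule dual_eqI[where M = "Fmod z" and \<Lambda> = \<Lambda>]) (simp_all add: c \<phi> dual_map_apply)
    have "?r (dual_map ?D fst \<phi>) = \<zero>\<^bsub>dual \<Lambda> (Fmod y)\<^esub>"
      by (rule dual_eqI[where M = "Fmod y" and \<Lambda> = \<Lambda>])
        (simp_all add: c \<phi> dual_map_apply dual_ops dual_at_zero[OF F \<phi>])
    then show "((\<lambda>x. (\<zero>\<^bsub>Gmod z\<^esub>, x)) \<circ> (?k \<circ> ?r)) (dual_map ?D fst \<phi>) = \<zero>\<^bsub>?E\<^esub>"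
      by (simp add: mod_hom_zero[OF d[OF F2] G2 k])
  next
    fix v assume "v \<in> carrier ?E"
    then obtain x x' where v: "v = (x, x')" and x: "x \<in> carrier (Gmod z)" "x' \<in> carrier (Gmod y)" by auto
    show "dual_map (Fmod z) (\<lambda>x. (x, \<zero>\<^bsub>Fmod y\<^esub>)) (?\<mu> v) = mu z (fst v)"
      by (rule dual_eqI[where M = "Fmod z" and \<Lambda> = \<Lambda>]) (simp_all add: v x c \<mu>c dual_map_apply app z0 cl)
    show "((\<lambda>x. (\<zero>\<^bsub>Gmod z\<^esub>, x)) \<circ> (?k \<circ> ?r)) (?\<mu> v) \<oplus>\<^bsub>?E\<^esub> (fst v, \<zero>\<^bsub>Gmod y\<^esub>) = v"
      using x by (simp add: v r\<mu> kh)
  next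
    fix \<phi> assume \<phi>: "\<phi> \<in> carrier (dual \<Lambda> ?D)"
    show "fst (((\<lambda>x. (\<zero>\<^bsub>Gmod z\<^esub>, x)) \<circ> (?k \<circ> ?r)) \<phi>) = \<zero>\<^bsub>Gmod z\<^esub>" by simp
    show "?\<mu> (((\<lambda>x. (\<zero>\<^bsub>Gmod z\<^esub>, x)) \<circ> (?k \<circ> ?r)) \<phi>) \<oplus>\<^bsub>dual \<Lambda> ?D\<^esub>
        dual_map ?D fst (dual_map (Fmod z) (\<lambda>x. (x, \<zero>\<^bsub>Fmod y\<^esub>)) \<phi>) = \<phi>"
    proof (rule dual_eqI[where M = ?D and \<Lambda> = \<Lambda>, OF _ \<phi>])
      fix w assume "w \<in> carrier ?D"
      then obtain u v where w: "w = (u, v)" and u: "u \<in> carrier (Fmod z)" and v: "v \<in> carrier (Fmod y)" by auto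
      have cc: "\<phi> (u, \<zero>\<^bsub>Fmod y\<^esub>) \<in> carrier \<Lambda>" "\<phi> (\<zero>\<^bsub>Fmod z\<^esub>, v) \<in> carrier \<Lambda>"
        using u v by (auto intro!: dual_closed[OF \<phi>])
      show "(?\<mu> (((\<lambda>x. (\<zero>\<^bsub>Gmod z\<^esub>, x)) \<circ> (?k \<circ> ?r)) \<phi>) \<oplus>\<^bsub>dual \<Lambda> ?D\<^esub>
          dual_map ?D fst (dual_map (Fmod z) (\<lambda>x. (x, \<zero>\<^bsub>Fmod y\<^esub>)) \<phi>)) w = \<phi> w"
        using u v cc
        by (simp add: w dual_ops app dual_map_apply \<mu>k c \<phi> mod_hom_zero[OF G d[OF F] \<mu>]
            dual_dsum_decomp[OF F F2 \<phi> u v] L.a_comm)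
    qed (simp add: c \<mu>c \<phi>)
  qed (intro left_module_dsum d F G F2 G2 \<mu> inl_hom fst_hom i1 p1
      mod_hom_comp[OF mod_hom_comp[OF i2 k] inr_hom] | simp; fail)+
qed

lemma ker_coker_split_sum: "ker_coker_split \<Lambda> z \<longleftrightarrow> ker_coker_split \<Lambda> (preform_sum \<Lambda> z y)"
  by (rule ker_coker_split_stabilization[OF I])
    (unfold preform_sum_simps(1-3), rule sum_stabilization_gam, rule sum_stabilization_mu)

lemma preform_sum_homs:
  "left_module \<Lambda> (Fmod (preform_sum \<Lambda> z y))" "left_module \<Lambda> (Gmod (preform_sum \<Lambda> z y))"
  "gam (preform_sum \<Lambda> z y) \<in> mod_hom \<Lambda> (Gmod (preform_sum \<Lambda> z y)) (Fmod (preform_sum \<Lambda> z y))"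
  "mu (preform_sum \<Lambda> z y) \<in> mod_hom \<Lambda> (Gmod (preform_sum \<Lambda> z y)) (dual \<Lambda> (Fmod (preform_sum \<Lambda> z y)))"
  unfolding preform_sum_simps(1-3)
  by (rule stabilization.N'[OF sum_stabilization_gam] stabilization.M'[OF sum_stabilization_gam]
      stabilization.f'[OF sum_stabilization_gam] stabilization.f'[OF sum_stabilization_mu])+

end

text \<open>A strong isomorphism is a stabilisation by a zero summand: b and a act as inclusions,
  their inverses as projections, and g is zero.\<close>

lemma ker_coker_split_strongly_isomorphic:
  assumes I: "involution_ring \<Lambda>"
    and F: "left_module \<Lambda> (Fmod z)" and G: "left_module \<Lambda> (Gmod z)"
    and \<gamma>: "gam z \<in> mod_hom \<Lambda> (Gmod z) (Fmod z)"
    and \<mu>: "mu z \<in> mod_hom \<Lambda> (Gmod z) (dual \<Lambda> (Fmod z))"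
    and F': "left_module \<Lambda> (Fmod z')" and G': "left_module \<Lambda> (Gmod z')"
    and \<gamma>': "gam z' \<in> mod_hom \<Lambda> (Gmod z') (Fmod z')"
    and \<mu>': "mu z' \<in> mod_hom \<Lambda> (Gmod z') (dual \<Lambda> (Fmod z'))"
    and iso: "strongly_isomorphic \<Lambda> z z'"
  shows "ker_coker_split \<Lambda> z \<longleftrightarrow> ker_coker_split \<Lambda> z'"
proof -
  obtain a b where a: "a \<in> mod_iso \<Lambda> (Fmod z) (Fmod z')" and b: "b \<in> mod_iso \<Lambda> (Gmod z) (Gmod z')"
    and ab: "\<And>x. x \<in> carrier (Gmod z) \<Longrightarrow> a (gam z x) = gam z' (b x)"
      "\<And>x. x \<in> carrier (Gmod z) \<Longrightarrow>
        dual_map (Fmod z') (inv_into (carrier (Fmod z)) a) (mu z x) = mu z' (b x)"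
    using iso unfolding strongly_isomorphic_def by blast
  define k where "k = inv_into (carrier (Fmod z)) a"
  define l where "l = inv_into (carrier (Gmod z)) b"
  note k = mod_iso_hom[OF mod_iso_inv[OF F a], folded k_def]
    and l = mod_iso_hom[OF mod_iso_inv[OF G b], folded l_def]
  note ah = mod_iso_hom[OF a] and bh = mod_iso_hom[OF b]
  note inv = bij_betw_inv_into_left[OF mod_iso_bij[OF a], folded k_def]
    bij_betw_inv_into_right[OF mod_iso_bij[OF a], folded k_def]
    bij_betw_inv_into_left[OF mod_iso_bij[OF b], folded l_def]
    bij_betw_inv_into_right[OF mod_iso_bij[OF b], folded l_def]
  note ak = dual_map_hom[OF I F F' ah] and kk = dual_map_hom[OF I F' F k]
  note d = left_module_dual[OF I F] left_module_dual[OF I F']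
  note c = mod_hom_closed[OF \<gamma>] mod_hom_closed[OF \<gamma>'] mod_hom_closed[OF \<mu>] mod_hom_closed[OF \<mu>']
    mod_hom_closed[OF k] mod_hom_closed[OF l] mod_hom_closed[OF ah] mod_hom_closed[OF bh]
    mod_hom_closed[OF ak] mod_hom_closed[OF kk]
  interpret F': left_module \<Lambda> "Fmod z'" by (rule F')
  interpret G': left_module \<Lambda> "Gmod z'" by (rule G')
  interpret dF': left_module \<Lambda> "dual \<Lambda> (Fmod z')" by (rule d(2))
  have kd: "dual_map (Fmod z) a (dual_map (Fmod z') k \<phi>) = \<phi>" if "\<phi> \<in> carrier (dual \<Lambda> (Fmod z))" for \<phi>
    by (rule dual_eqI[where M = "Fmod z" and \<Lambda> = \<Lambda>]) (simp_all add: that c dual_map_apply inv)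
  have dk: "dual_map (Fmod z') k (dual_map (Fmod z) a \<phi>) = \<phi>" if "\<phi> \<in> carrier (dual \<Lambda> (Fmod z'))" for \<phi>
    by (rule dual_eqI[where M = "Fmod z'" and \<Lambda> = \<Lambda>]) (simp_all add: that c dual_map_apply inv)
  have \<gamma>l: "k (gam z' x') = gam z (l x')" if "x' \<in> carrier (Gmod z')" for x'
    using arg_cong[OF ab(1)[of "l x'"], of k] that by (simp add: c inv)
  have \<mu>l: "dual_map (Fmod z) a (mu z' x') = mu z (l x')" if "x' \<in> carrier (Gmod z')" for x'
    using arg_cong[OF ab(2)[of "l x'", folded k_def], of "dual_map (Fmod z) a"] that
    by (simp add: c inv kd)
  have s1: "stabilization \<Lambda> (Gmod z) (Fmod z) (gam z) (Gmod z') (Fmod z') (gam z') b l a k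
    (\<lambda>x. \<zero>\<^bsub>Gmod z'\<^esub>)"
    by (rule stabilization.intro)
      (rule F G F' G' \<gamma> \<gamma>' ah bh k l mod_hom_const_zero[OF F' G']
       | simp add: c inv ab(1) \<gamma>l mod_hom_zero[OF G' F' \<gamma>'] mod_hom_zero[OF G' G l]; fail)+
  have s2: "stabilization \<Lambda> (Gmod z) (dual \<Lambda> (Fmod z)) (mu z) (Gmod z') (dual \<Lambda> (Fmod z')) (mu z') b l
    (dual_map (Fmod z') k) (dual_map (Fmod z) a) (\<lambda>x. \<zero>\<^bsub>Gmod z'\<^esub>)"
    by (rule stabilization.intro)
      (rule d G G' \<mu> \<mu>' bh l ak kk mod_hom_const_zero[OF d(2) G']
       | simp add: c inv ab(2)[folded k_def] \<mu>l kd dk mod_hom_zero[OF G' d(2) \<mu>'] mod_hom_zero[OF G' G l]; fail)+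
  show ?thesis by (rule ker_coker_split_stabilization[OF I s1 s2])
qed

section \<open>Hyperbolic preformations\<close>

lemma hyperbolic_simps:
  "Fmod (hyperbolic \<Lambda> \<epsilon> P) = dsum P (dual \<Lambda> P)" "Gmod (hyperbolic \<Lambda> \<epsilon> P) = dsum P (dual \<Lambda> P)"
  "gam (hyperbolic \<Lambda> \<epsilon> P) = (\<lambda>x. x)"
  "mu (hyperbolic \<Lambda> \<epsilon> P) = (\<lambda>(p, f). \<lambda>(p', f')\<in>carrier (dsum P (dual \<Lambda> P)).
     f p' \<oplus>\<^bsub>\<Lambda>\<^esub> (\<ominus>\<^bsub>\<Lambda>\<^esub> \<epsilon>) \<otimes>\<^bsub>\<Lambda>\<^esub> bar\<^bsub>\<Lambda>\<^esub> (f' p))"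
  by (simp_all add: hyperbolic_def)

lemma hyperbolic_gam_iso: "gam (hyperbolic \<Lambda> \<epsilon> P) \<in>
    mod_iso \<Lambda> (Gmod (hyperbolic \<Lambda> \<epsilon> P)) (Fmod (hyperbolic \<Lambda> \<epsilon> P))"
  by (simp add: hyperbolic_simps mod_iso_def mod_hom_id bij_betw_def)

text \<open>Up to sign \<mu> swaps the two summands, but in its target P appears as its double dual.
  Reflexivity of P therefore gives both injectivity in p and the preimage of a functional.\<close>

lemma hyperbolic_mu_iso:
  fixes \<Lambda> :: "'a involution_ring"
  assumes I: "involution_ring \<Lambda>" and P: "left_module \<Lambda> P" and refl: "reflexive \<Lambda> P"
    and e: "\<ominus>\<^bsub>\<Lambda>\<^esub> \<epsilon> \<in> {\<one>\<^bsub>\<Lambda>\<^esub>, \<ominus>\<^bsub>\<Lambda>\<^esub> \<one>\<^bsub>\<Lambda>\<^esub>}"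
  shows "mu (hyperbolic \<Lambda> \<epsilon> P) \<in>
    mod_iso \<Lambda> (Gmod (hyperbolic \<Lambda> \<epsilon> P)) (dual \<Lambda> (Fmod (hyperbolic \<Lambda> \<epsilon> P)))"
proof -
  interpret L: involution_ring \<Lambda> by fact
  let ?e = "\<ominus>\<^bsub>\<Lambda>\<^esub> \<epsilon>" and ?D = "dsum P (dual \<Lambda> P)" and ?\<mu> = "mu (hyperbolic \<Lambda> \<epsilon> P)"
  interpret P: left_module \<Lambda> P by fact
  note dP = left_module_dual[OF I P]
  interpret dP: left_module \<Lambda> "dual \<Lambda> P" by (rule dP)
  note D = left_module_dsum[OF P dP] and dD = left_module_dual[OF I left_module_dsum[OF P dP]]
  interpret D: left_module \<Lambda> ?D by (rule D)
  interpret dD: left_module \<Lambda> "dual \<Lambda> ?D" by (rule dD)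
  note ec = L.sign_facts(1)[OF e] and eb = L.sign_facts(3)[OF e]
    and ecomm = L.sign_facts(4)[OF e] and ee = L.sign_facts(5)[OF e]
  note [simp] = L.bar_closed L.bar_bar dual_closed ec
  have app: "?\<mu> (p, f) (p', f') = f p' \<oplus>\<^bsub>\<Lambda>\<^esub> ?e \<otimes>\<^bsub>\<Lambda>\<^esub> bar\<^bsub>\<Lambda>\<^esub> (f' p)"
    if "p' \<in> carrier P" "f' \<in> carrier (dual \<Lambda> P)" for p f p' f'
    using that by (simp add: hyperbolic_simps)
  have \<mu>c: "?\<mu> (p, f) \<in> carrier (dual \<Lambda> ?D)"
    if p: "p \<in> carrier P" and f: "f \<in> carrier (dual \<Lambda> P)" for p f
  proof -
    have "(\<lambda>(p', f')\<in>carrier ?D. f p' \<oplus>\<^bsub>\<Lambda>\<^esub> ?e \<otimes>\<^bsub>\<Lambda>\<^esub> bar\<^bsub>\<Lambda>\<^esub> (f' p)) \<in> carrier (dual \<Lambda> ?D)"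
    proof (rule dual_carrierI[OF D])
      fix a x assume a: "a \<in> carrier \<Lambda>" and "x \<in> carrier ?D"
      then obtain p' f' where x: "x = (p', f')" "p' \<in> carrier P" "f' \<in> carrier (dual \<Lambda> P)" by auto
      \<comment> \<open>Linearity on the summand \<open>dual \<Lambda> P\<close> requires the sign
        to commute with scalars.\<close>
      have "?e \<otimes>\<^bsub>\<Lambda>\<^esub> (a \<otimes>\<^bsub>\<Lambda>\<^esub> bar\<^bsub>\<Lambda>\<^esub> (f' p)) = a \<otimes>\<^bsub>\<Lambda>\<^esub> (?e \<otimes>\<^bsub>\<Lambda>\<^esub> bar\<^bsub>\<Lambda>\<^esub> (f' p))"
        using a p x ecomm[OF a] by (simp flip: L.m_assoc)
      then show "(case a \<odot>\<^bsub>?D\<^esub> x of (p', f') \<Rightarrow> f p' \<oplus>\<^bsub>\<Lambda>\<^esub> ?e \<otimes>\<^bsub>\<Lambda>\<^esub> bar\<^bsub>\<Lambda>\<^esub> (f' p))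
        = a \<otimes>\<^bsub>\<Lambda>\<^esub> (case x of (p', f') \<Rightarrow> f p' \<oplus>\<^bsub>\<Lambda>\<^esub> ?e \<otimes>\<^bsub>\<Lambda>\<^esub> bar\<^bsub>\<Lambda>\<^esub> (f' p))"
        using a p f x by (simp add: dual_ops dual_smult[OF f] L.bar_mult L.r_distr)
    next
      fix x y assume "x \<in> carrier ?D" "y \<in> carrier ?D"
      then obtain p1 f1 p2 f2 where xy: "x = (p1, f1)" "y = (p2, f2)"
        "p1 \<in> carrier P" "f1 \<in> carrier (dual \<Lambda> P)" "p2 \<in> carrier P" "f2 \<in> carrier (dual \<Lambda> P)" by auto
      then show "(case x \<oplus>\<^bsub>?D\<^esub> y of (p', f') \<Rightarrow> f p' \<oplus>\<^bsub>\<Lambda>\<^esub> ?e \<otimes>\<^bsub>\<Lambda>\<^esub> bar\<^bsub>\<Lambda>\<^esub> (f' p))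
        = (case x of (p', f') \<Rightarrow> f p' \<oplus>\<^bsub>\<Lambda>\<^esub> ?e \<otimes>\<^bsub>\<Lambda>\<^esub> bar\<^bsub>\<Lambda>\<^esub> (f' p))
          \<oplus>\<^bsub>\<Lambda>\<^esub> (case y of (p', f') \<Rightarrow> f p' \<oplus>\<^bsub>\<Lambda>\<^esub> ?e \<otimes>\<^bsub>\<Lambda>\<^esub> bar\<^bsub>\<Lambda>\<^esub> (f' p))"
        using p f by (simp add: dual_ops dual_add[OF f] L.bar_add L.r_distr L.a_ac)
    qed (use p f in auto)
    then show ?thesis by (simp add: hyperbolic_simps)
  qed
  have "?\<mu> \<in> mod_iso \<Lambda> ?D (dual \<Lambda> ?D)"
  proof (rule mod_isoI'[OF D dD])
    show "?\<mu> \<in> mod_hom \<Lambda> ?D (dual \<Lambda> ?D)"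
    proof (rule mod_homI)
      fix v assume "v \<in> carrier ?D"
      then obtain p f where v: "v = (p, f)" and p: "p \<in> carrier P" and f: "f \<in> carrier (dual \<Lambda> P)" by auto
      show "?\<mu> v \<in> carrier (dual \<Lambda> ?D)" unfolding v by (rule \<mu>c[OF p f])
      show "?\<mu> (v \<oplus>\<^bsub>?D\<^esub> w) = ?\<mu> v \<oplus>\<^bsub>dual \<Lambda> ?D\<^esub> ?\<mu> w" if w': "w \<in> carrier ?D" for w
      proof -
        obtain q g where w: "w = (q, g)" and q: "q \<in> carrier P" and g: "g \<in> carrier (dual \<Lambda> P)"
          using w' by auto
        show ?thesis
        proof (rule dual_eqI[where M = ?D and \<Lambda> = \<Lambda>])
          fix x assume "x \<in> carrier ?D"
          then obtain p' f' where x: "x = (p', f')" "p' \<in> carrier P" "f' \<in> carrier (dual \<Lambda> P)" by auto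
          show "?\<mu> (v \<oplus>\<^bsub>?D\<^esub> w) x = (?\<mu> v \<oplus>\<^bsub>dual \<Lambda> ?D\<^esub> ?\<mu> w) x"
            using x(2,3) p f q g
            by (simp add: v w x(1) dual_ops app dual_add[OF x(3)] L.bar_add L.r_distr L.a_ac)
        qed (use p f q g in \<open>simp_all add: v w \<mu>c\<close>)
      qed
      show "?\<mu> (a \<odot>\<^bsub>?D\<^esub> v) = a \<odot>\<^bsub>dual \<Lambda> ?D\<^esub> ?\<mu> v" if a: "a \<in> carrier \<Lambda>" for a
      proof (rule dual_eqI[where M = ?D and \<Lambda> = \<Lambda>])
        fix x assume "x \<in> carrier ?D"
        then obtain p' f' where x: "x = (p', f')" "p' \<in> carrier P" "f' \<in> carrier (dual \<Lambda> P)" by auto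
        show "?\<mu> (a \<odot>\<^bsub>?D\<^esub> v) x = (a \<odot>\<^bsub>dual \<Lambda> ?D\<^esub> ?\<mu> v) x"
          using x(2,3) p f a
          by (simp add: v x(1) dual_ops app dual_smult[OF x(3)] L.bar_mult L.l_distr L.m_assoc)
      qed (use p f a in \<open>simp_all add: v \<mu>c P.smult_closed dP.smult_closed dD.smult_closed\<close>)
    qed
  next
    fix v assume "v \<in> carrier ?D" and z: "?\<mu> v = \<zero>\<^bsub>dual \<Lambda> ?D\<^esub>"
    then obtain p f where v: "v = (p, f)" and p: "p \<in> carrier P" and f: "f \<in> carrier (dual \<Lambda> P)" by auto
    have 0: "f p' \<oplus>\<^bsub>\<Lambda>\<^esub> ?e \<otimes>\<^bsub>\<Lambda>\<^esub> bar\<^bsub>\<Lambda>\<^esub> (f' p) = \<zero>\<^bsub>\<Lambda>\<^esub>"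
      if "p' \<in> carrier P" "f' \<in> carrier (dual \<Lambda> P)" for p' f'
      using fun_cong[OF z, of "(p', f')"] that by (simp add: v app dual_ops)
    \<comment> \<open>Testing at f' = 0 isolates f; testing at p' = 0 isolates bar (f' p).\<close>
    have "f = \<zero>\<^bsub>dual \<Lambda> P\<^esub>"
    proof (rule dual_eqI[where M = P and \<Lambda> = \<Lambda>, OF f dP.M.zero_closed])
      fix p' assume p': "p' \<in> carrier P"
      show "f p' = \<zero>\<^bsub>dual \<Lambda> P\<^esub> p'"
        using 0[OF p' dP.M.zero_closed] p p' f by (simp add: dual_ops L.bar_zero)
    qed
    moreover have "f' p = \<zero>\<^bsub>\<Lambda>\<^esub>" if f': "f' \<in> carrier (dual \<Lambda> P)" for f'
    proof -
      have "?e \<otimes>\<^bsub>\<Lambda>\<^esub> bar\<^bsub>\<Lambda>\<^esub> (f' p) = \<zero>\<^bsub>\<Lambda>\<^esub>"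
        using 0[OF P.M.zero_closed f'] p f' by (simp add: dual_at_zero[OF P f])
      then have "bar\<^bsub>\<Lambda>\<^esub> (f' p) = \<zero>\<^bsub>\<Lambda>\<^esub>" using ee[of "bar\<^bsub>\<Lambda>\<^esub> (f' p)"] f' p by simp
      then show ?thesis using f' p by (simp add: L.bar_eq_zero_iff)
    qed
    then have "p = \<zero>\<^bsub>P\<^esub>" using refl p by (simp add: reflexive_def)
    ultimately show "v = \<zero>\<^bsub>?D\<^esub>" by (simp add: v)
  next
    fix \<phi> assume \<phi>: "\<phi> \<in> carrier (dual \<Lambda> ?D)"
    define f where "f = dual_map P (\<lambda>x. (x, \<zero>\<^bsub>dual \<Lambda> P\<^esub>)) \<phi>"
    define \<psi> where "\<psi> = dual_map (dual \<Lambda> P) (\<lambda>x. (\<zero>\<^bsub>P\<^esub>, x)) \<phi>"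
    have f: "f \<in> carrier (dual \<Lambda> P)" unfolding f_def by (rule dual_map_closed[OF P inl_hom[OF dP] \<phi>])
    have \<psi>: "\<psi> \<in> carrier (dual \<Lambda> (dual \<Lambda> P))"
      unfolding \<psi>_def by (rule dual_map_closed[OF dP inr_hom[OF P] \<phi>])
    obtain x where x: "x \<in> carrier P" "\<And>f'. f' \<in> carrier (dual \<Lambda> P) \<Longrightarrow> \<psi> f' = bar\<^bsub>\<Lambda>\<^esub> (f' x)"
      using refl \<psi> unfolding reflexive_def by blast
    \<comment> \<open>The scalar e absorbs the sign in \<mu>: e bar (f' (e x)) = bar (f' x), as e is
      central, fixed by bar and squares to one.\<close>
    let ?p = "?e \<odot>\<^bsub>P\<^esub> x"
    have p: "?p \<in> carrier P" using x(1) by (simp add: P.smult_closed)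
    have "?\<mu> (?p, f) = \<phi>"
    proof (rule dual_eqI[where M = ?D and \<Lambda> = \<Lambda>, OF \<mu>c[OF p f] \<phi>])
      fix w assume "w \<in> carrier ?D"
      then obtain p' f' where w: "w = (p', f')" and p': "p' \<in> carrier P" and f': "f' \<in> carrier (dual \<Lambda> P)" by auto
      have "?e \<otimes>\<^bsub>\<Lambda>\<^esub> bar\<^bsub>\<Lambda>\<^esub> (f' ?p) = \<psi> f'"
        using f' x(1) by (simp add: dual_smult[OF f'] L.bar_mult eb ecomm ee x(2))
      then show "?\<mu> (?p, f) w = \<phi> w"
        using p' f' by (simp add: w app dual_dsum_decomp[OF P dP \<phi> p' f'] f_def \<psi>_def dual_map_apply)
    qed
    then show "\<exists>v\<in>carrier ?D. ?\<mu> v = \<phi>" using p f by (intro bexI[of _ "(?p, f)"]) simp_all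
  qed
  then show ?thesis by (simp add: hyperbolic_simps)
qed

section \<open>Ranks and the conclusion\<close>

lemma dsum_free_isomorphic:
  assumes "ring R" "isomorphic R M (free_mod R m)" "isomorphic R N (free_mod R n)"
  shows "isomorphic R (dsum M N) (free_mod R (m + n))"
  by (rule isomorphic_trans[OF isomorphic_dsum[OF assms(2,3)] free_mod_add_isomorphic[OF assms(1)]])

lemma dual_free_isomorphic':
  assumes I: "involution_ring \<Lambda>" and M: "left_module \<Lambda> M" and iso: "isomorphic \<Lambda> M (free_mod \<Lambda> n)"
  shows "isomorphic \<Lambda> (dual \<Lambda> M) (free_mod \<Lambda> n)"
proof -
  interpret involution_ring \<Lambda> by fact
  note F = left_module_free[OF ring_axioms]
  show ?thesis
    by (rule isomorphic_trans[OF isomorphic_dual[OF I M F isomorphic_sym[OF M iso]] dual_free_isomorphic[OF I]])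
qed

theorem mainTheorem1:
  fixes \<Lambda> :: "'a involution_ring" and q :: nat and \<epsilon> :: 'a
    and z :: "('a, 'f, 'g) preform"
    and F :: "('a, 'f) module" and G :: "('a, 'g) module"
    and \<gamma> :: "'g \<Rightarrow> 'f" and \<mu> :: "'g \<Rightarrow> 'f \<Rightarrow> 'a" and \<theta> :: "'g \<Rightarrow> 'a set"
  assumes "involution_ring \<Lambda>" and "weakly_finite \<Lambda>"
    and "\<epsilon> = (\<ominus>\<^bsub>\<Lambda>\<^esub> \<one>\<^bsub>\<Lambda>\<^esub>) [^]\<^bsub>\<Lambda>\<^esub> q"
    and "z = \<lparr>Fmod = F, Gmod = G, gam = \<gamma>, mu = \<mu>, theta = \<theta>\<rparr>"
    and "regular_preformation \<Lambda> \<epsilon> z"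
    and "elementary_class \<Lambda> \<epsilon> (l_class \<Lambda> \<epsilon> z :: ('a, 'f2, 'g2) preform set)"
  shows "isomorphic \<Lambda> (ker_mod G F \<gamma>) (ker_mod G (dual \<Lambda> F) \<mu>)
    \<and> isomorphic \<Lambda> (coker_mod G F \<gamma>) (coker_mod G (dual \<Lambda> F) \<mu>)
    \<and> isomorphic \<Lambda> (ker_mod G (dual \<Lambda> G) (dual_map G \<gamma> \<circ> \<mu>))
        (dsum (ker_mod G F \<gamma>) (ker_mod (dual \<Lambda> F) (dual \<Lambda> G) (dual_map G \<gamma>)))
    \<and> isomorphic \<Lambda> (coker_mod G (dual \<Lambda> G) (dual_map G \<gamma> \<circ> \<mu>))
        (dsum (coker_mod G F \<gamma>) (coker_mod (dual \<Lambda> F) (dual \<Lambda> G) (dual_map G \<gamma>)))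
    \<and> even (rank \<Lambda> F)"
proof -
  note I = assms(1)
  interpret L: involution_ring \<Lambda> by fact
  have "\<epsilon> \<in> {\<one>\<^bsub>\<Lambda>\<^esub>, \<ominus>\<^bsub>\<Lambda>\<^esub> \<one>\<^bsub>\<Lambda>\<^esub>}"
    unfolding assms(3) by (induction q) (auto simp: L.l_minus L.r_minus)
  then have e: "\<ominus>\<^bsub>\<Lambda>\<^esub> \<epsilon> \<in> {\<one>\<^bsub>\<Lambda>\<^esub>, \<ominus>\<^bsub>\<Lambda>\<^esub> \<one>\<^bsub>\<Lambda>\<^esub>}" by auto
  obtain z' :: "('a, 'f2, 'g2) preform" where reg': "regular_preformation \<Lambda> \<epsilon> z'"
    and stable: "stably_strongly_isomorphic \<Lambda> \<epsilon> z z'" and el: "elementary_preformation \<Lambda> \<epsilon> z'"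
    using assms(6) unfolding elementary_class_def l_class_def by blast
  obtain P P' :: "('a, nat \<Rightarrow> 'a) module" where P: "fg_free_mod \<Lambda> P" and P': "fg_free_mod \<Lambda> P'"
    and iso: "strongly_isomorphic \<Lambda>
      (preform_sum \<Lambda> z (hyperbolic \<Lambda> \<epsilon> P)) (preform_sum \<Lambda> z' (hyperbolic \<Lambda> \<epsilon> P'))"
    using stable unfolding stably_strongly_isomorphic_def by blast
  have h: "left_module \<Lambda> (Fmod z)" "left_module \<Lambda> (Gmod z)" "gam z \<in> mod_hom \<Lambda> (Gmod z) (Fmod z)"
    "mu z \<in> mod_hom \<Lambda> (Gmod z) (dual \<Lambda> (Fmod z))"
    using assms(5) by (auto simp: regular_preformation_def split_preformation_def fg_free_mod_def)
  have h': "left_module \<Lambda> (Fmod z')" "left_module \<Lambda> (Gmod z')" "gam z' \<in> mod_hom \<Lambda> (Gmod z') (Fmod z')"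
    "mu z' \<in> mod_hom \<Lambda> (Gmod z') (dual \<Lambda> (Fmod z'))"
    using reg' by (auto simp: regular_preformation_def split_preformation_def fg_free_mod_def)
  obtain p where Pm: "left_module \<Lambda> P" and p: "isomorphic \<Lambda> P (free_mod \<Lambda> p)"
    using P by (auto simp: fg_free_mod_def)
  obtain p' where Pm': "left_module \<Lambda> P'" and p': "isomorphic \<Lambda> P' (free_mod \<Lambda> p')"
    using P' by (auto simp: fg_free_mod_def)
  note hy = left_module_dsum[OF Pm left_module_dual[OF I Pm], folded hyperbolic_simps(1)[of \<Lambda> \<epsilon>]]
    left_module_dsum[OF Pm left_module_dual[OF I Pm], folded hyperbolic_simps(2)[of \<Lambda> \<epsilon>]]
    hyperbolic_gam_iso hyperbolic_mu_iso[OF I Pm fg_free_reflexive[OF I P] e]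
  note hy' = left_module_dsum[OF Pm' left_module_dual[OF I Pm'], folded hyperbolic_simps(1)[of \<Lambda> \<epsilon>]]
    left_module_dsum[OF Pm' left_module_dual[OF I Pm'], folded hyperbolic_simps(2)[of \<Lambda> \<epsilon>]]
    hyperbolic_gam_iso hyperbolic_mu_iso[OF I Pm' fg_free_reflexive[OF I P'] e]
  note sum = preform_sum_homs[OF I h hy] and sum' = preform_sum_homs[OF I h' hy']
  have "split_preformation \<Lambda> \<epsilon> z'" using reg' by (simp add: regular_preformation_def)
  then obtain U \<tau> \<sigma> where lag: "lagrangian \<Lambda> (Fmod z') (Gmod z') (gam z') (mu z') (\<ominus>\<^bsub>\<Lambda>\<^esub> \<epsilon>) U \<tau> \<sigma>"
    and free: "fg_free_mod \<Lambda> (restr_mod (Gmod z') U)"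
    by (rule elementary_lagrangian[OF I _ e el])
  interpret E: lagrangian \<Lambda> "Fmod z'" "Gmod z'" "gam z'" "mu z'" "\<ominus>\<^bsub>\<Lambda>\<^esub> \<epsilon>" U \<tau> \<sigma> by (rule lag)
  have "ker_coker_split \<Lambda> z'"
    unfolding ker_coker_split_def Let_def
    by (intro conjI E.ker_\<gamma>_\<mu> E.coker_\<gamma>_\<mu> E.ker_\<gamma>'\<mu> E.coker_\<gamma>'\<mu>)
  \<comment> \<open>The property is carried up to the stabilisation of z', across the strong
    isomorphism, and down to z.\<close>
  then have "ker_coker_split \<Lambda> (preform_sum \<Lambda> z' (hyperbolic \<Lambda> \<epsilon> P'))"
    by (simp only: ker_coker_split_sum[OF I h' hy', symmetric])
  then have "ker_coker_split \<Lambda> (preform_sum \<Lambda> z (hyperbolic \<Lambda> \<epsilon> P))"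
    by (simp only: ker_coker_split_strongly_isomorphic[OF I sum sum' iso])
  then have "ker_coker_split \<Lambda> z"
    by (simp only: ker_coker_split_sum[OF I h hy])
  moreover have "even (rank \<Lambda> (Fmod z))"
  \<comment> \<open>Ranks can be compared only over a nonzero ring.\<close>
  proof (cases "\<one>\<^bsub>\<Lambda>\<^esub> = \<zero>\<^bsub>\<Lambda>\<^esub>")
    case True
    then show ?thesis using rank_trivial_ring[OF L.ring_axioms True h(1)] by simp
  next
    case False
    obtain m where m: "isomorphic \<Lambda> (Fmod z) (free_mod \<Lambda> m)"
      using assms(5) by (auto simp: regular_preformation_def split_preformation_def fg_free_mod_def)
    obtain n where n: "isomorphic \<Lambda> (restr_mod (Gmod z') U) (free_mod \<Lambda> n)"
      using free by (auto simp: fg_free_mod_def)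
    note D = dsum_free_isomorphic[OF L.ring_axioms]
    have "isomorphic \<Lambda> (Fmod z') (free_mod \<Lambda> (n + n))"
      by (rule isomorphic_trans[OF E.F_decomposition D[OF n dual_free_isomorphic'[OF I E.H n]]])
    from D[OF this D[OF p' dual_free_isomorphic'[OF I Pm' p']]]
    have 1: "isomorphic \<Lambda> (Fmod (preform_sum \<Lambda> z' (hyperbolic \<Lambda> \<epsilon> P'))) (free_mod \<Lambda> (n + n + (p' + p')))"
      by (simp only: preform_sum_simps hyperbolic_simps)
    from D[OF m D[OF p dual_free_isomorphic'[OF I Pm p]]]
    have 2: "isomorphic \<Lambda> (Fmod (preform_sum \<Lambda> z (hyperbolic \<Lambda> \<epsilon> P))) (free_mod \<Lambda> (m + (p + p)))"
      by (simp only: preform_sum_simps hyperbolic_simps)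
    have "isomorphic \<Lambda> (Fmod (preform_sum \<Lambda> z (hyperbolic \<Lambda> \<epsilon> P)))
        (Fmod (preform_sum \<Lambda> z' (hyperbolic \<Lambda> \<epsilon> P')))"
      using iso unfolding strongly_isomorphic_def by (blast intro: isomorphicI)
    from isomorphic_trans[OF this 1]
    have "isomorphic \<Lambda> (free_mod \<Lambda> (m + (p + p))) (free_mod \<Lambda> (n + n + (p' + p')))"
      by (rule isomorphic_trans[OF isomorphic_sym[OF sum(1) 2]])
    then have "m + (p + p) = n + n + (p' + p')"
      by (rule free_mod_rank_unique[OF L.ring_axioms assms(2) False])
    then have "even m" by presburger
    then show ?thesis by (simp add: rank_eqI[OF L.ring_axioms assms(2) False h(1) m])
  qed
  ultimately show ?thesis by (simp add: ker_coker_split_def assms(4))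
qed

end
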